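(* Let $k$ be an algebraically closed field of characteristic $p \ge 0$ and let $C$ be a (reduced, irreducible) smooth projective curve over $k$. Assume that there exist two finite subgroups $G_1$ and $G_2$ of the full automorphism group $\mathrm{Aut}(C)$ such that $G_1 \cap G_2=\{1\}$ and $C/G_i \cong \mathbb{P}^1$ for $i=1,2$. Let $f$ and $g$ be generators (over $k$) of the function fields of $C/G_1$ and $C/G_2$, respectively, regarded as elements of $k(C)$. Then the rational map $$\varphi: C \dashrightarrow \mathbb{P}^2, \quad \varphi=(f:g:1),$$ is birational onto its image, and the two points $P_1=(0:1:0)$ and $P_2=(1:0:0)$ are Galois points for $\varphi(C)$.
   Context: For a finite subgroup $G$ of $\mathrm{Aut}(C)$, the function field $k(C/G)$ is identified with the fixed field $k(C)^{G} \subset k(C)$. Let $\varphi$ be a rational map from $C$ to $\mathbb{P}^2$ that is birational onto its image $\varphi(C)$. For a point $P \in \mathbb{P}^2$, let $\pi_P$ denote the projection from $P$, which sends a point $Q\neq P$ to the line $\overline{PQ}$, regarded as a point of $\mathbb{P}^1$. The point $P$ (which may or may not lie on $\varphi(C)$, and may be a singular point of it) is called a Galois point for $\varphi(C)$ if the function field extension $k(\varphi(C))/\pi_P^*k(\mathbb{P}^1)$ induced by $\pi_P$ (restricted to $\varphi(C)$) is Galois. *)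

theory Defs
  imports
    "HOL-Computational_Algebra.Polynomial"
    "HOL-Library.Poly_Mapping"
    "HOL-Analysis.Cartesian_Space"
    "HOL-Algebra.Bij"
    "HOL-Algebra.QuotRing"
    "HOL-Algebra.Generated_Fields"
    "HOL-Algebra.Finite_Extensions"
begin

section \<open>Projective space\<close>

text \<open>
  Over a field \<open>'a\<close>, the type \<open>('a, 'n) pspace\<close> is the projective space of dimension
  \<open>CARD('n) - 1\<close>: nonzero vectors of \<open>'a ^ 'n\<close> up to scaling.  The value \<open>pt 0\<close> is junk, so
  every definition below that mentions \<open>pt v\<close> guards against \<open>v = 0\<close>.
\<close>

definition proportional :: "'a::field ^ 'n \<Rightarrow> 'a ^ 'n \<Rightarrow> bool" where
  "proportional v w \<longleftrightarrow> v \<noteq> 0 \<and> w \<noteq> 0 \<and> (\<exists>c. c \<noteq> 0 \<and> w = c *s v)"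

lemma part_equivp_proportional: "part_equivp (proportional :: 'a::field ^ 'n \<Rightarrow> 'a ^ 'n \<Rightarrow> bool)"
proof (rule part_equivpI)
  have "proportional (1 :: 'a ^ 'n) 1"
    unfolding proportional_def by (auto simp: vec_eq_iff intro!: exI[of _ 1])
  then show "\<exists>v. proportional (v :: 'a ^ 'n) v" ..
  show "symp (proportional :: 'a ^ 'n \<Rightarrow> _)"
  proof (rule sympI)
    fix v w :: "'a ^ 'n"
    assume "proportional v w"
    then obtain c where c: "v \<noteq> 0" "w \<noteq> 0" "c \<noteq> 0" "w = c *s v"
      unfolding proportional_def by blast
    then have "v = inverse c *s w" by (simp add: vec_eq_iff)
    with c show "proportional w v"
      unfolding proportional_def by (metis nonzero_imp_inverse_nonzero)
  qed
  show "transp (proportional :: 'a ^ 'n \<Rightarrow> _)"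
  proof (rule transpI)
    fix u v w :: "'a ^ 'n"
    assume "proportional u v" "proportional v w"
    then obtain c d where "u \<noteq> 0" "w \<noteq> 0" "c \<noteq> 0" "d \<noteq> 0" "v = c *s u" "w = d *s v"
      unfolding proportional_def by blast
    then have "w = (d * c) *s u" "d * c \<noteq> 0" by (simp_all add: vec_eq_iff mult.assoc)
    with \<open>u \<noteq> 0\<close> \<open>w \<noteq> 0\<close> show "proportional u w"
      unfolding proportional_def by blast
  qed
qed

quotient_type (overloaded) ('a, 'n) pspace = "('a::field) ^ ('n::finite)" / partial: proportional
  morphisms rep_pspace pt
  by (rule part_equivp_proportional)

lemma pt_eq_iff:
  assumes "v \<noteq> 0" "w \<noteq> 0"
  shows "pt v = pt w \<longleftrightarrow> (\<exists>c. c \<noteq> 0 \<and> w = c *s v)"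
proof -
  have refl: "proportional u u" if "u \<noteq> 0" for u :: "'a ^ 'b"
    using that unfolding proportional_def by (auto intro!: exI[of _ 1])
  have "pt v = pt w \<longleftrightarrow> proportional v w"
    using Quotient_rel[OF Quotient_pspace, of v w] refl assms by auto
  then show ?thesis
    using assms unfolding proportional_def by blast
qed


section \<open>Homogeneous polynomials and the Zariski topology\<close>

type_synonym ('a, 'n) mpol = "('n \<Rightarrow>\<^sub>0 nat) \<Rightarrow>\<^sub>0 'a"

definition peval :: "('a::field, 'n::finite) mpol \<Rightarrow> 'a ^ 'n \<Rightarrow> 'a" where
  "peval F v = (\<Sum>m\<in>Poly_Mapping.keys F.
     Poly_Mapping.lookup F m * (\<Prod>i\<in>UNIV. (v $ i) ^ Poly_Mapping.lookup m i))"

text \<open>The vector of formal partial derivatives of \<open>F\<close>, evaluated at \<open>v\<close>.\<close>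

definition gradient :: "('a::field, 'n::finite) mpol \<Rightarrow> 'a ^ 'n \<Rightarrow> 'a ^ 'n" where
  "gradient F v = (\<chi> i. \<Sum>m\<in>Poly_Mapping.keys F.
     Poly_Mapping.lookup F m * of_nat (Poly_Mapping.lookup m i)
       * (v $ i) ^ (Poly_Mapping.lookup m i - 1)
       * (\<Prod>j\<in>UNIV - {i}. (v $ j) ^ Poly_Mapping.lookup m j))"

definition homogeneous :: "nat \<Rightarrow> ('a::field, 'n::finite) mpol \<Rightarrow> bool" where
  "homogeneous d F \<longleftrightarrow>
     (\<forall>m\<in>Poly_Mapping.keys F. (\<Sum>i\<in>UNIV. Poly_Mapping.lookup m i) = d)"

definition forms :: "('a::field, 'n::finite) mpol set" where
  "forms = {F. \<exists>d. homogeneous d F}"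

definition zero_locus :: "('a::field, 'n::finite) mpol set \<Rightarrow> ('a, 'n) pspace set" where
  "zero_locus S = {P. \<forall>F\<in>S. \<forall>v. v \<noteq> 0 \<and> pt v = P \<longrightarrow> peval F v = 0}"

definition zclosed :: "('a::field, 'n::finite) pspace set \<Rightarrow> bool" where
  "zclosed V \<longleftrightarrow> (\<exists>S\<subseteq>forms. V = zero_locus S)"

definition zclosure :: "('a::field, 'n::finite) pspace set \<Rightarrow> ('a, 'n) pspace set" where
  "zclosure V = \<Inter>{Z. zclosed Z \<and> V \<subseteq> Z}"

definition zopen_in :: "('a::field, 'n::finite) pspace set \<Rightarrow> ('a, 'n) pspace set \<Rightarrow> bool" where
  "zopen_in V U \<longleftrightarrow> (\<exists>Z. zclosed Z \<and> U = V - Z)"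

definition projective_variety :: "('a::field, 'n::finite) pspace set \<Rightarrow> bool" where
  "projective_variety V \<longleftrightarrow> zclosed V \<and> V \<noteq> {} \<and>
     (\<forall>A B. zclosed A \<and> zclosed B \<and> V \<subseteq> A \<union> B \<longrightarrow> V \<subseteq> A \<or> V \<subseteq> B)"

definition irreducible_chain ::
    "('a::field, 'n::finite) pspace set \<Rightarrow> nat \<Rightarrow> (nat \<Rightarrow> ('a, 'n) pspace set) \<Rightarrow> bool" where
  "irreducible_chain V d Z \<longleftrightarrow>
     (\<forall>i\<le>d. projective_variety (Z i) \<and> Z i \<subseteq> V) \<and> (\<forall>i<d. Z i \<subset> Z (Suc i))"

definition has_dimension :: "('a::field, 'n::finite) pspace set \<Rightarrow> nat \<Rightarrow> bool" where
  "has_dimension V d \<longleftrightarrow>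
     (\<exists>Z. irreducible_chain V d Z) \<and> (\<nexists>Z. irreducible_chain V (Suc d) Z)"

definition vanishing_forms :: "('a::field, 'n::finite) pspace set \<Rightarrow> ('a, 'n) mpol set" where
  "vanishing_forms V = {F \<in> forms. \<forall>v. v \<noteq> 0 \<and> pt v \<in> V \<longrightarrow> peval F v = 0}"

text \<open>
  Jacobian criterion: a variety of dimension \<open>d\<close> in projective space of dimension
  \<open>CARD('n) - 1\<close> is smooth if the Jacobian matrix of its homogeneous ideal has rank
  \<open>CARD('n) - 1 - d\<close> at every point.
\<close>

definition smooth_of_dimension :: "('a::field, 'n::finite) pspace set \<Rightarrow> nat \<Rightarrow> bool" where
  "smooth_of_dimension V d \<longleftrightarrow> (\<forall>v. v \<noteq> 0 \<and> pt v \<in> V \<longrightarrow>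
     vec.dim ((\<lambda>F. gradient F v) ` vanishing_forms V) + 1 + d = CARD('n))"

definition smooth_projective_curve :: "('a::field, 'n::finite) pspace set \<Rightarrow> bool" where
  "smooth_projective_curve C \<longleftrightarrow>
     projective_variety C \<and> has_dimension C 1 \<and> smooth_of_dimension C 1"


section \<open>Regular functions, morphisms and rational maps\<close>

text \<open>
  Functions and maps on a variety \<open>V\<close> are total functions on the ambient projective space,
  of which only the values on (an open subset of) \<open>V\<close> matter.
\<close>

definition regular_at ::
    "('a::field, 'n::finite) pspace set \<Rightarrow> (('a, 'n) pspace \<Rightarrow> 'a) \<Rightarrow> ('a, 'n) pspace \<Rightarrow> bool" where
  "regular_at V h P \<longleftrightarrow> (\<exists>U d F G. zopen_in V U \<and> P \<in> U \<and> homogeneous d F \<and> homogeneous d G \<and>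
     (\<forall>v. v \<noteq> 0 \<and> pt v \<in> U \<longrightarrow> peval G v \<noteq> 0 \<and> h (pt v) = peval F v / peval G v))"

definition regular_map_at ::
    "('a::field, 'n::finite) pspace set \<Rightarrow> (('a, 'n) pspace \<Rightarrow> ('a, 'm::finite) pspace)
       \<Rightarrow> ('a, 'n) pspace \<Rightarrow> bool" where
  "regular_map_at V \<phi> P \<longleftrightarrow> (\<exists>U d F. zopen_in V U \<and> P \<in> U \<and> (\<forall>j. homogeneous d (F j)) \<and>
     (\<forall>v. v \<noteq> 0 \<and> pt v \<in> U \<longrightarrow>
        (\<chi> j. peval (F j) v) \<noteq> 0 \<and> \<phi> (pt v) = pt (\<chi> j. peval (F j) v)))"

definition morphism ::
    "('a::field, 'n::finite) pspace set \<Rightarrow> ('a, 'm::finite) pspace set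
       \<Rightarrow> (('a, 'n) pspace \<Rightarrow> ('a, 'm) pspace) \<Rightarrow> bool" where
  "morphism V Y \<phi> \<longleftrightarrow> \<phi> ` V \<subseteq> Y \<and> (\<forall>P\<in>V. regular_map_at V \<phi> P)"

definition generically ::
    "('a::field, 'n::finite) pspace set \<Rightarrow> (('a, 'n) pspace \<Rightarrow> bool) \<Rightarrow> bool" where
  "generically V Q \<longleftrightarrow> (\<exists>U. zopen_in V U \<and> U \<noteq> {} \<and> (\<forall>P\<in>U. Q P))"

text \<open>
  A rational map is represented by any total map that agrees with it on some nonempty open
  set; two representatives define the same rational map iff they agree generically.
\<close>

definition rational_map ::
    "('a::field, 'n::finite) pspace set \<Rightarrow> ('a, 'm::finite) pspace set
       \<Rightarrow> (('a, 'n) pspace \<Rightarrow> ('a, 'm) pspace) \<Rightarrow> bool" where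
  "rational_map V Y \<phi> \<longleftrightarrow> generically V (\<lambda>P. regular_map_at V \<phi> P \<and> \<phi> P \<in> Y)"

text \<open>The (closed) image of a rational map; it does not depend on the representative.\<close>

definition rational_image ::
    "('a::field, 'n::finite) pspace set \<Rightarrow> (('a, 'n) pspace \<Rightarrow> ('a, 'm::finite) pspace)
       \<Rightarrow> ('a, 'm) pspace set" where
  "rational_image V \<phi> = zclosure (\<phi> ` {P \<in> V. regular_map_at V \<phi> P})"

definition birational_onto_image ::
    "('a::field, 'n::finite) pspace set \<Rightarrow> (('a, 'n) pspace \<Rightarrow> ('a, 'm::finite) pspace) \<Rightarrow> bool" where
  "birational_onto_image V \<phi> \<longleftrightarrow> rational_map V (rational_image V \<phi>) \<phi> \<and>
     (\<exists>\<psi>. rational_map (rational_image V \<phi>) V \<psi> \<and>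
        generically V (\<lambda>P. \<psi> (\<phi> P) = P) \<and>
        generically (rational_image V \<phi>) (\<lambda>Q. \<phi> (\<psi> Q) = Q))"


section \<open>Function fields\<close>

text \<open>
  The function field of \<open>V\<close>: functions that are regular on a nonempty open subset of \<open>V\<close>,
  modulo agreement on a nonempty open subset.
\<close>

definition generic_ring :: "('a::field, 'n::finite) pspace set \<Rightarrow> (('a, 'n) pspace \<Rightarrow> 'a) ring" where
  "generic_ring V =
     \<lparr>carrier = {h. generically V (regular_at V h)},
      mult = (\<lambda>h h' P. h P * h' P), one = (\<lambda>P. 1),
      zero = (\<lambda>P. 0), add = (\<lambda>h h' P. h P + h' P)\<rparr>"

definition null_ideal :: "('a::field, 'n::finite) pspace set \<Rightarrow> (('a, 'n) pspace \<Rightarrow> 'a) set" where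
  "null_ideal V = {h. generically V (\<lambda>P. h P = 0)}"

definition function_field ::
    "('a::field, 'n::finite) pspace set \<Rightarrow> (('a, 'n) pspace \<Rightarrow> 'a) set ring" where
  "function_field V = generic_ring V Quot null_ideal V"

definition rational_function ::
    "('a::field, 'n::finite) pspace set \<Rightarrow> (('a, 'n) pspace \<Rightarrow> 'a) \<Rightarrow> (('a, 'n) pspace \<Rightarrow> 'a) set" where
  "rational_function V h = null_ideal V +>\<^bsub>generic_ring V\<^esub> h"

definition constants :: "('a::field, 'n::finite) pspace set \<Rightarrow> (('a, 'n) pspace \<Rightarrow> 'a) set set" where
  "constants V = range (\<lambda>a. rational_function V (\<lambda>P. a))"

text \<open>
  Pull-back of a rational function along a dominant rational map \<open>\<phi>\<close> defined on \<open>V\<close>.  All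
  representatives \<open>h\<close> of \<open>c\<close> yield the same coset, so the union is that coset.
\<close>

definition pullback ::
    "('a::field, 'n::finite) pspace set \<Rightarrow> (('a, 'n) pspace \<Rightarrow> ('a, 'm::finite) pspace)
       \<Rightarrow> (('a, 'm) pspace \<Rightarrow> 'a) set \<Rightarrow> (('a, 'n) pspace \<Rightarrow> 'a) set" where
  "pullback V \<phi> c = (\<Union>h\<in>c. rational_function V (h \<circ> \<phi>))"


section \<open>Automorphisms and quotients\<close>

definition Aut_var ::
    "('a::field, 'n::finite) pspace set \<Rightarrow> (('a, 'n) pspace \<Rightarrow> ('a, 'n) pspace) monoid" where
  "Aut_var V = (BijGroup V)
     \<lparr>carrier := {\<sigma> \<in> Bij V. morphism V V \<sigma> \<and> morphism V V (inv_into V \<sigma>)}\<rparr>"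

definition fixed_field ::
    "('a::field, 'n::finite) pspace set \<Rightarrow> (('a, 'n) pspace \<Rightarrow> ('a, 'n) pspace) set
       \<Rightarrow> (('a, 'n) pspace \<Rightarrow> 'a) set set" where
  "fixed_field V G = {c \<in> carrier (function_field V). \<forall>\<sigma>\<in>G. pullback V \<sigma> c = c}"

text \<open>
  \<open>q : V \<rightarrow> Y\<close> exhibits \<open>Y\<close> as the quotient \<open>V / G\<close>: it identifies \<open>Y\<close> with the orbit space,
  with the quotient topology and with the sheaf of \<open>G\<close>-invariant regular functions
  (the \<open>G\<close>-invariant functions on a saturated set being those that factor through \<open>q\<close>).
\<close>

definition is_quotient ::
    "('a::field, 'n::finite) pspace set \<Rightarrow> (('a, 'n) pspace \<Rightarrow> ('a, 'n) pspace) set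
       \<Rightarrow> ('a, 'm::finite) pspace set \<Rightarrow> (('a, 'n) pspace \<Rightarrow> ('a, 'm) pspace) \<Rightarrow> bool" where
  "is_quotient V G Y q \<longleftrightarrow>
     morphism V Y q \<and> q ` V = Y \<and>
     (\<forall>P\<in>V. \<forall>Q\<in>V. q P = q Q \<longleftrightarrow> (\<exists>\<sigma>\<in>G. \<sigma> P = Q)) \<and>
     (\<forall>U\<subseteq>Y. zopen_in Y U \<longleftrightarrow> zopen_in V {P \<in> V. q P \<in> U}) \<and>
     (\<forall>U h. zopen_in Y U \<longrightarrow>
        ((\<forall>Q\<in>U. regular_at Y h Q) \<longleftrightarrow> (\<forall>P\<in>{P \<in> V. q P \<in> U}. regular_at V (h \<circ> q) P)))"

definition quotient_is_P1 ::
    "('a::field, 'n::finite) pspace set \<Rightarrow> (('a, 'n) pspace \<Rightarrow> ('a, 'n) pspace) set \<Rightarrow> bool" where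
  "quotient_is_P1 V G \<longleftrightarrow> (\<exists>q. is_quotient V G (UNIV :: ('a, 2) pspace set) q)"


section \<open>Galois points\<close>

text \<open>
  A Galois extension is an algebraic, normal and separable one: the minimal polynomial over
  \<open>K\<close> of every element splits into distinct linear factors.
\<close>

definition (in Ring.field) galois_over :: "'a set \<Rightarrow> bool" where
  "galois_over K \<longleftrightarrow> subfield K R \<and>
     (\<forall>x\<in>carrier R. (algebraic over K) x \<and> splitted (Irr K x) \<and>
        (\<forall>y\<in>carrier R. alg_mult (Irr K x) y \<le> 1))"

text \<open>
  The lines through \<open>P\<close> are parametrized by the projective line via a linear map with kernel
  \<open>P\<close>; such maps differ by an automorphism of the projective line.  The value \<open>\<pi> P\<close> is
  arbitrary.
\<close>

definition projection_from ::
    "('a::field, 3) pspace \<Rightarrow> (('a, 3) pspace \<Rightarrow> ('a, 2) pspace) \<Rightarrow> bool" where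
  "projection_from P \<pi> \<longleftrightarrow> (\<exists>A :: 'a ^ 3 ^ 2. \<forall>v. v \<noteq> 0 \<longrightarrow>
     (A *v v = 0 \<longleftrightarrow> pt v = P) \<and> (pt v \<noteq> P \<longrightarrow> \<pi> (pt v) = pt (A *v v)))"

definition galois_point :: "('a::field, 3) pspace set \<Rightarrow> ('a, 3) pspace \<Rightarrow> bool" where
  "galois_point V P \<longleftrightarrow> (\<exists>\<pi>. projection_from P \<pi> \<and>
     rational_map V UNIV \<pi> \<and> rational_image V \<pi> = UNIV \<and>
     Ring.field (function_field V) \<and>
     field.galois_over (function_field V)
       (pullback V \<pi> ` carrier (function_field (UNIV :: ('a, 2) pspace set))))"

definition plane_map ::
    "(('a::field, 'n::finite) pspace \<Rightarrow> 'a) \<Rightarrow> (('a, 'n) pspace \<Rightarrow> 'a)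
       \<Rightarrow> ('a, 'n) pspace \<Rightarrow> ('a, 3) pspace" where
  "plane_map f g P = pt (vector [f P, g P, 1])"

end

theory Submission
  imports Defs
begin

text \<open>
  Let \<open>K = k(C)\<close>.  If \<open>x \<in> K\<close> has no common conjugate under \<open>G1\<close> and \<open>G2\<close> besides itself, then its
  minimal polynomial over \<open>k(f, g)\<close> divides both \<open>\<Prod>(T - \<sigma> x)\<close> over \<open>G1\<close>-conjugates, which lies in
  \<open>k(f)[T]\<close>, and the analogous product for \<open>G2\<close>, so it is \<open>T - x\<close> and \<open>x \<in> k(f, g)\<close>.  Because
  \<open>G1 \<inter> G2 = {1}\<close>, automorphisms act faithfully on \<open>K\<close>, and \<open>k\<close> is infinite, such \<open>x\<close> generate \<open>K\<close>;
  hence \<open>K = k(f, g)\<close>, i.e. pulling back along \<open>\<phi>\<close> identifies \<open>k(\<phi>(C))\<close> with \<open>K\<close>, and \<open>\<phi>\<close> is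
  birational.  The projections from the two points are given by \<open>f\<close> and \<open>g\<close>, so they correspond to
  the extensions \<open>K / K\<^sup>G\<close> for \<open>G = G1, G2\<close>, which are Galois by Artin's theorem.
\<close>

section \<open>Finite families of field endomorphisms\<close>

text \<open>Elements with no unwanted common conjugates are found by varying a scalar. If s and t
  differ at some y, the equation s(x + c y) = t(x + c y) is affine in c, because s and t fix
  \<open>k\<close>, and it excludes at most one c. There are finitely many pairs and
  \<open>k\<close> is infinite, so one x separates all differing pairs at once. For any y, some y +
  c x separates them too, and y = (y + c x) - c x. The isomorphism of \<open>C/G\<close> with the
  projective line enters as the nonconstancy of f and g: an affine coordinate of the line, composed
  with the quotient map, is a nonconstant invariant function, so the fixed field exceeds
  \<open>k\<close>. This is what makes the projections dominant. Rational functions and maps are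
  total functions up to generic equality, so automorphisms of \<open>K\<close> are controlled only
  on its carrier, and identities between them are stated pointwise there. Moreover,
  \<open>galois_point\<close> speaks of the function field of the image, so the group action on
  \<open>K\<close> has to be carried over along the isomorphism induced by the plane map.\<close>

definition fixed_points :: "('a, 'b) ring_scheme \<Rightarrow> ('a \<Rightarrow> 'a) set \<Rightarrow> 'a set" where
  "fixed_points R S = {x \<in> carrier R. \<forall>s\<in>S. s x = x}"

text \<open>The axioms of a finite group action, read modulo agreement on the carrier, since
  \<open>pullback\<close> is uncontrolled elsewhere. Inverses come for free on orbits: an injective
  map of a finite orbit into itself permutes it.\<close>

definition endo_family :: "('a, 'b) ring_scheme \<Rightarrow> ('a \<Rightarrow> 'a) set \<Rightarrow> bool" where
  "endo_family R S \<longleftrightarrow> finite S \<and> S \<subseteq> ring_hom R R \<and>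
     (\<exists>u\<in>S. \<forall>x\<in>carrier R. u x = x) \<and>
     (\<forall>s\<in>S. \<forall>t\<in>S. \<exists>u\<in>S. \<forall>x\<in>carrier R. u x = s (t x))"

section \<open>Polynomials with prescribed simple roots\<close>

context Ring.field
begin

text \<open>The product of the factors \<open>T - a\<close>. Degree and leading coefficient are
  recorded because the uniqueness argument of \<open>monic_eqI\<close> and the notion
  \<open>splitted\<close> depend on them.\<close>

lemma ex_monic_with_roots:
  assumes "finite A" "A \<subseteq> carrier R"
  shows "\<exists>p \<in> carrier (poly_ring R). p \<noteq> [] \<and> roots p = mset_set A \<and> degree p = card A \<and> lead_coeff p = \<one>"
  using assms
proof (induction A rule: finite_induct)
  case empty
  have c: "[\<one>] \<in> carrier (poly_ring R)"
    by (auto simp: univ_poly_def polynomial_def)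
  then show ?case
    using degree_zero_imp_empty_roots[OF c] by (intro bexI[of _ "[\<one>]"]) auto
next
  case (insert a A)
  then obtain p where p: "p \<in> carrier (poly_ring R)" "p \<noteq> []" "roots p = mset_set A"
    "degree p = card A" "lead_coeff p = \<one>" by auto
  have a: "a \<in> carrier R" using insert by auto
  have l: "[\<one>, \<ominus> a] \<in> carrier (poly_ring R)"
    using a by (auto simp: univ_poly_def polynomial_def)
  have pp: "polynomial (carrier R) p" "polynomial (carrier R) [\<one>, \<ominus> a]"
    using p(1) l by (simp_all add: univ_poly_carrier)
  let ?q = "[\<one>, \<ominus> a] \<otimes>\<^bsub>poly_ring R\<^esub> p"
  have q: "?q \<in> carrier (poly_ring R)"
    by (rule monoid.m_closed[OF univ_poly_is_monoid[OF carrier_is_subring] l p(1)])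
  have lc: "lead_coeff ?q = \<one>"
    using poly_mult_lead_coeff[OF carrier_is_subring pp(2,1)] p by (simp add: univ_poly_mult del: poly_mult.simps)
  have deg: "degree ?q = card (insert a A)"
    using poly_mult_degree_eq[OF carrier_is_subring pp(2,1)] p(2,4) insert(1,2)
    by (cases p) (simp_all add: univ_poly_mult del: poly_mult.simps)
  have "?q \<noteq> []" using deg insert by auto
  moreover have "roots ?q = mset_set (insert a A)"
    using poly_mult_degree_one_monic_imp_same_roots[OF a p(1,2)] p(3) insert by simp
  ultimately show ?case using q lc deg by blast
qed

text \<open>Divide q by p. The remainder vanishes on all of A but has degree below
  \<open>card A\<close>, so it is zero; comparing degrees and leading coefficients then makes the
  quotient 1.\<close>

lemma monic_eqI:
  assumes p: "p \<in> carrier (poly_ring R)" "p \<noteq> []" "lead_coeff p = \<one>"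
    and q: "q \<in> carrier (poly_ring R)" "q \<noteq> []" "lead_coeff q = \<one>"
    and deg: "degree p = card A" "degree q = card A"
    and A: "finite A" "A \<subseteq> carrier R" "\<And>a. a \<in> A \<Longrightarrow> eval p a = \<zero>" "\<And>a. a \<in> A \<Longrightarrow> eval q a = \<zero>"
  shows "p = q"
proof -
  note K = carrier_is_subfield
  let ?b = "q pdiv p" and ?r = "q pmod p"
  have c: "?b \<in> carrier (poly_ring R)" "?r \<in> carrier (poly_ring R)"
    using long_division_closed[OF K q(1) p(1)] by auto
  have e: "q = (p \<otimes>\<^bsub>poly_ring R\<^esub> ?b) \<oplus>\<^bsub>poly_ring R\<^esub> ?r"
    by (rule pdiv_pmod[OF K q(1) p(1)])
  interpret P: domain "poly_ring R" by (rule univ_poly_is_domain[OF carrier_is_subring])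
  have "?r = []"
  proof (rule ccontr)
    assume r: "?r \<noteq> []"
    have "A \<subseteq> set_mset (roots ?r)"
    proof
      fix a assume a: "a \<in> A"
      then have aR: "a \<in> carrier R" using A by auto
      note h = eval_is_hom[OF carrier_is_subring aR]
      have "eval q a = eval p a \<otimes> eval ?b a \<oplus> eval ?r a"
        using ring_hom_memE(2)[OF h p(1) c(1)] ring_hom_memE(3)[OF h _ c(2), of "p \<otimes>\<^bsub>poly_ring R\<^esub> ?b"]
          p(1) c e by simp
      then have "eval ?r a = \<zero>"
        using A(3,4)[OF a] ring_hom_memE(1)[OF h c(1)] ring_hom_memE(1)[OF h c(2)] by simp
      then show "a \<in># roots ?r"
        using r aR roots_mem_iff_is_root[OF c(2)] by (simp add: is_root_def)
    qed
    then have "card A \<le> card (set_mset (roots ?r))" by (rule card_mono[OF finite_set_mset])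
    also have "\<dots> \<le> size (roots ?r)"
      using size_mset_mono[OF mset_set_set_mset_msubset[of "roots ?r"]] by simp
    also have "\<dots> \<le> degree ?r" by (rule size_roots_le_degree[OF c(2)])
    also have "\<dots> < card A"
      using pmod_degree[OF K q(1) p(1,2)] r deg by auto
    finally show False by simp
  qed
  with e have "q = (p \<otimes>\<^bsub>poly_ring R\<^esub> ?b) \<oplus>\<^bsub>poly_ring R\<^esub> \<zero>\<^bsub>poly_ring R\<^esub>"
    by (simp add: univ_poly_zero)
  then have e': "q = p \<otimes>\<^bsub>poly_ring R\<^esub> ?b" using c p by simp
  have b0: "?b \<noteq> []"
  proof
    assume "?b = []"
    then have "q = \<zero>\<^bsub>poly_ring R\<^esub>"
      using e' P.r_null[OF p(1)] by (simp add: univ_poly_zero del: poly_mult.simps)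
    then show False using q(2) by (simp add: univ_poly_zero)
  qed
  have pp: "polynomial (carrier R) p" "polynomial (carrier R) ?b"
    using p(1) c(1) by (simp_all add: univ_poly_carrier)
  have "degree q = degree p + degree ?b"
    using poly_mult_degree_eq[OF carrier_is_subring pp] b0 p(2) arg_cong[OF e', of degree]
    by (simp add: univ_poly_mult)
  then have "length ?b = 1" using deg b0 by (cases ?b) auto
  moreover have "lead_coeff ?b = \<one>"
  proof -
    have "lead_coeff ?b \<in> carrier R"
      using polynomial_in_carrier[OF carrier_is_subring pp(2)] b0 by (meson hd_in_set subsetD)
    moreover have "\<one> = lead_coeff p \<otimes> lead_coeff ?b"
      using poly_mult_lead_coeff[OF carrier_is_subring pp p(2) b0] arg_cong[OF e', of hd] q(3)
      by (simp only: univ_poly_mult)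
    ultimately show ?thesis using p(3) by simp
  qed
  ultimately have "?b = [\<one>]" by (cases ?b) auto
  then have "q = p \<otimes>\<^bsub>poly_ring R\<^esub> \<one>\<^bsub>poly_ring R\<^esub>" using e' by (simp add: univ_poly_one)
  then show ?thesis using p(1) by simp
qed

lemma ring_endo_inj:
  assumes "h \<in> ring_hom R R" shows "inj_on h (carrier R)"
  by (rule non_trivial_field_hom_is_inj[OF assms field_axioms field_axioms])

section \<open>Fixed fields, orbit polynomials and Artin's theorem\<close>

lemma subfield_fixed_points:
  assumes "S \<subseteq> ring_hom R R"
  shows "subfield (fixed_points R S) R"
proof (rule subfieldI'[OF subringI])
  have h: "s \<in> ring_hom R R" if "s \<in> S" for s using assms that by auto
  show "fixed_points R S \<subseteq> carrier R" by (auto simp: fixed_points_def)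
  show "\<one> \<in> fixed_points R S" using ring_hom_memE(4)[OF h] by (auto simp: fixed_points_def)
  show "\<ominus> x \<in> fixed_points R S" if "x \<in> fixed_points R S" for x
  proof -
    have "s (\<ominus> x) = \<ominus> x" if s: "s \<in> S" for s
    proof -
      interpret s: ring_hom_ring R R s by (rule ring_hom_ringI2[OF ring_axioms ring_axioms h[OF s]])
      show ?thesis using \<open>x \<in> fixed_points R S\<close> s by (auto simp: fixed_points_def)
    qed
    then show ?thesis using that by (auto simp: fixed_points_def)
  qed
  show "x \<otimes> y \<in> fixed_points R S" if "x \<in> fixed_points R S" "y \<in> fixed_points R S" for x y
  proof -
    have xy: "x \<in> carrier R" "y \<in> carrier R" "\<And>s. s \<in> S \<Longrightarrow> s x = x" "\<And>s. s \<in> S \<Longrightarrow> s y = y"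
      using that by (auto simp: fixed_points_def)
    then have "s (x \<otimes> y) = x \<otimes> y" if "s \<in> S" for s
      using ring_hom_memE(2)[OF h[OF that] xy(1,2)] xy(3,4)[OF that] by simp
    then show ?thesis using xy(1,2) by (simp add: fixed_points_def)
  qed
  show "x \<oplus> y \<in> fixed_points R S" if "x \<in> fixed_points R S" "y \<in> fixed_points R S" for x y
  proof -
    have xy: "x \<in> carrier R" "y \<in> carrier R" "\<And>s. s \<in> S \<Longrightarrow> s x = x" "\<And>s. s \<in> S \<Longrightarrow> s y = y"
      using that by (auto simp: fixed_points_def)
    then have "s (x \<oplus> y) = x \<oplus> y" if "s \<in> S" for s
      using ring_hom_memE(3)[OF h[OF that] xy(1,2)] xy(3,4)[OF that] by simp
    then show ?thesis using xy(1,2) by (simp add: fixed_points_def)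
  qed
  show "inv x \<in> fixed_points R S" if "x \<in> fixed_points R S - {\<zero>}" for x
  proof -
    have x: "x \<in> carrier R" "x \<noteq> \<zero>" "\<And>s. s \<in> S \<Longrightarrow> s x = x" using that by (auto simp: fixed_points_def)
    have i: "inv x \<in> carrier R" "inv x \<otimes> x = \<one>" using x(1,2) field_Units by auto
    have "s (inv x) = inv x" if "s \<in> S" for s
    proof -
      have "s (inv x) \<otimes> x = \<one>"
        using ring_hom_memE(2)[OF h[OF that] i(1) x(1)] ring_hom_memE(4)[OF h[OF that]] i x(3)[OF that] by simp
      then show ?thesis
        using i x ring_hom_memE(1)[OF h[OF that] i(1)] by (metis comm_inv_char m_comm)
    qed
    then show ?thesis using i by (auto simp: fixed_points_def)
  qed
qed

text \<open>The polynomial is the product of \<open>T - a\<close> over the orbit as a set, so a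
  conjugate hit by several s counts once and all roots are simple. Each s permutes the orbit, so
  \<open>map s p\<close> is monic of the same degree with the same roots; it equals p, which makes
  the coefficients fixed.\<close>

lemma orbit_polynomial:
  assumes S: "endo_family R S" and x: "x \<in> carrier R"
  defines "A \<equiv> (\<lambda>s. s x) ` S"
  obtains p where "p \<in> carrier ((fixed_points R S)[X])" "p \<noteq> []" "roots p = mset_set A" "degree p = card A"
proof -
  have fin: "finite A" using S by (auto simp: A_def endo_family_def)
  have h: "s \<in> ring_hom R R" if "s \<in> S" for s using S that by (auto simp: endo_family_def)
  have AR: "A \<subseteq> carrier R" using h x by (auto simp: A_def intro: ring_hom_memE(1))
  obtain p where p: "p \<in> carrier (poly_ring R)" "p \<noteq> []" "roots p = mset_set A" 
    "degree p = card A" "lead_coeff p = \<one>"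
    using ex_monic_with_roots[OF fin AR] by blast
  have root: "eval p a = \<zero>" if "a \<in> A" for a
    using that roots_mem_iff_is_root[OF p(1), of a] p(3) fin by (auto simp: is_root_def)
  have "map s p = p" if s: "s \<in> S" for s
  proof -
    interpret s: ring_hom_ring R R s by (rule ring_hom_ringI2[OF ring_axioms ring_axioms h[OF s]])
    have setp: "set p \<subseteq> carrier R" using p(1) polynomial_in_carrier[OF carrier_is_subring] by (simp add: univ_poly_carrier[symmetric])
    have sA: "s ` A = A"
    proof (rule card_subset_eq[OF fin])
      show "s ` A \<subseteq> A"
      proof
        fix b assume "b \<in> s ` A"
        then obtain t where t: "t \<in> S" "b = s (t x)" by (auto simp: A_def)
        then obtain u where "u \<in> S" "u x = s (t x)" using S s x unfolding endo_family_def by blast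
        then show "b \<in> A" using t(2) by (metis A_def imageI)
      qed
      show "card (s ` A) = card A"
        by (rule card_image) (rule inj_on_subset[OF ring_endo_inj[OF h[OF s]] AR])
    qed
    have hd: "lead_coeff (map s p) = \<one>" using p(2,5) ring_hom_memE(4)[OF h[OF s]] by (simp add: hd_map)
    have "map s p \<in> carrier (poly_ring R)"
      using setp hd by (auto simp: univ_poly_def polynomial_def)
    then show ?thesis
    proof (rule monic_eqI[OF _ _ hd p(1,2,5) _ p(4) fin AR])
      fix b assume "b \<in> A"
      then obtain a where a: "a \<in> A" "b = s a" using sA by auto
      have "eval (map s p) (s a) = s (eval p a)"
        using s.eval_hom'[of a p] a(1) AR setp by auto
      then show "eval (map s p) b = \<zero>" using a root by simp
    qed (use p root in auto)
  qed
  then have "set p \<subseteq> fixed_points R S"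
    using p(1) polynomial_in_carrier[OF carrier_is_subring]
    by (auto simp: fixed_points_def univ_poly_carrier[symmetric] map_idI dest: map_eq_conv[THEN iffD1, of _ p "\<lambda>x. x", simplified])
  then have "p \<in> carrier ((fixed_points R S)[X])"
    using p(2,5) by (auto simp: univ_poly_def polynomial_def)
  then show thesis using that p by blast
qed

text \<open>The minimal polynomial divides every p over L that vanishes at x, and a divisor of a
  polynomial that splits with simple roots inherits both properties.\<close>

lemma Irr_split:
  assumes L: "subfield L R" and p: "p \<in> carrier (L[X])" "p \<noteq> []" "roots p = mset_set A" "degree p = card A"
    and A: "finite A" "x \<in> A" and x: "x \<in> carrier R"
  shows "(algebraic over L) x" "splitted (Irr L x)" "roots (Irr L x) \<subseteq># mset_set A"
proof -
  note Ls = subfieldE(1)[OF L]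
  have pR: "p \<in> carrier (poly_ring R)" by (rule carrier_polynomial_shell[OF Ls p(1)])
  have "eval p x = \<zero>" using roots_mem_iff_is_root[OF pR, of x] p(3) A by (auto simp: is_root_def)
  then show alg: "(algebraic over L) x" using algebraicI[OF p(1,2)] by blast
  have d: "Irr L x pdivides p" by (rule Irr_minimal[OF L x alg p(1)]) fact
  have i: "Irr L x \<in> carrier (poly_ring R)" by (rule carrier_polynomial_shell[OF Ls IrrE(1)[OF L x alg]])
  have "splitted p" using p A by (simp add: splitted_def)
  then show "splitted (Irr L x)" using pdivides_imp_splitted[OF i pR p(2)] d by blast
  show "roots (Irr L x) \<subseteq># mset_set A" using pdivides_imp_roots_incl[OF i pR p(2) d] p by simp
qed

text \<open>Apply \<open>Irr_split\<close> to the orbit polynomial of x over the fixed field. The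
  conclusions are exactly the clauses of \<open>galois_over\<close>; the degree of the extension is
  not computed.\<close>

theorem artin:
  assumes S: "endo_family R S"
  shows "subfield (fixed_points R S) R" 
    "x \<in> carrier R \<Longrightarrow> (algebraic over (fixed_points R S)) x \<and> splitted (Irr (fixed_points R S) x) \<and>
        (\<forall>y\<in>carrier R. alg_mult (Irr (fixed_points R S) x) y \<le> 1)"
proof -
  show L: "subfield (fixed_points R S) R"
    using S by (auto intro: subfield_fixed_points simp: endo_family_def)
  assume x: "x \<in> carrier R"
  obtain u where u: "u \<in> S" "u x = x" using S x by (auto simp: endo_family_def)
  obtain p where p: "p \<in> carrier ((fixed_points R S)[X])" "p \<noteq> []" "roots p = mset_set ((\<lambda>s. s x) ` S)"
    "degree p = card ((\<lambda>s. s x) ` S)"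
    using orbit_polynomial[OF S x] by blast
  have "finite ((\<lambda>s. s x) ` S)" "x \<in> (\<lambda>s. s x) ` S" 
    using u S by (auto simp: endo_family_def image_iff intro!: bexI[of _ u])
  note I = Irr_split[OF L p this x]
  have i: "Irr (fixed_points R S) x \<in> carrier (poly_ring R)"
    by (rule carrier_polynomial_shell[OF subfieldE(1)[OF L] IrrE(1)[OF L x I(1)]])
  have "alg_mult (Irr (fixed_points R S) x) y \<le> 1" for y
    using mset_subset_eq_count[OF I(3), of y] unfolding alg_mult_eq_count_roots[OF i]
    by (metis count_mset_set(1) count_mset_set(2) count_mset_set(3) le_trans zero_le_one order_refl)
  with I show "(algebraic over (fixed_points R S)) x \<and> splitted (Irr (fixed_points R S) x) \<and>
        (\<forall>y\<in>carrier R. alg_mult (Irr (fixed_points R S) x) y \<le> 1)" by blast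
qed

lemma mem_subfield_if_orbits_meet_trivially:
  assumes S: "endo_family R S" and T: "endo_family R T"
    and L: "subfield L R" "fixed_points R S \<subseteq> L" "fixed_points R T \<subseteq> L"
    and x: "x \<in> carrier R" and meet: "\<And>s t. s \<in> S \<Longrightarrow> t \<in> T \<Longrightarrow> s x = t x \<Longrightarrow> s x = x"
  shows "x \<in> L"
proof -
  have mono: "carrier (K[X]) \<subseteq> carrier (L[X])" if "K \<subseteq> L" for K
    using that by (auto simp: univ_poly_def polynomial_def)
  have *: "(algebraic over L) x \<and> splitted (Irr L x) \<and> roots (Irr L x) \<subseteq># mset_set ((\<lambda>s. s x) ` U)" "finite U"
    if U: "endo_family R U" "fixed_points R U \<subseteq> L" for U
  proof -
    obtain u where u: "u \<in> U" "u x = x" using U x by (auto simp: endo_family_def)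
    obtain p where p: "p \<in> carrier ((fixed_points R U)[X])" "p \<noteq> []" "roots p = mset_set ((\<lambda>s. s x) ` U)"
      "degree p = card ((\<lambda>s. s x) ` U)"
      using orbit_polynomial[OF U(1) x] by blast
    have "finite ((\<lambda>s. s x) ` U)" "x \<in> (\<lambda>s. s x) ` U"
      using u U by (auto simp: endo_family_def image_iff intro!: bexI[of _ u])
    with Irr_split[OF L(1) _ p(2-4) this x] p(1) mono[OF U(2)]
    show "(algebraic over L) x \<and> splitted (Irr L x) \<and> roots (Irr L x) \<subseteq># mset_set ((\<lambda>s. s x) ` U)" by blast
    show "finite U" using U by (auto simp: endo_family_def)
  qed
  note s = *[OF S L(2)] and t = *[OF T L(3)]
  note alg = s(1)[THEN conjunct1]
  note Irr = IrrE[OF L(1) x alg]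
  \<comment> \<open>The roots lie in both orbits, which are multiplicity-free and share at most x;
    hence there is at most one root, counted with multiplicity.\<close>
  have "roots (Irr L x) \<subseteq># {#x#}"
  proof (rule mset_subset_eqI)
    fix a
    have "a = x" if "a \<in> (\<lambda>s. s x) ` S" "a \<in> (\<lambda>s. s x) ` T"
      using that meet by auto
    then show "count (roots (Irr L x)) a \<le> count {#x#} a"
      using mset_subset_eq_count[OF s(1)[THEN conjunct2, THEN conjunct2], of a]
        mset_subset_eq_count[OF t(1)[THEN conjunct2, THEN conjunct2], of a] s(2) t(2)
      by (auto simp: count_mset_set' split: if_splits)
  qed
  then have "size (roots (Irr L x)) \<le> 1" using size_mset_mono by fastforce
  then have "degree (Irr L x) \<le> 1" using s(1) by (simp add: splitted_def)
  moreover have "degree (Irr L x) \<ge> 1" by (rule pirreducible_degree[OF L(1) Irr(1,2)])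
  ultimately have "length (Irr L x) = 2" by linarith
  then obtain c d where cd: "Irr L x = [c, d]"
    by (metis (no_types, opaque_lifting) length_0_conv length_Suc_conv numeral_2_eq_2)
  \<comment> \<open>The minimal polynomial is thus \<open>T + d\<close> with d in L, so x =
    -d.\<close>
  have "c = \<one>" "d \<in> L" "d \<in> carrier R"
    using Irr(1,3) cd subringE(1)[OF subfieldE(1)[OF L(1)]] by (auto simp: univ_poly_def polynomial_def)
  moreover from this have "x \<oplus> d = \<zero>" using Irr(4) cd x by simp
  ultimately have "x = \<ominus> d" using x by (metis minus_equality minus_minus a_comm)
  then show ?thesis using \<open>d \<in> L\<close> subringE(5)[OF subfieldE(1)[OF L(1)]] by simp
qed

text \<open>Two distinct affine functions of c agree for at most one c: subtracting the equations
  gives (c - d)(b - b') = 0, and b = b' would force a = a'.\<close>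

lemma affine_eq_unique:
  assumes R: "a \<in> carrier R" "b \<in> carrier R" "a' \<in> carrier R" "b' \<in> carrier R" "c \<in> carrier R" "d \<in> carrier R"
    and c: "a \<oplus> c \<otimes> b = a' \<oplus> c \<otimes> b'" and d: "a \<oplus> d \<otimes> b = a' \<oplus> d \<otimes> b'"
    and ne: "a \<noteq> a' \<or> b \<noteq> b'"
  shows "c = d"
proof -
  have "(c \<ominus> d) \<otimes> (b \<ominus> b') = ((a \<oplus> c \<otimes> b) \<ominus> (a \<oplus> d \<otimes> b)) \<ominus> ((a' \<oplus> c \<otimes> b') \<ominus> (a' \<oplus> d \<otimes> b'))"
    using R by algebra
  also have "\<dots> = \<zero>" unfolding c d using R by algebra
  finally have "c \<ominus> d = \<zero> \<or> b \<ominus> b' = \<zero>"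
    using R by (intro integral) auto
  then show "c = d"
  proof
    assume "b \<ominus> b' = \<zero>"
    then have "b = b'" using R by simp
    then have "a = a'" using c R by simp
    then show ?thesis using ne \<open>b = b'\<close> by blast
  qed (use R in simp)
qed

text \<open>As s and t fix c, the two sides are the affine functions s x + c s y and t x + c t y of
  c. Each pair in I rules out at most one scalar, and k is infinite.\<close>

lemma ex_scalar_avoiding:
  assumes k: "infinite k" "k \<subseteq> carrier R"
    and I: "finite I" and fix_k: "\<And>s t. (s, t) \<in> I \<Longrightarrow> s \<in> ring_hom R R \<and> t \<in> ring_hom R R \<and> (\<forall>c\<in>k. s c = c \<and> t c = c)"
    and xy: "x \<in> carrier R" "y \<in> carrier R"
    and ne: "\<And>s t. (s, t) \<in> I \<Longrightarrow> s x \<noteq> t x \<or> s y \<noteq> t y"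
  obtains c where "c \<in> k" "\<And>s t. (s, t) \<in> I \<Longrightarrow> s (x \<oplus> c \<otimes> y) \<noteq> t (x \<oplus> c \<otimes> y)"
proof -
  define bad where "bad = (\<lambda>(s :: 'a \<Rightarrow> 'a, t :: 'a \<Rightarrow> 'a). {c \<in> k. s (x \<oplus> c \<otimes> y) = t (x \<oplus> c \<otimes> y)})"
  have "finite (bad i)" if i: "i \<in> I" for i
  proof -
    obtain s t where st: "i = (s, t)" by fastforce
    have s: "s \<in> ring_hom R R" and t: "t \<in> ring_hom R R" and f: "\<forall>c\<in>k. s c = c \<and> t c = c"
      using fix_k i st by auto
    have c: "s x \<in> carrier R" "s y \<in> carrier R" "t x \<in> carrier R" "t y \<in> carrier R"
      using s t xy by (auto simp: ring_hom_memE(1))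
    have e: "s x \<oplus> c \<otimes> s y = t x \<oplus> c \<otimes> t y" "c \<in> carrier R" if "c \<in> bad i" for c
    proof -
      have ck: "c \<in> k" "c \<in> carrier R" using that k by (auto simp: bad_def st)
      then have "s (x \<oplus> c \<otimes> y) = s x \<oplus> c \<otimes> s y" "t (x \<oplus> c \<otimes> y) = t x \<oplus> c \<otimes> t y"
        using s t f xy by (simp_all add: ring_hom_memE(2,3))
      then show "s x \<oplus> c \<otimes> s y = t x \<oplus> c \<otimes> t y" "c \<in> carrier R" using that ck by (auto simp: bad_def st)
    qed
    have "c = d" if cd: "c \<in> bad i" "d \<in> bad i" for c d
      by (rule affine_eq_unique[OF c(1,2,3,4) e(2)[OF cd(1)] e(2)[OF cd(2)] e(1)[OF cd(1)] e(1)[OF cd(2)]])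
        (use ne i st in blast)
    then obtain b where "bad i \<subseteq> {b}" by blast
    then show ?thesis by (rule finite_subset) simp
  qed
  then have "infinite (k - (\<Union>i\<in>I. bad i))" using k(1) I by (simp add: Diff_infinite_finite)
  then have "k - (\<Union>i\<in>I. bad i) \<noteq> {}" by (rule infinite_imp_nonempty)
  then obtain c where c: "c \<in> k" "\<And>i. i \<in> I \<Longrightarrow> c \<notin> bad i" by blast
  show thesis
  proof (rule that[OF c(1)])
    fix s t assume "(s, t) \<in> I"
    from c(2)[OF this] c(1) show "s (x \<oplus> c \<otimes> y) \<noteq> t (x \<oplus> c \<otimes> y)" by (simp add: bad_def)
  qed
qed

theorem subfield_eq_carrier:
  assumes S: "endo_family R S" and T: "endo_family R T"
    and L: "subfield L R" "fixed_points R S \<subseteq> L" "fixed_points R T \<subseteq> L"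
    and k: "infinite k" "k \<subseteq> fixed_points R S" "k \<subseteq> fixed_points R T"
    and triv: "\<And>s t. s \<in> S \<Longrightarrow> t \<in> T \<Longrightarrow> \<forall>x\<in>carrier R. s x = t x \<Longrightarrow> \<forall>x\<in>carrier R. s x = x"
  shows "L = carrier R"
proof
  show "L \<subseteq> carrier R" using subringE(1)[OF subfieldE(1)[OF L(1)]] .
  \<comment> \<open>The pairs that have to be separated; a pair outside I agrees on the whole
    carrier and acts trivially by \<open>triv\<close>.\<close>
  define I where "I = {(s, t) \<in> S \<times> T. \<exists>x\<in>carrier R. s x \<noteq> t x}"
  have kR: "k \<subseteq> carrier R" using k by (auto simp: fixed_points_def)
  have finI: "finite I"
    using S T by (auto intro: finite_subset[of _ "S \<times> T"] simp: I_def endo_family_def)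
  have hom: "s \<in> ring_hom R R \<and> t \<in> ring_hom R R \<and> (\<forall>c\<in>k. s c = c \<and> t c = c)" if "(s, t) \<in> I" for s t
    using that S T k(2,3) by (auto simp: I_def endo_family_def fixed_points_def)
  have inL: "x \<in> L" if x: "x \<in> carrier R" "\<And>s t. (s, t) \<in> I \<Longrightarrow> s x \<noteq> t x" for x
  proof (rule mem_subfield_if_orbits_meet_trivially[OF S T L x(1)])
    fix s t assume "s \<in> S" "t \<in> T" "s x = t x"
    then show "s x = x" using x triv[of s t] by (auto simp: I_def)
  qed
  have "\<exists>x\<in>carrier R. \<forall>(s, t)\<in>J. s x \<noteq> t x" if "finite J" "J \<subseteq> I" for J
    using that
  proof (induction J rule: finite_induct)
    case empty
    then show ?case by auto
  next
    case (insert i J)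
    then obtain x where x: "x \<in> carrier R" "\<forall>(s, t)\<in>J. s x \<noteq> t x" by auto
    obtain s t where st: "i = (s, t)" by fastforce
    then obtain y where y: "y \<in> carrier R" "s y \<noteq> t y" using insert by (auto simp: I_def)
    \<comment> \<open>x separates the pairs in J and y separates i, so for every pair of
      \<open>insert i J\<close> at least one of x, y does, which is all that the choice of c
      requires.\<close>
    obtain c where "c \<in> k" "\<And>s t. (s, t) \<in> insert i J \<Longrightarrow> s (x \<oplus> c \<otimes> y) \<noteq> t (x \<oplus> c \<otimes> y)"
      by (rule ex_scalar_avoiding[OF k(1) kR _ _ x(1) y(1), of "insert i J"])
        (use insert x y st hom in auto)
    then show ?case using x y kR by (intro bexI[of _ "x \<oplus> c \<otimes> y"]) auto
  qed
  from this[OF finI order_refl] obtain x where x: "x \<in> carrier R" "\<And>s t. (s, t) \<in> I \<Longrightarrow> s x \<noteq> t x" by auto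
  show "carrier R \<subseteq> L"
  proof
    fix y assume y: "y \<in> carrier R"
    \<comment> \<open>Since x alone separates every pair, y may be arbitrary. Both x and y + c x
      then satisfy \<open>inL\<close>, and y is recovered by subtraction.\<close>
    obtain c where c: "c \<in> k" "\<And>s t. (s, t) \<in> I \<Longrightarrow> s (y \<oplus> c \<otimes> x) \<noteq> t (y \<oplus> c \<otimes> x)"
      by (rule ex_scalar_avoiding[OF k(1) kR finI hom y x(1)]) (use x in auto)
    have cR: "c \<in> carrier R" using c kR by auto
    have "y \<oplus> c \<otimes> x \<in> L" using c y x cR by (intro inL) auto
    moreover have "c \<otimes> x \<in> L"
      using c(1) k(2) L(2) inL[OF x(1)] x(2) subringE(6)[OF subfieldE(1)[OF L(1)]] by blast
    ultimately have "(y \<oplus> c \<otimes> x) \<oplus> \<ominus> (c \<otimes> x) \<in> L"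
      using subringE(5,7)[OF subfieldE(1)[OF L(1)]] by blast
    moreover have "(y \<oplus> c \<otimes> x) \<oplus> \<ominus> (c \<otimes> x) = y" using y x cR by algebra
    ultimately show "y \<in> L" by simp
  qed
qed

end

section \<open>Homogeneous polynomial functions\<close>

definition mono_fun :: "('n::finite \<Rightarrow>\<^sub>0 nat) \<Rightarrow> 'a::field ^ 'n \<Rightarrow> 'a" where
  "mono_fun m v = (\<Prod>i\<in>UNIV. (v $ i) ^ Poly_Mapping.lookup m i)"

text \<open>Zero loci, regular functions and regular maps see a form only through its values.
  Working with the polynomial function makes closure under sums, products and substitution available
  without handling coefficients.\<close>

definition form_fun :: "nat \<Rightarrow> ('a::field ^ 'n::finite \<Rightarrow> 'a) \<Rightarrow> bool" where
  "form_fun d h \<longleftrightarrow> (\<exists>F. homogeneous d F \<and> h = peval F)"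

lemma form_fun_peval: "homogeneous d F \<Longrightarrow> form_fun d (peval F)"
  by (auto simp: form_fun_def)

lemma form_fun_decomp:
  assumes "form_fun d h"
  shows "\<exists>M c. finite M \<and> (\<forall>m\<in>M. (\<Sum>i\<in>UNIV. Poly_Mapping.lookup m i) = d) \<and>
    (\<forall>v. h v = (\<Sum>m\<in>M. c m * mono_fun m v))"
proof -
  obtain F where F: "homogeneous d F" "h = peval F" using assms by (auto simp: form_fun_def)
  then show ?thesis
    by (intro exI[of _ "Poly_Mapping.keys F"] exI[of _ "Poly_Mapping.lookup F"])
      (simp add: homogeneous_def peval_def mono_fun_def)
qed

text \<open>The exponents \<open>e i\<close> may repeat. Equal ones are merged into the coefficient
  b, which can cancel to 0; hence \<open>keys F\<close> is only contained in the set of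
  exponents.\<close>

lemma form_fun_sum_mono:
  fixes e :: "'i \<Rightarrow> ('n::finite \<Rightarrow>\<^sub>0 nat)" and c :: "'i \<Rightarrow> 'a::field"
  assumes "finite I" "\<And>i. i \<in> I \<Longrightarrow> (\<Sum>j\<in>UNIV. Poly_Mapping.lookup (e i) j) = d"
  shows "form_fun d (\<lambda>v. \<Sum>i\<in>I. c i * mono_fun (e i) v)"
proof -
  define b where "b m = (\<Sum>i\<in>{i\<in>I. e i = m}. c i)" for m
  define F where "F = (\<Sum>m\<in>e ` I. Poly_Mapping.single m (b m))"
  have F: "Poly_Mapping.lookup F m = (if m \<in> e ` I then b m else 0)" for m
    unfolding F_def lookup_sum lookup_single when_def using assms(1) by simp
  have k: "Poly_Mapping.keys F \<subseteq> e ` I"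
    by (auto simp: in_keys_iff F split: if_splits)
  have "homogeneous d F" using k assms(2) by (auto simp: homogeneous_def)
  moreover have "peval F v = (\<Sum>i\<in>I. c i * mono_fun (e i) v)" for v
  proof -
    have "peval F v = (\<Sum>m\<in>e ` I. Poly_Mapping.lookup F m * mono_fun m v)"
      unfolding peval_def mono_fun_def using k assms(1)
      by (intro sum.mono_neutral_left) (auto simp: in_keys_iff)
    also have "\<dots> = (\<Sum>m\<in>e ` I. \<Sum>i\<in>{i\<in>I. e i = m}. c i * mono_fun (e i) v)"
      by (intro sum.cong) (auto simp: F b_def sum_distrib_right)
    also have "\<dots> = (\<Sum>i\<in>I. c i * mono_fun (e i) v)"
      by (rule sum.image_gen[symmetric, OF assms(1)])
    finally show ?thesis .
  qed
  ultimately show ?thesis unfolding form_fun_def by (intro exI[of _ F]) (simp add: fun_eq_iff)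
qed

lemma form_fun_zero: "form_fun d (\<lambda>v. 0)"
  using form_fun_sum_mono[of "{}" _ d] by simp

lemma form_fun_const: "form_fun 0 (\<lambda>v. c)"
  using form_fun_sum_mono[of "{()}" "\<lambda>_. 0" 0 "\<lambda>_. c"] by (simp add: mono_fun_def)

lemma form_fun_coord: "form_fun 1 (\<lambda>v. v $ i)"
proof -
  have "mono_fun (Poly_Mapping.single i 1) v = v $ i" for v :: "'a ^ 'b"
  proof -
    have "mono_fun (Poly_Mapping.single i 1) v = (\<Prod>j\<in>UNIV. if j = i then v $ j else 1)"
      unfolding mono_fun_def by (intro prod.cong) (auto simp: lookup_single when_def)
    then show ?thesis by simp
  qed
  then have e: "(\<lambda>v :: 'a ^ 'b. v $ i) = (\<lambda>v. \<Sum>u\<in>{()}. 1 * mono_fun (Poly_Mapping.single i 1) v)" by simp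
  show ?thesis unfolding e
    by (rule form_fun_sum_mono) (simp_all add: lookup_single when_def)
qed

lemma form_fun_add:
  assumes "form_fun d h" "form_fun d h'" shows "form_fun d (\<lambda>v. h v + h' v)"
proof -
  obtain M c where M: "finite M" "\<And>m. m \<in> M \<Longrightarrow> (\<Sum>i\<in>UNIV. Poly_Mapping.lookup m i) = d"
    "\<And>v. h v = (\<Sum>m\<in>M. c m * mono_fun m v)" using form_fun_decomp[OF assms(1)] by blast
  obtain M' c' where M': "finite M'" "\<And>m. m \<in> M' \<Longrightarrow> (\<Sum>i\<in>UNIV. Poly_Mapping.lookup m i) = d"
    "\<And>v. h' v = (\<Sum>m\<in>M'. c' m * mono_fun m v)" using form_fun_decomp[OF assms(2)] by blast
  \<comment> \<open>The index set is a disjoint union because M and M' may share exponents.\<close>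
  have "(\<lambda>v. h v + h' v) = (\<lambda>v. \<Sum>m\<in>M <+> M'. case_sum c c' m * mono_fun (case_sum id id m) v)"
    using M(1,3) M'(1,3) by (simp add: sum.Plus)
  moreover have "form_fun d (\<lambda>v. \<Sum>m\<in>M <+> M'. case_sum c c' m * mono_fun (case_sum id id m) v)"
    by (rule form_fun_sum_mono) (use M M' in auto)
  ultimately show ?thesis by simp
qed

lemma mono_fun_add: "mono_fun (m + m') v = mono_fun m v * mono_fun m' v"
  by (simp add: mono_fun_def lookup_add power_add prod.distrib)

lemma form_fun_mult:
  assumes "form_fun d h" "form_fun e h'" shows "form_fun (d + e) (\<lambda>v. h v * h' v)"
proof -
  obtain M c where M: "finite M" "\<And>m. m \<in> M \<Longrightarrow> (\<Sum>i\<in>UNIV. Poly_Mapping.lookup m i) = d"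
    "\<And>v. h v = (\<Sum>m\<in>M. c m * mono_fun m v)" using form_fun_decomp[OF assms(1)] by blast
  obtain M' c' where M': "finite M'" "\<And>m. m \<in> M' \<Longrightarrow> (\<Sum>i\<in>UNIV. Poly_Mapping.lookup m i) = e"
    "\<And>v. h' v = (\<Sum>m\<in>M'. c' m * mono_fun m v)" using form_fun_decomp[OF assms(2)] by blast
  have "h v * h' v = (\<Sum>p\<in>M \<times> M'. (c (fst p) * c' (snd p)) * mono_fun (fst p + snd p) v)" for v
    unfolding M(3) M'(3) sum_product sum.cartesian_product
    by (intro sum.cong) (auto simp: mono_fun_add)
  then show ?thesis
    using form_fun_sum_mono[of "M \<times> M'" "\<lambda>p. fst p + snd p" "d + e" "\<lambda>p. c (fst p) * c' (snd p)"] M(1,2) M'(1,2)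
    by (auto simp: lookup_add sum.distrib)
qed

lemma form_fun_cmult: "form_fun d h \<Longrightarrow> form_fun d (\<lambda>v. c * h v)"
  using form_fun_mult[OF form_fun_const[of c], of d h] by simp

lemma form_fun_diff: "form_fun d h \<Longrightarrow> form_fun d h' \<Longrightarrow> form_fun d (\<lambda>v. h v - h' v)"
  using form_fun_add[of d h "\<lambda>v. - 1 * h' v"] form_fun_cmult[of d h' "- 1"] by simp

lemma form_fun_sum:
  assumes "finite I" "\<And>i. i \<in> I \<Longrightarrow> form_fun d (A i)"
  shows "form_fun d (\<lambda>v. \<Sum>i\<in>I. A i v)"
  using assms by (induction I rule: finite_induct) (simp_all add: form_fun_zero form_fun_add)

lemma form_fun_prod:
  assumes "finite I" "\<And>i. i \<in> I \<Longrightarrow> form_fun (e i) (A i)"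
  shows "form_fun (\<Sum>i\<in>I. e i) (\<lambda>v. \<Prod>i\<in>I. A i v)"
  using assms by (induction I rule: finite_induct) (simp_all add: form_fun_const form_fun_mult)

lemma form_fun_power: "form_fun d h \<Longrightarrow> form_fun (n * d) (\<lambda>v. h v ^ n)"
  by (induction n) (simp_all add: form_fun_const form_fun_mult)

lemma form_fun_compose:
  assumes h: "form_fun d h" and A: "\<And>j. form_fun e (A j)"
  shows "form_fun (d * e) (\<lambda>v. h (\<chi> j. A j v))"
proof -
  obtain M c where M: "finite M" "\<And>m. m \<in> M \<Longrightarrow> (\<Sum>i\<in>UNIV. Poly_Mapping.lookup m i) = d"
    "\<And>v. h v = (\<Sum>m\<in>M. c m * mono_fun m v)" using form_fun_decomp[OF h] by blast
  have "form_fun (d * e) (\<lambda>v. c m * (\<Prod>j\<in>UNIV. A j v ^ Poly_Mapping.lookup m j))" if "m \<in> M" for m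
    using form_fun_cmult[OF form_fun_prod[of UNIV "\<lambda>j. Poly_Mapping.lookup m j * e" "\<lambda>j v. A j v ^ Poly_Mapping.lookup m j"], of "c m"]
      M(2)[OF that] A by (simp add: form_fun_power sum_distrib_right[symmetric])
  then have "form_fun (d * e) (\<lambda>v. \<Sum>m\<in>M. c m * (\<Prod>j\<in>UNIV. A j v ^ Poly_Mapping.lookup m j))"
    by (rule form_fun_sum[OF M(1)])
  then show ?thesis by (simp add: M(3) mono_fun_def)
qed

lemma form_fun_scale:
  assumes "form_fun d h" shows "h (c *s v) = c ^ d * h v"
proof -
  obtain M b where M: "finite M" "\<And>m. m \<in> M \<Longrightarrow> (\<Sum>i\<in>UNIV. Poly_Mapping.lookup m i) = d"
    "\<And>v. h v = (\<Sum>m\<in>M. b m * mono_fun m v)" using form_fun_decomp[OF assms] by blast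
  have "mono_fun m (c *s v) = c ^ d * mono_fun m v" if "m \<in> M" for m
    using M(2)[OF that] by (simp add: mono_fun_def power_mult_distrib prod.distrib power_sum[symmetric])
  then show ?thesis by (simp add: M(3) sum_distrib_left mult.left_commute)
qed

section \<open>Zariski topology\<close>

lemma pt_cases:
  obtains v where "v \<noteq> 0" "P = pt v"
proof -
  have "pt (rep_pspace P) = P" "proportional (rep_pspace P) (rep_pspace P)"
    using Quotient_abs_rep[OF Quotient_pspace] Quotient_rep_reflp[OF Quotient_pspace] by auto
  then show thesis using that by (auto simp: proportional_def)
qed

lemma rep_pspace_nonzero: "rep_pspace P \<noteq> 0" 
  and pt_rep_pspace: "pt (rep_pspace P) = P"
    using Quotient_abs_rep[OF Quotient_pspace] Quotient_rep_reflp[OF Quotient_pspace, of P]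
    by (auto simp: proportional_def)

text \<open>The distinguished open set of a form. For a form the condition does not depend on the
  representative (\<open>pt_in_nz\<close>), by homogeneity.\<close>

definition nz :: "('a::field ^ 'n::finite \<Rightarrow> 'a) \<Rightarrow> ('a, 'n) pspace set" where
  "nz h = {pt v | v. v \<noteq> 0 \<and> h v \<noteq> 0}"

lemma pt_in_nz:
  assumes "form_fun d h" "v \<noteq> 0"
  shows "pt v \<in> nz h \<longleftrightarrow> h v \<noteq> 0"
proof
  assume "pt v \<in> nz h"
  then obtain w where w: "w \<noteq> 0" "h w \<noteq> 0" "pt v = pt w" by (auto simp: nz_def)
  then obtain c where "c \<noteq> 0" "w = c *s v" using pt_eq_iff[OF assms(2) w(1)] by auto
  then show "h v \<noteq> 0" using form_fun_scale[OF assms(1), of c v] w by auto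
qed (use assms in \<open>auto simp: nz_def\<close>)

lemma nz_mult: 
  assumes "form_fun d h" "form_fun e h'"
  shows "nz (\<lambda>v. h v * h' v) = nz h \<inter> nz h'"
proof -
  have "P \<in> nz (\<lambda>v. h v * h' v) \<longleftrightarrow> P \<in> nz h \<inter> nz h'" for P
    by (cases P rule: pt_cases) (simp add: pt_in_nz[OF form_fun_mult[OF assms]] pt_in_nz[OF assms(1)] pt_in_nz[OF assms(2)])
  then show ?thesis by blast
qed

lemma nz_one: "nz (\<lambda>v. 1) = UNIV"
proof -
  have "P \<in> nz (\<lambda>v. 1)" for P :: "('a, 'b) pspace"
    by (cases P rule: pt_cases) (auto simp: nz_def)
  then show ?thesis by blast
qed

text \<open>Distinguished open sets form a basis: Z is closed iff its complement is a union of them.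
  For the converse, the defining equations are all forms that vanish on Z.\<close>

lemma zclosed_iff:
  "zclosed Z \<longleftrightarrow> (\<forall>P. P \<notin> Z \<longrightarrow> (\<exists>d h. form_fun d h \<and> P \<in> nz h \<and> Z \<inter> nz h = {}))"
proof
  assume "zclosed Z"
  then obtain S where S: "S \<subseteq> forms" "Z = zero_locus S" by (auto simp: zclosed_def)
  show "\<forall>P. P \<notin> Z \<longrightarrow> (\<exists>d h. form_fun d h \<and> P \<in> nz h \<and> Z \<inter> nz h = {})"
  proof (intro allI impI)
    fix P assume "P \<notin> Z"
    then obtain F v where F: "F \<in> S" "v \<noteq> 0" "pt v = P" "peval F v \<noteq> 0"
      unfolding S(2) zero_locus_def by blast
    then obtain d where d: "homogeneous d F" using S(1) unfolding forms_def by blast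
    have "Z \<inter> nz (peval F) = {}" using F(1) unfolding S(2) zero_locus_def nz_def by blast
    moreover have "P \<in> nz (peval F)" using F(2-4) unfolding nz_def by blast
    ultimately show "\<exists>d h. form_fun d h \<and> P \<in> nz h \<and> Z \<inter> nz h = {}"
      using form_fun_peval[OF d] by blast
  qed
next
  assume Z: "\<forall>P. P \<notin> Z \<longrightarrow> (\<exists>d h. form_fun d h \<and> P \<in> nz h \<and> Z \<inter> nz h = {})"
  let ?S = "{F \<in> forms. Z \<inter> nz (peval F) = {}}"
  have "P \<in> Z \<longleftrightarrow> P \<in> zero_locus ?S" for P
  proof
    assume "P \<in> Z" then show "P \<in> zero_locus ?S" unfolding zero_locus_def nz_def by blast
  next
    assume P: "P \<in> zero_locus ?S"
    show "P \<in> Z"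
    proof (rule ccontr)
      assume "P \<notin> Z"
      then obtain d h where h: "form_fun d h" "P \<in> nz h" "Z \<inter> nz h = {}" using Z by blast
      then obtain F where F: "homogeneous d F" "h = peval F" unfolding form_fun_def by blast
      then have "F \<in> ?S" using h(3) unfolding forms_def by blast
      moreover obtain v where "v \<noteq> 0" "pt v = P" "peval F v \<noteq> 0"
        using h(2) unfolding F(2) nz_def by blast
      ultimately show False using P unfolding zero_locus_def by blast
    qed
  qed
  then have "Z = zero_locus ?S" by (rule Set.set_eqI)
  moreover have "?S \<subseteq> forms" by simp
  ultimately show "zclosed Z" unfolding zclosed_def by (intro exI[of _ ?S] conjI)
qed

lemma zclosed_compl_nz: "form_fun d h \<Longrightarrow> zclosed (- nz h)"
  unfolding zclosed_iff by blast

lemma zopen_in_iff: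
  "zopen_in V U \<longleftrightarrow> U \<subseteq> V \<and> (\<forall>P\<in>U. \<exists>d h. form_fun d h \<and> P \<in> nz h \<and> V \<inter> nz h \<subseteq> U)"
proof
  assume "zopen_in V U"
  then obtain Z where Z: "zclosed Z" "U = V - Z" by (auto simp: zopen_in_def)
  have "\<exists>d h. form_fun d h \<and> P \<in> nz h \<and> V \<inter> nz h \<subseteq> U" if "P \<in> U" for P
  proof -
    have "P \<notin> Z" using that Z by blast
    then obtain d h where "form_fun d h" "P \<in> nz h" "Z \<inter> nz h = {}"
      using Z(1)[unfolded zclosed_iff, rule_format] by metis
    then show ?thesis using Z(2) by blast
  qed
  then show "U \<subseteq> V \<and> (\<forall>P\<in>U. \<exists>d h. form_fun d h \<and> P \<in> nz h \<and> V \<inter> nz h \<subseteq> U)"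
    using Z(2) by blast
next
  assume U: "U \<subseteq> V \<and> (\<forall>P\<in>U. \<exists>d h. form_fun d h \<and> P \<in> nz h \<and> V \<inter> nz h \<subseteq> U)"
  \<comment> \<open>The complement of the union of all distinguished open sets whose trace on V lies
    in U.\<close>
  define Z where "Z = {P. \<forall>d h. form_fun d h \<longrightarrow> V \<inter> nz h \<subseteq> U \<longrightarrow> P \<notin> nz h}"
  have "zclosed Z" unfolding zclosed_iff
  proof (intro allI impI)
    fix P assume "P \<notin> Z"
    then obtain d h where h: "form_fun d h" "V \<inter> nz h \<subseteq> U" "P \<in> nz h" unfolding Z_def by blast
    then have "Z \<inter> nz h = {}" unfolding Z_def by blast
    with h show "\<exists>d h. form_fun d h \<and> P \<in> nz h \<and> Z \<inter> nz h = {}" by blast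
  qed
  moreover have "U = V - Z"
  proof (rule Set.set_eqI)
    fix P show "P \<in> U \<longleftrightarrow> P \<in> V - Z"
    proof
      assume "P \<in> U"
      then obtain d h where "form_fun d h" "P \<in> nz h" "V \<inter> nz h \<subseteq> U" using U by metis
      then show "P \<in> V - Z" using U \<open>P \<in> U\<close> unfolding Z_def by blast
    next
      assume "P \<in> V - Z" then show "P \<in> U" unfolding Z_def by blast
    qed
  qed
  ultimately show "zopen_in V U" by (auto simp: zopen_in_def)
qed

lemma zopen_in_nz: "form_fun d h \<Longrightarrow> zopen_in V (V \<inter> nz h)"
  unfolding zopen_in_iff by blast

text \<open>Irreducibility in terms of open sets: if the two traces were disjoint, V would be
  covered by two closed complements, and one of them would contain V.\<close>

lemma projective_variety_inter:
  assumes V: "projective_variety V" and h: "form_fun d h" "form_fun e h'"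
    and ne: "V \<inter> nz h \<noteq> {}" "V \<inter> nz h' \<noteq> {}"
  shows "V \<inter> nz (\<lambda>v. h v * h' v) \<noteq> {}"
proof
  assume "V \<inter> nz (\<lambda>v. h v * h' v) = {}"
  then have "V \<subseteq> (- nz h) \<union> (- nz h')" by (auto simp: nz_mult[OF h])
  then show False using V zclosed_compl_nz[OF h(1)] zclosed_compl_nz[OF h(2)] ne
    unfolding projective_variety_def by blast
qed

lemma projective_varietyI:
  assumes "zclosed V" "V \<noteq> {}"
    and inter: "\<And>d h e h'. form_fun d h \<Longrightarrow> form_fun e h' \<Longrightarrow> V \<inter> nz h \<noteq> {} \<Longrightarrow> V \<inter> nz h' \<noteq> {} \<Longrightarrow>
      V \<inter> (nz h \<inter> nz h') \<noteq> {}"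
  shows "projective_variety V"
  unfolding projective_variety_def
proof (intro conjI assms(1,2) allI impI)
  fix A B assume AB: "zclosed A \<and> zclosed B \<and> V \<subseteq> A \<union> B"
  show "V \<subseteq> A \<or> V \<subseteq> B"
  proof (rule ccontr)
    assume "\<not> (V \<subseteq> A \<or> V \<subseteq> B)"
    then obtain P Q where PQ: "P \<in> V" "P \<notin> A" "Q \<in> V" "Q \<notin> B" by blast
    obtain d h where h: "form_fun d h" "P \<in> nz h" "A \<inter> nz h = {}"
      using AB[THEN conjunct1, unfolded zclosed_iff] PQ(2) by metis
    obtain e h' where h': "form_fun e h'" "Q \<in> nz h'" "B \<inter> nz h' = {}"
      using AB[THEN conjunct2, THEN conjunct1, unfolded zclosed_iff] PQ(4) by metis
    have "V \<inter> (nz h \<inter> nz h') \<noteq> {}" by (rule inter[OF h(1) h'(1)]) (use h h' PQ in blast)+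
    then show False using h(3) h'(3) AB by blast
  qed
qed

section \<open>Generic statements on a variety\<close>

lemma generically_iff:
  "generically V Q \<longleftrightarrow> (\<exists>d h. form_fun d h \<and> V \<inter> nz h \<noteq> {} \<and> (\<forall>P\<in>V \<inter> nz h. Q P))"
proof
  assume "generically V Q"
  then obtain U P where U: "zopen_in V U" "P \<in> U" "\<forall>P\<in>U. Q P" by (auto simp: generically_def)
  then obtain d h where "form_fun d h" "P \<in> nz h" "V \<inter> nz h \<subseteq> U" "U \<subseteq> V" unfolding zopen_in_iff by blast
  then show "\<exists>d h. form_fun d h \<and> V \<inter> nz h \<noteq> {} \<and> (\<forall>P\<in>V \<inter> nz h. Q P)" using U by blast
next
  assume "\<exists>d h. form_fun d h \<and> V \<inter> nz h \<noteq> {} \<and> (\<forall>P\<in>V \<inter> nz h. Q P)"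
  then show "generically V Q" unfolding generically_def using zopen_in_nz by blast
qed

lemma generically_mono: "generically V Q \<Longrightarrow> (\<And>P. P \<in> V \<Longrightarrow> Q P \<Longrightarrow> Q' P) \<Longrightarrow> generically V Q'"
  unfolding generically_iff by blast

lemma generically_all:
  assumes "projective_variety V" "\<And>P. P \<in> V \<Longrightarrow> Q P" shows "generically V Q"
  unfolding generically_iff
proof (intro exI conjI)
  show "form_fun 0 (\<lambda>v :: 'a ^ 'b. 1)" by (rule form_fun_const)
qed (use assms in \<open>auto simp: nz_one projective_variety_def\<close>)

text \<open>Irreducibility at work: two nonempty open sets meet. With
  \<open>generically_mono\<close> this lets generic truth be handled like truth on a filter.\<close>

lemma generically_conj:
  assumes V: "projective_variety V" and "generically V Q" "generically V Q'"
  shows "generically V (\<lambda>P. Q P \<and> Q' P)"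
proof -
  obtain d h where h: "form_fun d h" "V \<inter> nz h \<noteq> {}" "\<forall>P\<in>V \<inter> nz h. Q P" using assms(2) unfolding generically_iff by blast
  obtain e h' where h': "form_fun e h'" "V \<inter> nz h' \<noteq> {}" "\<forall>P\<in>V \<inter> nz h'. Q' P" using assms(3) unfolding generically_iff by blast
  show ?thesis unfolding generically_iff
  proof (intro exI conjI)
    show "form_fun (d + e) (\<lambda>v. h v * h' v)" by (rule form_fun_mult[OF h(1) h'(1)])
    show "V \<inter> nz (\<lambda>v. h v * h' v) \<noteq> {}" by (rule projective_variety_inter[OF V h(1) h'(1) h(2) h'(2)])
    show "\<forall>P\<in>V \<inter> nz (\<lambda>v. h v * h' v). Q P \<and> Q' P"
      using h(3) h'(3) unfolding nz_mult[OF h(1) h'(1)] by blast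
  qed
qed

lemma generically_mp:
  assumes "projective_variety V" "generically V Q" "generically V Q'" "\<And>P. P \<in> V \<Longrightarrow> Q P \<Longrightarrow> Q' P \<Longrightarrow> Q'' P"
  shows "generically V Q''"
  using generically_mono[OF generically_conj[OF assms(1-3)]] assms(4) by blast

lemma generically_ball_finite:
  assumes "projective_variety V" "finite I" "\<And>i. i \<in> I \<Longrightarrow> generically V (Q i)"
  shows "generically V (\<lambda>P. \<forall>i\<in>I. Q i P)"
  using assms(2,3)
proof (induction I rule: finite_induct)
  case empty then show ?case by (auto intro: generically_all[OF assms(1)])
next
  case (insert i I)
  then show ?case using generically_conj[OF assms(1), of "Q i" "\<lambda>P. \<forall>i\<in>I. Q i P"] by simp
qed

lemma generically_ex: "generically V Q \<Longrightarrow> \<exists>P\<in>V. Q P"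
  unfolding generically_iff by blast

lemma generically_nz: "form_fun d h \<Longrightarrow> V \<inter> nz h \<noteq> {} \<Longrightarrow> generically V (\<lambda>P. P \<in> nz h)"
  unfolding generically_iff by blast

text \<open>A single fraction suffices. Localize at one regular point, with neighbourhood cut out by
  a form s, and multiply numerator and denominator by s; the domain of validity becomes the
  nonvanishing of the denominator.\<close>

lemma ratfun_iff:
  "generically V (regular_at V h) \<longleftrightarrow> (\<exists>d F G. form_fun d F \<and> form_fun d G \<and> V \<inter> nz G \<noteq> {} \<and>
     (\<forall>v. v \<noteq> 0 \<longrightarrow> pt v \<in> V \<longrightarrow> G v \<noteq> 0 \<longrightarrow> h (pt v) = F v / G v))"
proof
  assume "generically V (regular_at V h)"
  then obtain P where "P \<in> V" "regular_at V h P" using generically_ex by blast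
  then obtain U d F G where U: "zopen_in V U" "P \<in> U" "homogeneous d F" "homogeneous d G"
    "\<forall>v. v \<noteq> 0 \<and> pt v \<in> U \<longrightarrow> peval G v \<noteq> 0 \<and> h (pt v) = peval F v / peval G v"
    unfolding regular_at_def by blast
  then obtain e s where s: "form_fun e s" "P \<in> nz s" "V \<inter> nz s \<subseteq> U" unfolding zopen_in_iff by blast
  note FG = form_fun_peval[OF U(3)] form_fun_peval[OF U(4)]
  have "P \<in> nz (peval G)"
    by (rule pt_cases[of P]) (use U pt_in_nz[OF FG(2)] in auto)
  then have "P \<in> nz (\<lambda>v. peval G v * s v)" using s by (simp add: nz_mult[OF FG(2) s(1)])
  moreover have "h (pt v) = (peval F v * s v) / (peval G v * s v)"
    if "v \<noteq> 0" "pt v \<in> V" "peval G v * s v \<noteq> 0" for v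
    using U(5) s(3) that pt_in_nz[OF s(1) that(1)] by auto
  ultimately show "\<exists>d F G. form_fun d F \<and> form_fun d G \<and> V \<inter> nz G \<noteq> {} \<and>
     (\<forall>v. v \<noteq> 0 \<longrightarrow> pt v \<in> V \<longrightarrow> G v \<noteq> 0 \<longrightarrow> h (pt v) = F v / G v)"
    using form_fun_mult[OF FG(1) s(1)] form_fun_mult[OF FG(2) s(1)] \<open>P \<in> V\<close> by blast
next
  assume "\<exists>d F G. form_fun d F \<and> form_fun d G \<and> V \<inter> nz G \<noteq> {} \<and>
     (\<forall>v. v \<noteq> 0 \<longrightarrow> pt v \<in> V \<longrightarrow> G v \<noteq> 0 \<longrightarrow> h (pt v) = F v / G v)"
  then obtain d F G where FG: "homogeneous d F" "homogeneous d G" "V \<inter> nz (peval G) \<noteq> {}"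
    and h: "\<And>v. v \<noteq> 0 \<Longrightarrow> pt v \<in> V \<Longrightarrow> peval G v \<noteq> 0 \<Longrightarrow> h (pt v) = peval F v / peval G v"
    unfolding form_fun_def by blast
  have "regular_at V h P" if "P \<in> V \<inter> nz (peval G)" for P
    unfolding regular_at_def
  proof (intro exI conjI)
    show "\<forall>v. v \<noteq> 0 \<and> pt v \<in> V \<inter> nz (peval G) \<longrightarrow> peval G v \<noteq> 0 \<and> h (pt v) = peval F v / peval G v"
      using h pt_in_nz[OF form_fun_peval[OF FG(2)]] by blast
  qed (use that FG zopen_in_nz[OF form_fun_peval[OF FG(2)]] in auto)
  then show "generically V (regular_at V h)" using FG form_fun_peval[OF FG(2)] unfolding generically_iff by blast
qed

text \<open>Here the form s that cuts out the neighbourhood stays separate, since homogeneous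
  coordinates have no denominator to absorb it.\<close>

lemma regular_map_at_iff:
  "regular_map_at V \<phi> P \<longleftrightarrow> (\<exists>d A e s. (\<forall>j. form_fun d (A j)) \<and> form_fun e s \<and> P \<in> V \<inter> nz s \<and>
     (\<forall>v. v \<noteq> 0 \<longrightarrow> pt v \<in> V \<longrightarrow> s v \<noteq> 0 \<longrightarrow> (\<chi> j. A j v) \<noteq> 0 \<and> \<phi> (pt v) = pt (\<chi> j. A j v)))"
proof
  assume "regular_map_at V \<phi> P"
  then obtain U d F where U: "zopen_in V U" "P \<in> U" "\<forall>j. homogeneous d (F j)"
    "\<forall>v. v \<noteq> 0 \<and> pt v \<in> U \<longrightarrow> (\<chi> j. peval (F j) v) \<noteq> 0 \<and> \<phi> (pt v) = pt (\<chi> j. peval (F j) v)"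
    unfolding regular_map_at_def by blast
  then obtain e s where s: "form_fun e s" "P \<in> nz s" "V \<inter> nz s \<subseteq> U" "U \<subseteq> V" unfolding zopen_in_iff by blast
  have v: "pt v \<in> U" if "v \<noteq> 0" "pt v \<in> V" "s v \<noteq> 0" for v using that s pt_in_nz[OF s(1) that(1)] by blast
  show "\<exists>d A e s. (\<forall>j. form_fun d (A j)) \<and> form_fun e s \<and> P \<in> V \<inter> nz s \<and>
     (\<forall>v. v \<noteq> 0 \<longrightarrow> pt v \<in> V \<longrightarrow> s v \<noteq> 0 \<longrightarrow> (\<chi> j. A j v) \<noteq> 0 \<and> \<phi> (pt v) = pt (\<chi> j. A j v))"
  proof (intro exI conjI)
    show "\<forall>j. form_fun d (peval (F j))" using U(3) form_fun_peval by blast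
    show "form_fun e s" "P \<in> V \<inter> nz s" using s U(2) by auto
    show "\<forall>v. v \<noteq> 0 \<longrightarrow> pt v \<in> V \<longrightarrow> s v \<noteq> 0 \<longrightarrow>
      (\<chi> j. peval (F j) v) \<noteq> 0 \<and> \<phi> (pt v) = pt (\<chi> j. peval (F j) v)"
      using v U(4) by blast
  qed
next
  assume "\<exists>d A e s. (\<forall>j. form_fun d (A j)) \<and> form_fun e s \<and> P \<in> V \<inter> nz s \<and>
     (\<forall>v. v \<noteq> 0 \<longrightarrow> pt v \<in> V \<longrightarrow> s v \<noteq> 0 \<longrightarrow> (\<chi> j. A j v) \<noteq> 0 \<and> \<phi> (pt v) = pt (\<chi> j. A j v))"
  then obtain d A e s where A: "\<forall>j. form_fun d (A j)" and s: "form_fun e s" "P \<in> V \<inter> nz s"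
    and e: "\<And>v. v \<noteq> 0 \<Longrightarrow> pt v \<in> V \<Longrightarrow> s v \<noteq> 0 \<Longrightarrow> (\<chi> j. A j v) \<noteq> 0 \<and> \<phi> (pt v) = pt (\<chi> j. A j v)"
    by blast
  obtain F where "\<And>j. homogeneous d (F j)" "\<And>j. A j = peval (F j)"
    using A unfolding form_fun_def by metis
  note F = this
  show "regular_map_at V \<phi> P" unfolding regular_map_at_def
  proof (intro exI conjI)
    show "\<forall>v. v \<noteq> 0 \<and> pt v \<in> V \<inter> nz s \<longrightarrow>
      (\<chi> j. peval (F j) v) \<noteq> 0 \<and> \<phi> (pt v) = pt (\<chi> j. peval (F j) v)"
      using e pt_in_nz[OF s(1)] unfolding F(2) by blast
  qed (use s F(1) zopen_in_nz[OF s(1)] in auto)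
qed

lemma ratmap_iff:
  "generically V (regular_map_at V \<phi>) \<longleftrightarrow> (\<exists>d A e s. (\<forall>j. form_fun d (A j)) \<and> form_fun e s \<and> V \<inter> nz s \<noteq> {} \<and>
     (\<forall>v. v \<noteq> 0 \<longrightarrow> pt v \<in> V \<longrightarrow> s v \<noteq> 0 \<longrightarrow> (\<chi> j. A j v) \<noteq> 0 \<and> \<phi> (pt v) = pt (\<chi> j. A j v)))"
  (is "?L \<longleftrightarrow> ?R")
proof
  assume ?L
  then obtain P where "P \<in> V" "regular_map_at V \<phi> P" using generically_ex by blast
  then show ?R unfolding regular_map_at_iff by blast
next
  assume ?R
  then show ?L unfolding generically_iff regular_map_at_iff by blast
qed

section \<open>Rational functions and rational maps\<close>

lemma rep_pspace_pt:
  assumes "v \<noteq> 0"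
  obtains c where "c \<noteq> 0" "rep_pspace (pt v) = c *s v"
proof -
  have "pt v = pt (rep_pspace (pt v))" by (simp add: pt_rep_pspace)
  then show thesis using that pt_eq_iff[OF assms rep_pspace_nonzero] by blast
qed

lemma in_nz_iff:
  assumes "form_fun d h" shows "P \<in> nz h \<longleftrightarrow> h (rep_pspace P) \<noteq> 0"
  using pt_in_nz[OF assms rep_pspace_nonzero, of P] by (simp add: pt_rep_pspace)

lemma form_quot_pt:
  assumes "form_fun d F" "form_fun d G" "v \<noteq> 0"
  shows "F (rep_pspace (pt v)) / G (rep_pspace (pt v)) = F v / G v"
proof -
  obtain c where "c \<noteq> 0" "rep_pspace (pt v) = c *s v" by (rule rep_pspace_pt[OF assms(3)])
  then show ?thesis using form_fun_scale[OF assms(1), of c v] form_fun_scale[OF assms(2), of c v] by simp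
qed

lemma pt_scale: "c \<noteq> 0 \<Longrightarrow> v \<noteq> 0 \<Longrightarrow> pt (c *s v) = pt v"
proof -
  assume c: "c \<noteq> 0" "v \<noteq> 0"
  then have n: "c *s v \<noteq> 0" by (simp add: vec_eq_iff)
  have "\<exists>b. b \<noteq> 0 \<and> c *s v = b *s v" using c(1) by blast
  then show ?thesis using pt_eq_iff[OF c(2) n] by simp
qed

lemma form_map_pt:
  assumes "\<And>j. form_fun d (A j)" "v \<noteq> 0"
  shows "(\<chi> j. A j (rep_pspace (pt v))) \<noteq> 0 \<longleftrightarrow> (\<chi> j. A j v) \<noteq> 0"
    and "(\<chi> j. A j v) \<noteq> 0 \<Longrightarrow> pt (\<chi> j. A j (rep_pspace (pt v))) = pt (\<chi> j. A j v)"
proof -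
  obtain c where c: "c \<noteq> 0" "rep_pspace (pt v) = c *s v" by (rule rep_pspace_pt[OF assms(2)])
  have e: "(\<chi> j. A j (rep_pspace (pt v))) = (c ^ d) *s (\<chi> j. A j v)"
    by (simp add: vec_eq_iff c(2) form_fun_scale[OF assms(1)])
  then show "(\<chi> j. A j (rep_pspace (pt v))) \<noteq> 0 \<longleftrightarrow> (\<chi> j. A j v) \<noteq> 0"
    using c(1) by (simp add: vec_eq_iff)
  show "(\<chi> j. A j v) \<noteq> 0 \<Longrightarrow> pt (\<chi> j. A j (rep_pspace (pt v))) = pt (\<chi> j. A j v)"
    unfolding e using c(1) by (simp add: pt_scale)
qed

text \<open>Evaluating at the chosen representative \<open>rep_pspace P\<close> turns the fraction
  into a predicate of the point P, so that it can be combined with other generic statements.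
  \<open>ratfunI\<close> is the way back.\<close>

lemma ratfun_rep:
  assumes "generically V (regular_at V h)"
  shows "\<exists>d F G. form_fun d F \<and> form_fun d G \<and>
    generically V (\<lambda>P. G (rep_pspace P) \<noteq> 0 \<and> h P = F (rep_pspace P) / G (rep_pspace P))"
proof -
  obtain d F G where FG: "form_fun d F" "form_fun d G" "V \<inter> nz G \<noteq> {}"
    "\<And>v. v \<noteq> 0 \<Longrightarrow> pt v \<in> V \<Longrightarrow> G v \<noteq> 0 \<Longrightarrow> h (pt v) = F v / G v"
    using assms unfolding ratfun_iff by blast
  have "generically V (\<lambda>P. G (rep_pspace P) \<noteq> 0 \<and> h P = F (rep_pspace P) / G (rep_pspace P))"
  proof (rule generically_mono[OF generically_nz[OF FG(2,3)]])
    fix P assume "P \<in> V" "P \<in> nz G"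
    then show "G (rep_pspace P) \<noteq> 0 \<and> h P = F (rep_pspace P) / G (rep_pspace P)"
      using FG(4)[OF rep_pspace_nonzero, of P] in_nz_iff[OF FG(2), of P] unfolding pt_rep_pspace by blast
  qed
  then show ?thesis using FG(1,2) by blast
qed

lemma ratfunI:
  assumes F: "form_fun d F" and G: "form_fun d G"
    and h: "generically V (\<lambda>P. G (rep_pspace P) \<noteq> 0 \<and> h P = F (rep_pspace P) / G (rep_pspace P))"
  shows "generically V (regular_at V h)"
proof -
  obtain e s where s: "form_fun e s" "V \<inter> nz s \<noteq> {}"
    "\<And>P. P \<in> V \<inter> nz s \<Longrightarrow> G (rep_pspace P) \<noteq> 0 \<and> h P = F (rep_pspace P) / G (rep_pspace P)"
    using h unfolding generically_iff by blast
  show ?thesis unfolding ratfun_iff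
  proof (intro exI conjI)
    show "form_fun (d + e) (\<lambda>v. F v * s v)" by (rule form_fun_mult[OF F s(1)])
    show "form_fun (d + e) (\<lambda>v. G v * s v)" by (rule form_fun_mult[OF G s(1)])
    have "V \<inter> nz s \<subseteq> nz G" using s(3) in_nz_iff[OF G] by blast
    then show "V \<inter> nz (\<lambda>v. G v * s v) \<noteq> {}" using s(2) unfolding nz_mult[OF G s(1)] by blast
    show "\<forall>v. v \<noteq> 0 \<longrightarrow> pt v \<in> V \<longrightarrow> G v * s v \<noteq> 0 \<longrightarrow> h (pt v) = F v * s v / (G v * s v)"
    proof (intro allI impI)
      fix v assume v: "v \<noteq> 0" "pt v \<in> V" "G v * s v \<noteq> 0"
      then have "pt v \<in> V \<inter> nz s" using pt_in_nz[OF s(1) v(1)] by auto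
      then have "h (pt v) = F v / G v" using s(3) form_quot_pt[OF F G v(1)] by simp
      then show "h (pt v) = F v * s v / (G v * s v)" using v by simp
    qed
  qed
qed

lemma ratfun_cong:
  assumes "projective_variety V" "generically V (regular_at V h)" "generically V (\<lambda>P. h' P = h P)"
  shows "generically V (regular_at V h')"
proof -
  obtain d F G where FG: "form_fun d F" "form_fun d G"
    "generically V (\<lambda>P. G (rep_pspace P) \<noteq> 0 \<and> h P = F (rep_pspace P) / G (rep_pspace P))"
    using ratfun_rep[OF assms(2)] by blast
  show ?thesis by (rule ratfunI[OF FG(1,2)]) (rule generically_mp[OF assms(1) FG(3) assms(3)], simp)
qed

lemma ratfun_const: "projective_variety V \<Longrightarrow> generically V (regular_at V (\<lambda>P. c))"
  by (rule ratfunI[OF form_fun_const[of c] form_fun_const[of 1]]) (auto intro: generically_all)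

lemma ratfun_add:
  assumes V: "projective_variety V" and "generically V (regular_at V h)" "generically V (regular_at V h')"
  shows "generically V (regular_at V (\<lambda>P. h P + h' P))"
proof -
  obtain d F G where FG: "form_fun d F" "form_fun d G"
    "generically V (\<lambda>P. G (rep_pspace P) \<noteq> 0 \<and> h P = F (rep_pspace P) / G (rep_pspace P))"
    using ratfun_rep[OF assms(2)] by blast
  obtain d' F' G' where FG': "form_fun d' F'" "form_fun d' G'"
    "generically V (\<lambda>P. G' (rep_pspace P) \<noteq> 0 \<and> h' P = F' (rep_pspace P) / G' (rep_pspace P))"
    using ratfun_rep[OF assms(3)] by blast
  have "form_fun (d + d') (\<lambda>v. F v * G' v + F' v * G v)"
    using form_fun_add form_fun_mult[OF FG(1) FG'(2)] form_fun_mult[OF FG'(1) FG(2)] by (simp add: add.commute)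
  then show ?thesis
    by (rule ratfunI[OF _ form_fun_mult[OF FG(2) FG'(2)]])
      (rule generically_mp[OF V FG(3) FG'(3)], simp add: field_simps)
qed

lemma ratfun_mult:
  assumes V: "projective_variety V" and "generically V (regular_at V h)" "generically V (regular_at V h')"
  shows "generically V (regular_at V (\<lambda>P. h P * h' P))"
proof -
  obtain d F G where FG: "form_fun d F" "form_fun d G"
    "generically V (\<lambda>P. G (rep_pspace P) \<noteq> 0 \<and> h P = F (rep_pspace P) / G (rep_pspace P))"
    using ratfun_rep[OF assms(2)] by blast
  obtain d' F' G' where FG': "form_fun d' F'" "form_fun d' G'"
    "generically V (\<lambda>P. G' (rep_pspace P) \<noteq> 0 \<and> h' P = F' (rep_pspace P) / G' (rep_pspace P))"
    using ratfun_rep[OF assms(3)] by blast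
  show ?thesis
    by (rule ratfunI[OF form_fun_mult[OF FG(1) FG'(1)] form_fun_mult[OF FG(2) FG'(2)]])
      (rule generically_mp[OF V FG(3) FG'(3)], simp)
qed

text \<open>Decided by the numerator F: if F vanished on all of V, h would be generically zero;
  otherwise F is nonzero on a nonempty open set.\<close>

lemma ratfun_zero_or_nonzero:
  assumes V: "projective_variety V" and h: "generically V (regular_at V h)" and "\<not> generically V (\<lambda>P. h P = 0)"
  shows "generically V (\<lambda>P. h P \<noteq> 0)"
proof -
  obtain d F G where FG: "form_fun d F" "form_fun d G"
    "generically V (\<lambda>P. G (rep_pspace P) \<noteq> 0 \<and> h P = F (rep_pspace P) / G (rep_pspace P))"
    using ratfun_rep[OF h] by blast
  have "V \<inter> nz F \<noteq> {}"
  proof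
    assume e: "V \<inter> nz F = {}"
    have "generically V (\<lambda>P. h P = 0)"
      by (rule generically_mono[OF FG(3)]) (use e in_nz_iff[OF FG(1)] in auto)
    then show False using assms by blast
  qed
  from generically_nz[OF FG(1) this] FG(3) show ?thesis
    by (rule generically_mp[OF V]) (simp add: in_nz_iff[OF FG(1)])
qed

lemma ratfun_inverse:
  assumes V: "projective_variety V" and h: "generically V (regular_at V h)" and nz: "generically V (\<lambda>P. h P \<noteq> 0)"
  shows "generically V (regular_at V (\<lambda>P. inverse (h P)))"
proof -
  obtain d F G where FG: "form_fun d F" "form_fun d G"
    "generically V (\<lambda>P. G (rep_pspace P) \<noteq> 0 \<and> h P = F (rep_pspace P) / G (rep_pspace P))"
    using ratfun_rep[OF h] by blast
  show ?thesis
    by (rule ratfunI[OF FG(2,1)]) (rule generically_mp[OF V FG(3) nz], auto)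
qed

section \<open>Rational maps in homogeneous coordinates\<close>

lemma ratmap_rep:
  assumes "generically V (regular_map_at V \<phi>)"
  shows "\<exists>d A. (\<forall>j. form_fun d (A j)) \<and>
    generically V (\<lambda>P. (\<chi> j. A j (rep_pspace P)) \<noteq> 0 \<and> \<phi> P = pt (\<chi> j. A j (rep_pspace P)))"
proof -
  obtain d A e s where A: "\<forall>j. form_fun d (A j)" "form_fun e s" "V \<inter> nz s \<noteq> {}"
    "\<And>v. v \<noteq> 0 \<Longrightarrow> pt v \<in> V \<Longrightarrow> s v \<noteq> 0 \<Longrightarrow> (\<chi> j. A j v) \<noteq> 0 \<and> \<phi> (pt v) = pt (\<chi> j. A j v)"
    using assms unfolding ratmap_iff by blast
  have "generically V (\<lambda>P. (\<chi> j. A j (rep_pspace P)) \<noteq> 0 \<and> \<phi> P = pt (\<chi> j. A j (rep_pspace P)))"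
  proof (rule generically_mono[OF generically_nz[OF A(2,3)]])
    fix P assume "P \<in> V" "P \<in> nz s"
    then show "(\<chi> j. A j (rep_pspace P)) \<noteq> 0 \<and> \<phi> P = pt (\<chi> j. A j (rep_pspace P))"
      using A(4)[OF rep_pspace_nonzero, of P] in_nz_iff[OF A(2), of P] unfolding pt_rep_pspace by blast
  qed
  then show ?thesis using A(1) by blast
qed

lemma ratmapI:
  assumes A: "\<And>j. form_fun d (A j)"
    and h: "generically V (\<lambda>P. (\<chi> j. A j (rep_pspace P)) \<noteq> 0 \<and> \<phi> P = pt (\<chi> j. A j (rep_pspace P)))"
  shows "generically V (regular_map_at V \<phi>)"
proof -
  obtain e s where s: "form_fun e s" "V \<inter> nz s \<noteq> {}"
    "\<And>P. P \<in> V \<inter> nz s \<Longrightarrow> (\<chi> j. A j (rep_pspace P)) \<noteq> 0 \<and> \<phi> P = pt (\<chi> j. A j (rep_pspace P))"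
    using h unfolding generically_iff by blast
  have "(\<chi> j. A j v) \<noteq> 0 \<and> \<phi> (pt v) = pt (\<chi> j. A j v)" if "v \<noteq> 0" "pt v \<in> V" "s v \<noteq> 0" for v
    using s(3)[of "pt v"] that pt_in_nz[OF s(1) that(1)] form_map_pt[where A = A, OF A that(1)] by auto
  note g = this
  show ?thesis unfolding ratmap_iff
  proof (intro exI conjI)
    show "\<forall>j. form_fun d (A j)" using A by simp
  qed (use s(1,2) g in blast)+
qed

lemma ratmap_of_ratfuns:
  fixes h :: "'m::finite \<Rightarrow> ('a::field, 'n::finite) pspace \<Rightarrow> 'a"
  assumes V: "projective_variety V" and h: "\<And>i. generically V (regular_at V (h i))"
    and nz: "generically V (\<lambda>P. (\<chi> i. h i P) \<noteq> 0)"
  shows "generically V (regular_map_at V (\<lambda>P. pt (\<chi> i. h i P)))"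
proof -
  obtain d F G where FG: "\<And>i. form_fun (d i) (F i)" "\<And>i. form_fun (d i) (G i)"
    "\<And>i. generically V (\<lambda>P. G i (rep_pspace P) \<noteq> 0 \<and> h i P = F i (rep_pspace P) / G i (rep_pspace P))"
  proof -
    have "\<forall>i. \<exists>t. form_fun (fst t) (fst (snd t)) \<and> form_fun (fst t) (snd (snd t)) \<and>
      generically V (\<lambda>P. snd (snd t) (rep_pspace P) \<noteq> 0 \<and>
        h i P = fst (snd t) (rep_pspace P) / snd (snd t) (rep_pspace P))"
      using ratfun_rep[OF h] by simp
    from choice[OF this] obtain t where "\<And>i. form_fun (fst (t i)) (fst (snd (t i))) \<and>
      form_fun (fst (t i)) (snd (snd (t i))) \<and>
      generically V (\<lambda>P. snd (snd (t i)) (rep_pspace P) \<noteq> 0 \<and>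
        h i P = fst (snd (t i)) (rep_pspace P) / snd (snd (t i)) (rep_pspace P))" by blast
    then show thesis
      by (intro that[of "\<lambda>i. fst (t i)" "\<lambda>i. fst (snd (t i))" "\<lambda>i. snd (snd (t i))"]) blast+
  qed
  \<comment> \<open>Clearing denominators: \<open>A i\<close> is \<open>h i\<close> times the
    product of all denominators, a factor common to all coordinates, and all \<open>A i\<close> have
    the same degree.\<close>
  define A where "A i v = F i v * (\<Prod>j\<in>UNIV - {i}. G j v)" for i v
  have A: "form_fun (\<Sum>j\<in>UNIV. d j) (A i)" for i
  proof -
    have "form_fun (d i + (\<Sum>j\<in>UNIV - {i}. d j)) (A i)"
      unfolding A_def by (intro form_fun_mult form_fun_prod FG) simp
    then show ?thesis by (simp add: sum.remove[of UNIV i])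
  qed
  have "generically V (\<lambda>P. \<forall>i\<in>UNIV. G i (rep_pspace P) \<noteq> 0 \<and> h i P = F i (rep_pspace P) / G i (rep_pspace P))"
    by (rule generically_ball_finite[OF V]) (use FG(3) in auto)
  from this nz show ?thesis
  proof (rule ratmapI[OF A, OF generically_mp[OF V]])
    fix P assume g: "\<forall>i\<in>UNIV. G i (rep_pspace P) \<noteq> 0 \<and> h i P = F i (rep_pspace P) / G i (rep_pspace P)"
      and n: "(\<chi> i. h i P) \<noteq> 0"
    let ?c = "\<Prod>j\<in>UNIV. G j (rep_pspace P)"
    have c: "?c \<noteq> 0" using g by simp
    have "A i (rep_pspace P) = ?c * h i P" for i
      using g by (simp add: A_def prod.remove[of UNIV i])
    then have e: "(\<chi> i. A i (rep_pspace P)) = ?c *s (\<chi> i. h i P)" by (simp add: vec_eq_iff)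
    show "(\<chi> i. A i (rep_pspace P)) \<noteq> 0 \<and> pt (\<chi> i. h i P) = pt (\<chi> i. A i (rep_pspace P))"
      unfolding e using c n pt_scale[OF c n] by (simp add: vec_eq_iff)
  qed
qed

text \<open>Proportionality as the vanishing of all 2 x 2 minors. It turns disagreement of two
  rational maps into the nonvanishing of a form, an open condition.\<close>

lemma pt_eq_iff_minors:
  assumes "v \<noteq> 0" "w \<noteq> 0"
  shows "pt v = pt w \<longleftrightarrow> (\<forall>i j. v $ i * w $ j = v $ j * w $ i)"
proof
  assume "pt v = pt w"
  then obtain c where "w = c *s v" using pt_eq_iff[OF assms] by blast
  then show "\<forall>i j. v $ i * w $ j = v $ j * w $ i" by simp
next
  assume m: "\<forall>i j. v $ i * w $ j = v $ j * w $ i"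
  obtain i where i: "v $ i \<noteq> 0" using assms(1) by (auto simp: vec_eq_iff)
  let ?c = "w $ i / v $ i"
  have w: "w = ?c *s v"
    using i m by (simp add: vec_eq_iff) (metis mult.commute nonzero_eq_divide_eq)
  have "?c \<noteq> 0" using w assms(2) by (metis vector_smult_lzero)
  then show "pt v = pt w" using w pt_eq_iff[OF assms] by blast
qed

text \<open>Density of the image is expressed by transporting generic statements back to V, the form
  in which composition and pull-back use it.\<close>

definition dominant :: "('a::field, 'n::finite) pspace set \<Rightarrow> (('a, 'n) pspace \<Rightarrow> ('a, 'm::finite) pspace)
    \<Rightarrow> ('a, 'm) pspace set \<Rightarrow> bool" where
  "dominant V \<phi> W \<longleftrightarrow> generically V (regular_map_at V \<phi>) \<and>
     (\<forall>Q. generically W Q \<longrightarrow> generically V (\<lambda>P. Q (\<phi> P)))"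

lemma dominantD: "dominant V \<phi> W \<Longrightarrow> generically W Q \<Longrightarrow> generically V (\<lambda>P. Q (\<phi> P))"
  by (simp add: dominant_def)

lemma dominant_ratmap_comp:
  fixes \<psi> :: "('a::field, 'm::finite) pspace \<Rightarrow> ('a, 'l::finite) pspace"
  assumes V: "projective_variety V" and \<phi>: "dominant V \<phi> W" and \<psi>: "generically W (regular_map_at W \<psi>)"
  shows "generically V (regular_map_at V (\<lambda>P. \<psi> (\<phi> P)))"
proof -
  obtain d A where A: "\<forall>j. form_fun d (A j)"
    "generically V (\<lambda>P. (\<chi> j. A j (rep_pspace P)) \<noteq> 0 \<and> \<phi> P = pt (\<chi> j. A j (rep_pspace P)))"
    using ratmap_rep \<phi> unfolding dominant_def by blast
  obtain e B where B: "\<forall>j. form_fun e (B j)"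
    "generically W (\<lambda>P. (\<chi> j. B j (rep_pspace P)) \<noteq> 0 \<and> \<psi> P = pt (\<chi> j. B j (rep_pspace P)))"
    using ratmap_rep[OF \<psi>] by blast
  have B': "\<And>j. form_fun e (B j)" using B(1) by blast
  have c: "form_fun (e * d) (\<lambda>v. B j (\<chi> j. A j v))" for j
    by (rule form_fun_compose) (use A(1) B(1) in auto)
  show ?thesis
    by (rule ratmapI[OF c], rule generically_mp[OF V A(2) dominantD[OF \<phi> B(2)]])
      (use form_map_pt[where A = B, OF B'] in auto)
qed

lemma dominant_comp:
  assumes "projective_variety V" "dominant V \<phi> W" "dominant W \<psi> Y"
  shows "dominant V (\<lambda>P. \<psi> (\<phi> P)) Y"
  using dominant_ratmap_comp[OF assms(1,2), of \<psi>] dominantD[OF assms(2)] assms(3)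
  unfolding dominant_def[of W] dominant_def[of V _ Y] by blast

lemma dominant_ratfun_comp:
  assumes V: "projective_variety V" and \<phi>: "dominant V \<phi> W" and h: "generically W (regular_at W h)"
  shows "generically V (regular_at V (\<lambda>P. h (\<phi> P)))"
proof -
  obtain d A where A: "\<forall>j. form_fun d (A j)"
    "generically V (\<lambda>P. (\<chi> j. A j (rep_pspace P)) \<noteq> 0 \<and> \<phi> P = pt (\<chi> j. A j (rep_pspace P)))"
    using ratmap_rep \<phi> unfolding dominant_def by blast
  obtain e F G where FG: "form_fun e F" "form_fun e G"
    "generically W (\<lambda>P. G (rep_pspace P) \<noteq> 0 \<and> h P = F (rep_pspace P) / G (rep_pspace P))"
    using ratfun_rep[OF h] by blast
  have A': "\<And>j. form_fun d (A j)" using A(1) by blast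
  show ?thesis
  proof (rule ratfunI[OF form_fun_compose[OF FG(1) A'] form_fun_compose[OF FG(2) A']],
      rule generically_mp[OF V A(2) dominantD[OF \<phi> FG(3)]])
    fix P assume a: "(\<chi> j. A j (rep_pspace P)) \<noteq> 0 \<and> \<phi> P = pt (\<chi> j. A j (rep_pspace P))"
      and g: "G (rep_pspace (\<phi> P)) \<noteq> 0 \<and> h (\<phi> P) = F (rep_pspace (\<phi> P)) / G (rep_pspace (\<phi> P))"
    let ?w = "\<chi> j. A j (rep_pspace P)"
    have "G ?w \<noteq> 0" using g a in_nz_iff[OF FG(2), of "\<phi> P"] pt_in_nz[OF FG(2), of ?w] by simp
    then show "G ?w \<noteq> 0 \<and> h (\<phi> P) = F ?w / G ?w"
      using g a form_quot_pt[OF FG(1,2), of ?w] by simp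
  qed
qed

text \<open>If an open set \<open>nz t\<close> meets the closed image, it meets the image itself at
  a point P where the map is regular. Near P the map is given by forms A, and substituting A into t
  gives a form nonzero at P, so the preimage of \<open>nz t\<close> holds generically
  (\<open>key\<close>). Irreducibility of the image follows because two generic conditions on V have
  a common point.\<close>

lemma rational_image_dominant:
  assumes V: "projective_variety V" and \<phi>: "generically V (regular_map_at V \<phi>)"
  shows "projective_variety (rational_image V \<phi>)" "dominant V \<phi> (rational_image V \<phi>)"
    "generically V (\<lambda>P. \<phi> P \<in> rational_image V \<phi>)"
proof -
  let ?W = "rational_image V \<phi>" and ?R = "{P \<in> V. regular_map_at V \<phi> P}"
  have sub: "\<phi> P \<in> ?W" if "P \<in> V" "regular_map_at V \<phi> P" for P
    using that unfolding rational_image_def zclosure_def by blast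
  have least: "?W \<subseteq> Z" if "zclosed Z" "\<phi> ` ?R \<subseteq> Z" for Z
    using that unfolding rational_image_def zclosure_def by blast
  have closed: "zclosed ?W" unfolding zclosed_iff
  proof (intro allI impI)
    fix P assume "P \<notin> ?W"
    then obtain Z where Z: "zclosed Z" "\<phi> ` ?R \<subseteq> Z" "P \<notin> Z" unfolding rational_image_def zclosure_def by blast
    obtain d h where h: "form_fun d h" "P \<in> nz h" "Z \<inter> nz h = {}"
      using Z(1)[unfolded zclosed_iff] Z(3) by blast
    with least[OF Z(1,2)] have "?W \<inter> nz h = {}" by blast
    with h(1,2) show "\<exists>d h. form_fun d h \<and> P \<in> nz h \<and> ?W \<inter> nz h = {}" by blast
  qed
  have key: "generically V (\<lambda>P. \<phi> P \<in> ?W \<inter> nz t)" if t: "form_fun e t" "?W \<inter> nz t \<noteq> {}" for e t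
  proof -
    \<comment> \<open>Otherwise the closed complement of \<open>nz t\<close> would contain the image
      and hence its closure.\<close>
    have "\<not> \<phi> ` ?R \<subseteq> - nz t" using least[OF zclosed_compl_nz[OF t(1)]] t(2) by blast
    then obtain P where P: "P \<in> V" "regular_map_at V \<phi> P" "\<phi> P \<in> nz t" by blast
    obtain d A e' s where A: "\<forall>j. form_fun d (A j)" "form_fun e' s" "P \<in> V \<inter> nz s" and
     eq: "\<forall>v. v \<noteq> 0 \<longrightarrow> pt v \<in> V \<longrightarrow> s v \<noteq> 0 \<longrightarrow> (\<chi> j. A j v) \<noteq> 0 \<and> \<phi> (pt v) = pt (\<chi> j. A j v)"
      using P(2) unfolding regular_map_at_iff by blast
    have reg: "regular_map_at V \<phi> Q" if "Q \<in> V \<inter> nz s" for Q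
      unfolding regular_map_at_iff
    proof (intro exI conjI)
      show "\<forall>j. form_fun d (A j)" by (rule A(1))
      show "form_fun e' s" "Q \<in> V \<inter> nz s" by (rule A(2), rule that)
    qed (rule eq)
    have tA: "form_fun (e * d) (\<lambda>v. t (\<chi> j. A j v))"
      by (rule form_fun_compose[OF t(1)]) (use A(1) in blast)
    have iff: "\<phi> (pt v) \<in> nz t \<longleftrightarrow> pt v \<in> nz (\<lambda>v. t (\<chi> j. A j v))" if "v \<noteq> 0" "pt v \<in> V \<inter> nz s" for v
    proof -
      have "(\<chi> j. A j v) \<noteq> 0 \<and> \<phi> (pt v) = pt (\<chi> j. A j v)"
        using eq that pt_in_nz[OF A(2) that(1)] by blast
      then show ?thesis using pt_in_nz[OF tA that(1)] pt_in_nz[OF t(1), of "\<chi> j. A j v"] by simp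
    qed
    have "P \<in> nz (\<lambda>v. t (\<chi> j. A j v))"
      using iff[OF rep_pspace_nonzero, of P] A(3) P(3) unfolding pt_rep_pspace by blast
    then have ne: "V \<inter> nz (\<lambda>v. s v * t (\<chi> j. A j v)) \<noteq> {}" using A(3) nz_mult[OF A(2) tA] by blast
    show ?thesis
    proof (rule generically_mono[OF generically_nz[OF form_fun_mult[OF A(2) tA] ne]])
      fix Q assume Q: "Q \<in> V" "Q \<in> nz (\<lambda>v. s v * t (\<chi> j. A j v))"
      then have Q': "Q \<in> V \<inter> nz s" "Q \<in> nz (\<lambda>v. t (\<chi> j. A j v))" using nz_mult[OF A(2) tA] by blast+
      have "\<phi> Q \<in> nz t"
        using iff[OF rep_pspace_nonzero, of Q] Q' unfolding pt_rep_pspace by blast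
      then show "\<phi> Q \<in> ?W \<inter> nz t" using sub[OF Q(1) reg[OF Q'(1)]] by blast
    qed
  qed
  show "generically V (\<lambda>P. \<phi> P \<in> ?W)"
    by (rule generically_mono[OF \<phi>]) (use sub in blast)
  then have "?W \<noteq> {}" using generically_ex by blast
  with closed show "projective_variety ?W"
  proof (rule projective_varietyI)
    fix d h e h' assume "form_fun d h" "form_fun e h'" "?W \<inter> nz h \<noteq> {}" "?W \<inter> nz h' \<noteq> {}"
    then have "generically V (\<lambda>P. \<phi> P \<in> ?W \<inter> nz h \<and> \<phi> P \<in> ?W \<inter> nz h')"
      by (intro generically_conj[OF V] key)
    then show "?W \<inter> (nz h \<inter> nz h') \<noteq> {}" using generically_ex by blast
  qed
  show "dominant V \<phi> ?W" unfolding dominant_def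
  proof (intro conjI \<phi> allI impI)
    fix Q assume "generically ?W Q"
    then obtain d h where h: "form_fun d h" "?W \<inter> nz h \<noteq> {}" "\<forall>P\<in>?W \<inter> nz h. Q P" unfolding generically_iff by blast
    show "generically V (\<lambda>P. Q (\<phi> P))" by (rule generically_mono[OF key[OF h(1,2)]]) (use h(3) in blast)
  qed
qed

text \<open>If the maps differ at P, some minor of their coordinate vectors is nonzero at P, hence
  generically, so they would differ generically.\<close>

lemma regular_maps_agree:
  assumes V: "projective_variety V" and eq: "generically V (\<lambda>P. \<phi> P = \<psi> P)"
    and reg: "regular_map_at V \<phi> P" "regular_map_at V \<psi> P"
  shows "\<phi> P = \<psi> P"
proof (rule ccontr)
  assume ne: "\<phi> P \<noteq> \<psi> P"
  obtain d A e s where A: "\<forall>j. form_fun d (A j)" "form_fun e s" "P \<in> V \<inter> nz s"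
    "\<And>v. v \<noteq> 0 \<Longrightarrow> pt v \<in> V \<Longrightarrow> s v \<noteq> 0 \<Longrightarrow> (\<chi> j. A j v) \<noteq> 0 \<and> \<phi> (pt v) = pt (\<chi> j. A j v)"
    using reg(1) unfolding regular_map_at_iff by blast
  obtain d' B e' s' where B: "\<forall>j. form_fun d' (B j)" "form_fun e' s'" "P \<in> V \<inter> nz s'"
    "\<And>v. v \<noteq> 0 \<Longrightarrow> pt v \<in> V \<Longrightarrow> s' v \<noteq> 0 \<Longrightarrow> (\<chi> j. B j v) \<noteq> 0 \<and> \<psi> (pt v) = pt (\<chi> j. B j v)"
    using reg(2) unfolding regular_map_at_iff by blast
  have agree: "\<phi> Q = \<psi> Q \<longleftrightarrow> (\<forall>i j. A i (rep_pspace Q) * B j (rep_pspace Q) = A j (rep_pspace Q) * B i (rep_pspace Q))"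
    if "Q \<in> V" "Q \<in> nz s" "Q \<in> nz s'" for Q
  proof -
    have a: "(\<chi> j. A j (rep_pspace Q)) \<noteq> 0 \<and> \<phi> Q = pt (\<chi> j. A j (rep_pspace Q))"
      using A(4)[OF rep_pspace_nonzero, of Q] that in_nz_iff[OF A(2)] by (simp add: pt_rep_pspace)
    have b: "(\<chi> j. B j (rep_pspace Q)) \<noteq> 0 \<and> \<psi> Q = pt (\<chi> j. B j (rep_pspace Q))"
      using B(4)[OF rep_pspace_nonzero, of Q] that in_nz_iff[OF B(2)] by (simp add: pt_rep_pspace)
    show ?thesis using a b pt_eq_iff_minors[of "\<chi> j. A j (rep_pspace Q)" "\<chi> j. B j (rep_pspace Q)"] by simp
  qed
  then obtain i j where ij: "A i (rep_pspace P) * B j (rep_pspace P) \<noteq> A j (rep_pspace P) * B i (rep_pspace P)"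
    using ne A(3) B(3) by blast
  have m: "form_fun (d + d') (\<lambda>v. A i v * B j v - A j v * B i v)"
    using A(1) B(1) by (intro form_fun_diff form_fun_mult) auto
  have "P \<in> nz (\<lambda>v. A i v * B j v - A j v * B i v)" using ij in_nz_iff[OF m] by simp
  then have "generically V (\<lambda>Q. Q \<in> nz (\<lambda>v. A i v * B j v - A j v * B i v))"
    using A(3) by (intro generically_nz[OF m]) blast
  moreover have "generically V (\<lambda>Q. Q \<in> nz s)" "generically V (\<lambda>Q. Q \<in> nz s')"
    using A(2,3) B(2,3) generically_nz by blast+
  ultimately have "generically V (\<lambda>Q. (Q \<in> nz (\<lambda>v. A i v * B j v - A j v * B i v) \<and> \<phi> Q = \<psi> Q) \<and> Q \<in> nz s \<and> Q \<in> nz s')"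
    using eq by (intro generically_conj[OF V])
  then obtain Q where "Q \<in> V" "Q \<in> nz (\<lambda>v. A i v * B j v - A j v * B i v)" "\<phi> Q = \<psi> Q" "Q \<in> nz s" "Q \<in> nz s'"
    using generically_ex by blast
  then show False using agree in_nz_iff[OF m] by fastforce
qed

text \<open>A dominant map can be cancelled on the right: a minor that is nonzero somewhere on W
  makes the two maps differ generically on W, and dominance carries this back to V.\<close>

lemma dominant_agree:
  assumes V: "projective_variety V" and W: "projective_variety W" and \<phi>: "dominant V \<phi> W"
    and reg: "generically W (regular_map_at W \<alpha>)" "generically W (regular_map_at W \<beta>)"
    and eq: "generically V (\<lambda>P. \<alpha> (\<phi> P) = \<beta> (\<phi> P))"
  shows "generically W (\<lambda>Q. \<alpha> Q = \<beta> Q)"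
proof -
  obtain d A where A: "\<forall>j. form_fun d (A j)"
    "generically W (\<lambda>P. (\<chi> j. A j (rep_pspace P)) \<noteq> 0 \<and> \<alpha> P = pt (\<chi> j. A j (rep_pspace P)))"
    using ratmap_rep[OF reg(1)] by blast
  obtain e B where B: "\<forall>j. form_fun e (B j)"
    "generically W (\<lambda>P. (\<chi> j. B j (rep_pspace P)) \<noteq> 0 \<and> \<beta> P = pt (\<chi> j. B j (rep_pspace P)))"
    using ratmap_rep[OF reg(2)] by blast
  have agree: "generically W (\<lambda>Q. \<alpha> Q = \<beta> Q \<longleftrightarrow>
    (\<forall>i j. A i (rep_pspace Q) * B j (rep_pspace Q) = A j (rep_pspace Q) * B i (rep_pspace Q)))"
    by (rule generically_mp[OF W A(2) B(2)]) (simp add: pt_eq_iff_minors)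
  have zero: "A i (rep_pspace Q) * B j (rep_pspace Q) = A j (rep_pspace Q) * B i (rep_pspace Q)" if "Q \<in> W" for Q i j
  proof (rule ccontr)
    have m: "form_fun (d + e) (\<lambda>v. A i v * B j v - A j v * B i v)"
      using A(1) B(1) by (intro form_fun_diff form_fun_mult) auto
    assume "\<not> ?thesis"
    then have "W \<inter> nz (\<lambda>v. A i v * B j v - A j v * B i v) \<noteq> {}" using that in_nz_iff[OF m] by auto
    from agree generically_nz[OF m this] have "generically W (\<lambda>Q. \<alpha> Q \<noteq> \<beta> Q)"
      by (rule generically_mp[OF W]) (auto simp: in_nz_iff[OF m])
    from generically_conj[OF V dominantD[OF \<phi> this] eq] show False using generically_ex by blast
  qed
  show ?thesis by (rule generically_mono[OF agree]) (use zero in blast)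
qed

section \<open>Function fields and pull-backs\<close>

lemma cring_generic_ring:
  assumes V: "projective_variety V" shows "cring (generic_ring V)"
proof (rule cringI)
  show "abelian_group (generic_ring V)"
  proof (rule abelian_groupI)
    fix h assume h: "h \<in> carrier (generic_ring V)"
    \<comment> \<open>The negative is written as a product with a constant so that closure under
      multiplication applies.\<close>
    then have "(\<lambda>P. - 1 * h P) \<in> carrier (generic_ring V)"
      using ratfun_mult[OF V ratfun_const[OF V, of "- 1"]] by (simp add: generic_ring_def)
    then show "\<exists>y\<in>carrier (generic_ring V). y \<oplus>\<^bsub>generic_ring V\<^esub> h = \<zero>\<^bsub>generic_ring V\<^esub>"
      by (intro bexI[of _ "\<lambda>P. - 1 * h P"]) (simp_all add: generic_ring_def)
  qed (simp_all add: generic_ring_def ratfun_add[OF V] ratfun_const[OF V] add_ac)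
  show "comm_monoid (generic_ring V)"
    by (rule comm_monoidI) (simp_all add: generic_ring_def ratfun_mult[OF V] ratfun_const[OF V] mult_ac)
qed (simp add: generic_ring_def algebra_simps)

lemma ideal_null_ideal:
  assumes V: "projective_variety V" shows "ideal (null_ideal V) (generic_ring V)"
proof -
  interpret R: cring "generic_ring V" by (rule cring_generic_ring[OF V])
  have sub: "h \<in> carrier (generic_ring V)" if "h \<in> null_ideal V" for h
    using that ratfun_cong[OF V ratfun_const[OF V, of 0]] by (simp add: null_ideal_def generic_ring_def)
  show ?thesis
  proof (rule idealI[OF R.ring_axioms])
    show "subgroup (null_ideal V) (add_monoid (generic_ring V))"
    proof (rule R.add.subgroupI)
      show "null_ideal V \<subseteq> carrier (generic_ring V)" using sub by blast
      have "(\<lambda>P. 0) \<in> null_ideal V" using generically_all[OF V] by (simp add: null_ideal_def)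
      then show "null_ideal V \<noteq> {}" by blast
      fix a assume a: "a \<in> null_ideal V"
      have "\<ominus>\<^bsub>generic_ring V\<^esub> a = (\<lambda>P. - a P)"
      proof (rule R.minus_equality)
        show "(\<lambda>P. - a P) \<in> carrier (generic_ring V)"
          using a by (intro sub) (simp add: null_ideal_def)
        show "(\<lambda>P. - a P) \<oplus>\<^bsub>generic_ring V\<^esub> a = \<zero>\<^bsub>generic_ring V\<^esub>" by (simp add: generic_ring_def)
      qed (rule sub[OF a])
      then show "\<ominus>\<^bsub>generic_ring V\<^esub> a \<in> null_ideal V" using a by (simp add: null_ideal_def)
      fix b assume b: "b \<in> null_ideal V"
      have "generically V (\<lambda>P. a P + b P = 0)"
        by (rule generically_mp[OF V, of "\<lambda>P. a P = 0" "\<lambda>P. b P = 0"]) (use a b in \<open>simp_all add: null_ideal_def\<close>)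
      then show "a \<oplus>\<^bsub>generic_ring V\<^esub> b \<in> null_ideal V" by (simp add: null_ideal_def generic_ring_def)
    qed
  next
    fix a x assume a: "a \<in> null_ideal V"
    have "generically V (\<lambda>P. x P * a P = 0)" "generically V (\<lambda>P. a P * x P = 0)"
      by (rule generically_mono[of V "\<lambda>P. a P = 0"]; use a in \<open>simp add: null_ideal_def\<close>)+
    then show "x \<otimes>\<^bsub>generic_ring V\<^esub> a \<in> null_ideal V" "a \<otimes>\<^bsub>generic_ring V\<^esub> x \<in> null_ideal V"
      by (simp_all add: null_ideal_def generic_ring_def)
  qed
qed

lemma rational_function_eq: "rational_function V h = {h'. generically V (\<lambda>P. h' P = h P)}"
proof -
  have "h' \<in> rational_function V h \<longleftrightarrow> generically V (\<lambda>P. h' P = h P)" for h'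
  proof
    assume "h' \<in> rational_function V h"
    then obtain n where n: "n \<in> null_ideal V" "h' = (\<lambda>P. n P + h P)"
      unfolding rational_function_def a_r_coset_def r_coset_def by (auto simp: generic_ring_def)
    then show "generically V (\<lambda>P. h' P = h P)" by (simp add: null_ideal_def)
  next
    assume "generically V (\<lambda>P. h' P = h P)"
    then have "(\<lambda>P. h' P - h P) \<in> null_ideal V" by (simp add: null_ideal_def)
    moreover have "h' = (\<lambda>P. (h' P - h P) + h P)" by simp
    ultimately show "h' \<in> rational_function V h"
      unfolding rational_function_def a_r_coset_def r_coset_def
      by (auto simp: generic_ring_def intro!: bexI[of _ "\<lambda>P. h' P - h P"])
  qed
  then show ?thesis by blast
qed

lemma rational_function_eq_iff:
  assumes V: "projective_variety V"
  shows "rational_function V h = rational_function V h' \<longleftrightarrow> generically V (\<lambda>P. h P = h' P)"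
proof
  assume "rational_function V h = rational_function V h'"
  moreover have "h \<in> rational_function V h"
    by (auto simp: rational_function_eq intro: generically_all[OF V])
  ultimately show "generically V (\<lambda>P. h P = h' P)" by (simp add: rational_function_eq)
next
  assume e: "generically V (\<lambda>P. h P = h' P)"
  have "generically V (\<lambda>P. k P = h P) \<longleftrightarrow> generically V (\<lambda>P. k P = h' P)" for k
    using generically_mp[OF V _ e, of "\<lambda>P. k P = h P" "\<lambda>P. k P = h' P"]
      generically_mp[OF V _ e, of "\<lambda>P. k P = h' P" "\<lambda>P. k P = h P"] by auto
  then show "rational_function V h = rational_function V h'" by (simp add: rational_function_eq)
qed

lemma function_field_carrier:
  "carrier (function_field V) = rational_function V ` {h. generically V (regular_at V h)}"
  unfolding function_field_def FactRing_def A_RCOSETS_def RCOSETS_def rational_function_def a_r_coset_def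
  by (auto simp: generic_ring_def)

lemma rational_function_hom:
  assumes V: "projective_variety V"
  shows "rational_function V \<in> ring_hom (generic_ring V) (function_field V)"
proof -
  have "rational_function V = (+>\<^bsub>generic_ring V\<^esub>) (null_ideal V)"
    by (rule ext) (simp add: rational_function_def)
  then show ?thesis
    using ideal.rcos_ring_hom[OF ideal_null_ideal[OF V]] by (simp add: function_field_def)
qed

lemma function_field_ops:
  assumes V: "projective_variety V"
  shows "generically V (regular_at V h) \<Longrightarrow> generically V (regular_at V h') \<Longrightarrow>
      rational_function V h \<oplus>\<^bsub>function_field V\<^esub> rational_function V h' = rational_function V (\<lambda>P. h P + h' P)"
    and "generically V (regular_at V h) \<Longrightarrow> generically V (regular_at V h') \<Longrightarrow>
      rational_function V h \<otimes>\<^bsub>function_field V\<^esub> rational_function V h' = rational_function V (\<lambda>P. h P * h' P)"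
    and "\<one>\<^bsub>function_field V\<^esub> = rational_function V (\<lambda>P. 1)"
    and "\<zero>\<^bsub>function_field V\<^esub> = rational_function V (\<lambda>P. 0)"
proof -
  note hom = rational_function_hom[OF V]
  show "\<one>\<^bsub>function_field V\<^esub> = rational_function V (\<lambda>P. 1)"
    using ring_hom_memE(4)[OF hom] by (simp add: generic_ring_def)
  show "\<zero>\<^bsub>function_field V\<^esub> = rational_function V (\<lambda>P. 0)"
    by (simp add: function_field_def FactRing_def null_ideal_def rational_function_eq)
  assume "generically V (regular_at V h)" "generically V (regular_at V h')"
  then have "h \<in> carrier (generic_ring V)" "h' \<in> carrier (generic_ring V)"
    by (simp_all add: generic_ring_def)
  from ring_hom_memE(2,3)[OF hom this]
  show "rational_function V h \<oplus>\<^bsub>function_field V\<^esub> rational_function V h' = rational_function V (\<lambda>P. h P + h' P)"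
    "rational_function V h \<otimes>\<^bsub>function_field V\<^esub> rational_function V h' = rational_function V (\<lambda>P. h P * h' P)"
    by (simp_all add: generic_ring_def)
qed

text \<open>A nonzero class is generically nowhere zero by \<open>ratfun_zero_or_nonzero\<close>, so
  the pointwise inverse represents its inverse.\<close>

lemma field_function_field:
  assumes V: "projective_variety V" shows "Ring.field (function_field V)"
proof -
  have "cring (function_field V)" unfolding function_field_def
    by (rule ideal.quotient_is_cring[OF ideal_null_ideal[OF V] cring_generic_ring[OF V]])
  then show ?thesis
  proof (rule cring.cring_fieldI2)
    show "\<zero>\<^bsub>function_field V\<^esub> \<noteq> \<one>\<^bsub>function_field V\<^esub>"
    proof
      assume "\<zero>\<^bsub>function_field V\<^esub> = \<one>\<^bsub>function_field V\<^esub>"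
      then have "generically V (\<lambda>P. (0 :: 'a) = 1)"
        unfolding function_field_ops[OF V] rational_function_eq_iff[OF V] .
      then show False using generically_ex by fastforce
    qed
    fix a assume "a \<in> carrier (function_field V)" "a \<noteq> \<zero>\<^bsub>function_field V\<^esub>"
    then obtain h where h: "generically V (regular_at V h)" "a = rational_function V h"
      "\<not> generically V (\<lambda>P. h P = 0)"
      unfolding function_field_ops[OF V] function_field_carrier using rational_function_eq_iff[OF V] by blast
    note nz = ratfun_zero_or_nonzero[OF V h(1,3)]
    note i = ratfun_inverse[OF V h(1) nz]
    have "rational_function V (\<lambda>P. h P * inverse (h P)) = rational_function V (\<lambda>P. 1)"
      unfolding rational_function_eq_iff[OF V] by (rule generically_mono[OF nz]) simp
    then show "\<exists>b\<in>carrier (function_field V). a \<otimes>\<^bsub>function_field V\<^esub> b = \<one>\<^bsub>function_field V\<^esub>"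
      using i h(1) by (intro bexI[of _ "rational_function V (\<lambda>P. inverse (h P))"])
        (simp_all add: h(2) function_field_ops[OF V] function_field_carrier)
  qed
qed

section \<open>Pull-back along dominant rational maps\<close>

lemma pullback_rational_function:
  assumes V: "projective_variety V" and W: "projective_variety W" and \<phi>: "dominant V \<phi> W"
  shows "pullback V \<phi> (rational_function W h) = rational_function V (\<lambda>P. h (\<phi> P))"
proof -
  have "rational_function V (h' \<circ> \<phi>) = rational_function V (\<lambda>P. h (\<phi> P))" if "h' \<in> rational_function W h" for h'
  proof -
    have "generically W (\<lambda>P. h' P = h P)" using that by (simp add: rational_function_eq)
    from dominantD[OF \<phi> this] show ?thesis by (simp add: rational_function_eq_iff[OF V])
  qed
  moreover have "h \<in> rational_function W h"
    by (auto simp: rational_function_eq intro: generically_all[OF W])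
  ultimately show ?thesis unfolding pullback_def by blast
qed

lemma pullback_hom:
  assumes V: "projective_variety V" and W: "projective_variety W" and \<phi>: "dominant V \<phi> W"
  shows "pullback V \<phi> \<in> ring_hom (function_field W) (function_field V)"
proof (rule ring_hom_memI)
  note pb = pullback_rational_function[OF V W \<phi>]
  note c = dominant_ratfun_comp[OF V \<phi>]
  show "pullback V \<phi> \<one>\<^bsub>function_field W\<^esub> = \<one>\<^bsub>function_field V\<^esub>"
    by (simp add: function_field_ops[OF V] function_field_ops[OF W] pb)
  fix x assume "x \<in> carrier (function_field W)"
  then obtain h where h: "generically W (regular_at W h)" "x = rational_function W h"
    by (auto simp: function_field_carrier)
  show "pullback V \<phi> x \<in> carrier (function_field V)"
    using c[OF h(1)] by (auto simp: h(2) pb function_field_carrier)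
  fix y assume "y \<in> carrier (function_field W)"
  then obtain h' where h': "generically W (regular_at W h')" "y = rational_function W h'"
    by (auto simp: function_field_carrier)
  show "pullback V \<phi> (x \<otimes>\<^bsub>function_field W\<^esub> y) = pullback V \<phi> x \<otimes>\<^bsub>function_field V\<^esub> pullback V \<phi> y"
    "pullback V \<phi> (x \<oplus>\<^bsub>function_field W\<^esub> y) = pullback V \<phi> x \<oplus>\<^bsub>function_field V\<^esub> pullback V \<phi> y"
    using h(1) h'(1) c[OF h(1)] c[OF h'(1)]
    by (simp_all add: h(2) h'(2) pb function_field_ops[OF V] function_field_ops[OF W])
qed

lemma pullback_inj:
  assumes "projective_variety V" "projective_variety W" "dominant V \<phi> W"
  shows "inj_on (pullback V \<phi>) (carrier (function_field W))"
  by (rule non_trivial_field_hom_is_inj[OF pullback_hom[OF assms]]) (use assms in \<open>auto intro: field_function_field\<close>)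

lemma pullback_image_subfield:
  assumes "projective_variety V" "projective_variety W" "dominant V \<phi> W"
  shows "subfield (pullback V \<phi> ` carrier (function_field W)) (function_field V)"
proof -
  interpret W: Ring.field "function_field W" by (rule field_function_field[OF assms(2)])
  interpret V: Ring.field "function_field V" by (rule field_function_field[OF assms(1)])
  interpret h: ring_hom_ring "function_field W" "function_field V" "pullback V \<phi>"
    by (rule ring_hom_ringI2[OF W.ring_axioms V.ring_axioms pullback_hom[OF assms]])
  show ?thesis by (rule h.img_is_subfield(2)[OF W.carrier_is_subfield V.one_not_zero])
qed

lemma pullback_constants:
  assumes "projective_variety V" "projective_variety W" "dominant V \<phi> W"
  shows "constants V \<subseteq> pullback V \<phi> ` carrier (function_field W)"
proof -
  have "rational_function V (\<lambda>P. a) \<in> pullback V \<phi> ` carrier (function_field W)" for a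
    using pullback_rational_function[OF assms, of "\<lambda>P. a"] ratfun_const[OF assms(2), of a]
    by (auto simp: function_field_carrier image_iff intro!: bexI[of _ "rational_function W (\<lambda>P. a)"])
  then show ?thesis by (auto simp: constants_def)
qed

lemma pullback_comp:
  assumes V: "projective_variety V" and W: "projective_variety W" and Y: "projective_variety Y"
    and \<phi>: "dominant V \<phi> W" and \<psi>: "dominant W \<psi> Y" and c: "c \<in> carrier (function_field Y)"
  shows "pullback V \<phi> (pullback W \<psi> c) = pullback V (\<lambda>P. \<psi> (\<phi> P)) c"
proof -
  obtain h where "c = rational_function Y h" using c by (auto simp: function_field_carrier)
  then show ?thesis
    by (simp add: pullback_rational_function[OF W Y \<psi>] pullback_rational_function[OF V W \<phi>]
      pullback_rational_function[OF V Y dominant_comp[OF V \<phi> \<psi>]])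
qed

lemma pullback_cong:
  assumes V: "projective_variety V" and W: "projective_variety W"
    and \<phi>: "dominant V \<phi> W" "dominant V \<psi> W" and e: "generically V (\<lambda>P. \<phi> P = \<psi> P)"
    and c: "c \<in> carrier (function_field W)"
  shows "pullback V \<phi> c = pullback V \<psi> c"
proof -
  obtain h where "c = rational_function W h" using c by (auto simp: function_field_carrier)
  moreover have "generically V (\<lambda>P. h (\<phi> P) = h (\<psi> P))" by (rule generically_mono[OF e]) simp
  ultimately show ?thesis
    by (simp add: pullback_rational_function[OF V W] \<phi> rational_function_eq_iff[OF V])
qed

section \<open>Automorphisms and the projective line\<close>

text \<open>Over a finite field the product of all \<open>T - x\<close>, plus 1, would be a
  nonconstant polynomial without a root.\<close>

lemma infinite_UNIV_alg_closed: "infinite (UNIV :: 'a::alg_closed_field set)"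
proof
  assume fin: "finite (UNIV :: 'a set)"
  let ?p = "(\<Prod>x\<in>UNIV. [:- x, 1:]) :: 'a poly"
  have "Polynomial.degree ?p = card (UNIV :: 'a set)"
    by (subst degree_prod_eq_sum_degree) simp_all
  moreover have "card (UNIV :: 'a set) > 0" using fin by (simp add: card_gt_0_iff)
  ultimately have d: "Polynomial.degree ?p > 0" by simp
  then have "Polynomial.degree (?p + 1) > 0" by (simp add: degree_add_eq_left)
  then obtain x where "poly (?p + 1) x = 0" using alg_closed_imp_poly_has_root by blast
  moreover have "poly ?p x = 0" using fin by (auto simp: poly_prod)
  ultimately show False by simp
qed

lemma closed_generic_dichotomy:
  assumes "zclosed Z" "\<not> Y \<subseteq> Z"
  shows "generically Y (\<lambda>P. P \<notin> Z)"
proof -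
  obtain P where P: "P \<in> Y" "P \<notin> Z" using assms(2) by blast
  then obtain d h where h: "form_fun d h" "P \<in> nz h" "Z \<inter> nz h = {}"
    using assms(1)[unfolded zclosed_iff] by blast
  then have "Y \<inter> nz h \<noteq> {}" using P by blast
  from generically_nz[OF h(1) this] show ?thesis by (rule generically_mono) (use h(3) in blast)
qed

text \<open>The composite and q agree generically. If either of the two closed sets failed to
  contain the other, a generic point would land outside the set in which it must lie. Taking q to be
  the identity yields the image of an inverse map.\<close>

lemma rational_image_eqI:
  assumes V: "projective_variety V" and W: "projective_variety W" and C: "projective_variety C"
    and \<phi>: "dominant V \<phi> W" and \<psi>: "generically W (regular_map_at W \<psi>)"
    and q: "dominant V q C" and e: "generically V (\<lambda>P. \<psi> (\<phi> P) = q P)" 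
    and qC: "generically V (\<lambda>P. q P \<in> C)"
  shows "rational_image W \<psi> = C"
proof
  note im = rational_image_dominant[OF W \<psi>]
  show "rational_image W \<psi> \<subseteq> C"
  proof (rule ccontr)
    assume "\<not> ?thesis"
    with C have "generically (rational_image W \<psi>) (\<lambda>P. P \<notin> C)"
      by (intro closed_generic_dichotomy) (simp add: projective_variety_def)
    from generically_conj[OF V e generically_conj[OF V qC dominantD[OF \<phi> dominantD[OF im(2) this]]]]
    obtain P where "\<psi> (\<phi> P) = q P \<and> q P \<in> C \<and> \<psi> (\<phi> P) \<notin> C" using generically_ex by blast
    then show False by auto
  qed
  show "C \<subseteq> rational_image W \<psi>"
  proof (rule ccontr)
    assume "\<not> ?thesis"
    with im(1) have "generically C (\<lambda>P. P \<notin> rational_image W \<psi>)"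
      by (intro closed_generic_dichotomy) (simp add: projective_variety_def)
    from generically_conj[OF V e generically_conj[OF V dominantD[OF q this] dominantD[OF \<phi> im(3)]]]
    obtain P where "\<psi> (\<phi> P) = q P \<and> q P \<notin> rational_image W \<psi> \<and> \<psi> (\<phi> P) \<in> rational_image W \<psi>" using generically_ex by blast
    then show False by auto
  qed
qed

lemma ratmap_id: "projective_variety V \<Longrightarrow> generically V (regular_map_at V (\<lambda>P. P))"
  by (rule ratmapI[where A = "\<lambda>j v. v $ j", OF form_fun_coord])
    (auto intro!: generically_all simp: rep_pspace_nonzero pt_rep_pspace)

lemma morphism_dominant:
  assumes V: "projective_variety V" and W: "projective_variety W"
    and \<phi>: "morphism V W \<phi>" "\<phi> ` V = W"
  shows "dominant V \<phi> W"
proof -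
  have reg: "generically V (regular_map_at V \<phi>)"
    using \<phi> by (intro generically_all[OF V]) (simp add: morphism_def)
  have "{P \<in> V. regular_map_at V \<phi> P} = V" using \<phi> by (auto simp: morphism_def)
  then have "rational_image V \<phi> = zclosure W" using \<phi>(2) by (simp add: rational_image_def)
  moreover have "zclosure W = W" using W by (auto simp: zclosure_def projective_variety_def)
  ultimately show ?thesis using rational_image_dominant(2)[OF V reg] by simp
qed

text \<open>An affine coordinate on the chart where coordinate j is nonzero. Off the chart division
  by zero returns 0, hence the genericity assumptions in the lemmas about it.\<close>

definition coord_ratio :: "'n \<Rightarrow> 'n \<Rightarrow> ('a::field, 'n::finite) pspace \<Rightarrow> 'a" where
  "coord_ratio i j P = rep_pspace P $ i / rep_pspace P $ j"

lemma coord_ratio_pt: "v \<noteq> 0 \<Longrightarrow> coord_ratio i j (pt v) = v $ i / v $ j"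
  unfolding coord_ratio_def using form_quot_pt[OF form_fun_coord form_fun_coord] .

lemma coord_ratio_ratfun:
  assumes "generically V (\<lambda>P. rep_pspace P $ j \<noteq> 0)"
  shows "generically V (regular_at V (coord_ratio i j))"
  by (rule ratfunI[OF form_fun_coord[of i] form_fun_coord[of j]])
    (use assms in \<open>simp add: coord_ratio_def\<close>)

lemma generically_coord_nonzero: "P \<in> V \<Longrightarrow> rep_pspace P $ j \<noteq> 0 \<Longrightarrow> generically V (\<lambda>P. rep_pspace P $ j \<noteq> 0)"
proof -
  assume "P \<in> V" "rep_pspace P $ j \<noteq> 0"
  then have "V \<inter> nz (\<lambda>v. v $ j) \<noteq> {}" using in_nz_iff[OF form_fun_coord[of j], of P] by blast
  from generically_nz[OF form_fun_coord this] show ?thesis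
    by (rule generically_mono) (simp add: in_nz_iff[OF form_fun_coord])
qed

lemma ex_coord_nonzero:
  assumes "projective_variety V"
  obtains j where "generically V (\<lambda>P. rep_pspace P $ j \<noteq> 0)"
proof -
  obtain P where P: "P \<in> V" using assms by (auto simp: projective_variety_def)
  obtain j where "rep_pspace P $ j \<noteq> 0" using rep_pspace_nonzero[of P] by (auto simp: vec_eq_iff)
  with generically_coord_nonzero[OF P] that show thesis by blast
qed

lemma pt_coord_ratios:
  assumes "rep_pspace P $ j \<noteq> 0"
  shows "(\<chi> i. coord_ratio i j P) \<noteq> 0" "pt (\<chi> i. coord_ratio i j P) = P"
proof -
  have e: "(\<chi> i. coord_ratio i j P) = inverse (rep_pspace P $ j) *s rep_pspace P"
    by (simp add: vec_eq_iff coord_ratio_def field_simps)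
  show "(\<chi> i. coord_ratio i j P) \<noteq> 0"
    using assms by (auto simp: vec_eq_iff coord_ratio_def intro!: exI[of _ j])
  show "pt (\<chi> i. coord_ratio i j P) = P"
    unfolding e using pt_scale[OF nonzero_imp_inverse_nonzero[OF assms] rep_pspace_nonzero] by (simp add: pt_rep_pspace)
qed

section \<open>Automorphisms acting on the function field\<close>

lemma Aut_dominant:
  assumes V: "projective_variety V" and s: "\<sigma> \<in> carrier (Aut_var V)"
  shows "dominant V \<sigma> V"
  by (rule morphism_dominant[OF V V]) (use s in \<open>auto simp: Aut_var_def Bij_def bij_betw_def\<close>)

text \<open>Coordinate ratios recover a point, so equal pull-backs force the automorphisms to agree
  generically. Being morphisms, they then agree on all of V, and members of \<open>Bij\<close> are
  extensional, so they are equal as total functions.\<close>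

lemma Aut_pullback_faithful:
  assumes V: "projective_variety V" and s: "\<sigma> \<in> carrier (Aut_var V)" and t: "\<tau> \<in> carrier (Aut_var V)"
    and eq: "\<And>c. c \<in> carrier (function_field V) \<Longrightarrow> pullback V \<sigma> c = pullback V \<tau> c"
  shows "\<sigma> = \<tau>"
proof -
  note ds = Aut_dominant[OF V s] and dt = Aut_dominant[OF V t]
  obtain j where j: "generically V (\<lambda>P. rep_pspace P $ j \<noteq> 0)" by (rule ex_coord_nonzero[OF V])
  have "generically V (\<lambda>P. coord_ratio i j (\<sigma> P) = coord_ratio i j (\<tau> P))" for i
  proof -
    have "pullback V \<sigma> (rational_function V (coord_ratio i j)) = pullback V \<tau> (rational_function V (coord_ratio i j))"
      by (rule eq) (use coord_ratio_ratfun[OF j] in \<open>auto simp: function_field_carrier\<close>)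
    then show ?thesis
      by (simp add: pullback_rational_function[OF V V ds] pullback_rational_function[OF V V dt] rational_function_eq_iff[OF V])
  qed
  then have "generically V (\<lambda>P. \<forall>i\<in>UNIV. coord_ratio i j (\<sigma> P) = coord_ratio i j (\<tau> P))"
    by (intro generically_ball_finite[OF V]) simp_all
  from this generically_conj[OF V dominantD[OF ds j] dominantD[OF dt j]]
  have "generically V (\<lambda>P. \<sigma> P = \<tau> P)"
  proof (rule generically_mp[OF V])
    fix P assume e: "\<forall>i\<in>UNIV. coord_ratio i j (\<sigma> P) = coord_ratio i j (\<tau> P)"
      and nz: "rep_pspace (\<sigma> P) $ j \<noteq> 0 \<and> rep_pspace (\<tau> P) $ j \<noteq> 0"
    have "\<sigma> P = pt (\<chi> i. coord_ratio i j (\<sigma> P))" using pt_coord_ratios(2) nz by metis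
    also have "\<dots> = pt (\<chi> i. coord_ratio i j (\<tau> P))" using e by simp
    also have "\<dots> = \<tau> P" using pt_coord_ratios(2) nz by blast
    finally show "\<sigma> P = \<tau> P" .
  qed
  then have "\<sigma> P = \<tau> P" if "P \<in> V" for P
    by (rule regular_maps_agree[OF V]) (use s t that in \<open>auto simp: Aut_var_def morphism_def\<close>)
  then show ?thesis
    using s t by (intro extensionalityI[of \<sigma> V \<tau>]) (auto simp: Aut_var_def Bij_def)
qed

lemma Aut_pullback_family:
  assumes V: "projective_variety V" and G: "subgroup G (Aut_var V)" "finite G"
  shows "endo_family (function_field V) (pullback V ` G)"
    and "fixed_points (function_field V) (pullback V ` G) = fixed_field V G"
    and "c \<in> carrier (function_field V) \<Longrightarrow> pullback V \<one>\<^bsub>Aut_var V\<^esub> c = c"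
proof -
  show "fixed_points (function_field V) (pullback V ` G) = fixed_field V G"
    by (auto simp: fixed_points_def fixed_field_def)
  have sub: "\<sigma> \<in> carrier (Aut_var V)" if "\<sigma> \<in> G" for \<sigma> using subgroup.subset[OF G(1)] that by blast
  have dom: "dominant V \<sigma> V" if "\<sigma> \<in> G" for \<sigma> using Aut_dominant[OF V sub[OF that]] .
  have one: "\<one>\<^bsub>Aut_var V\<^esub> \<in> G" by (rule subgroup.one_closed[OF G(1)])
  have one_id: "pullback V \<one>\<^bsub>Aut_var V\<^esub> c = c" if c: "c \<in> carrier (function_field V)" for c
  proof -
    obtain h where h: "c = rational_function V h" using c by (auto simp: function_field_carrier)
    show ?thesis unfolding h pullback_rational_function[OF V V dom[OF one]] rational_function_eq_iff[OF V]
      by (rule generically_all[OF V]) (simp add: Aut_var_def BijGroup_def)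
  qed
  then show "c \<in> carrier (function_field V) \<Longrightarrow> pullback V \<one>\<^bsub>Aut_var V\<^esub> c = c" .
  have comp: "\<exists>\<rho>\<in>G. \<forall>c\<in>carrier (function_field V). pullback V \<rho> c = pullback V \<sigma> (pullback V \<tau> c)"
    if st: "\<sigma> \<in> G" "\<tau> \<in> G" for \<sigma> \<tau>
  proof (intro bexI ballI)
    \<comment> \<open>Pull-back is contravariant: pulling back along \<tau> and then along \<sigma>
      is pulling back along \<tau> after \<sigma>.\<close>
    show ts: "\<tau> \<otimes>\<^bsub>Aut_var V\<^esub> \<sigma> \<in> G" using subgroup.m_closed[OF G(1)] st by blast
    fix c assume c: "c \<in> carrier (function_field V)"
    have "generically V (\<lambda>P. (\<tau> \<otimes>\<^bsub>Aut_var V\<^esub> \<sigma>) P = \<tau> (\<sigma> P))"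
      using sub[OF st(1)] sub[OF st(2)]
      by (intro generically_all[OF V]) (simp add: Aut_var_def BijGroup_def compose_def)
    from pullback_cong[OF V V dom[OF ts] dominant_comp[OF V dom[OF st(1)] dom[OF st(2)]] this c]
      pullback_comp[OF V V V dom[OF st(1)] dom[OF st(2)] c]
    show "pullback V (\<tau> \<otimes>\<^bsub>Aut_var V\<^esub> \<sigma>) c = pullback V \<sigma> (pullback V \<tau> c)" by simp
  qed
  show "endo_family (function_field V) (pullback V ` G)" unfolding endo_family_def
  proof (intro conjI)
    show "finite (pullback V ` G)" using G(2) by simp
    show "pullback V ` G \<subseteq> ring_hom (function_field V) (function_field V)"
      using pullback_hom[OF V V dom] by blast
    show "\<exists>u\<in>pullback V ` G. \<forall>x\<in>carrier (function_field V). u x = x" using one one_id by blast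
    show "\<forall>s\<in>pullback V ` G. \<forall>t\<in>pullback V ` G. \<exists>u\<in>pullback V ` G. \<forall>x\<in>carrier (function_field V). u x = s (t x)"
      using comp by simp
  qed
qed

section \<open>Constants and the projective line\<close>

lemma subfield_constants:
  assumes V: "projective_variety V" shows "subfield (constants V) (function_field V)"
proof -
  interpret Ring.field "function_field V" by (rule field_function_field[OF V])
  note c = ratfun_const[OF V]
  note ops = function_field_ops[OF V]
  have carr: "rational_function V (\<lambda>P. a) \<in> carrier (function_field V)" for a
    using c by (auto simp: function_field_carrier)
  show ?thesis
  proof (rule subfieldI'[OF subringI])
    show "constants V \<subseteq> carrier (function_field V)" using carr by (auto simp: constants_def)
    show "\<one>\<^bsub>function_field V\<^esub> \<in> constants V" by (auto simp: constants_def ops)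
    show "\<ominus>\<^bsub>function_field V\<^esub> x \<in> constants V" if x: "x \<in> constants V" for x
    proof -
      obtain a where a: "x = rational_function V (\<lambda>P. a)" using x unfolding constants_def by blast
      have "\<ominus>\<^bsub>function_field V\<^esub> x = rational_function V (\<lambda>P. - a)"
        by (rule minus_equality) (simp_all add: a carr ops c)
      then show ?thesis by (simp add: constants_def)
    qed
    show "x \<otimes>\<^bsub>function_field V\<^esub> y \<in> constants V" "x \<oplus>\<^bsub>function_field V\<^esub> y \<in> constants V"
      if "x \<in> constants V" "y \<in> constants V" for x y
      using that by (auto simp: constants_def ops c)
    show "inv\<^bsub>function_field V\<^esub> x \<in> constants V" if x: "x \<in> constants V - {\<zero>\<^bsub>function_field V\<^esub>}" for x
    proof -
      obtain a where a: "x = rational_function V (\<lambda>P. a)" using x unfolding constants_def by blast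
      have "a \<noteq> 0" using x by (auto simp: a ops)
      then have "inv\<^bsub>function_field V\<^esub> x = rational_function V (\<lambda>P. inverse a)"
        by (intro comm_inv_char) (simp_all add: a carr ops c)
      then show ?thesis by (simp add: constants_def)
    qed
  qed
qed

lemma infinite_constants:
  assumes V: "projective_variety (V :: ('a::alg_closed_field, 'n::finite) pspace set)"
  shows "infinite (constants V)"
proof -
  have "inj (\<lambda>a. rational_function V (\<lambda>P. a))"
  proof (rule injI)
    fix a b assume "rational_function V (\<lambda>P. a) = rational_function V (\<lambda>P. b)"
    then have "generically V (\<lambda>P. a = b)" by (simp add: rational_function_eq_iff[OF V])
    then show "a = b" using generically_ex by blast
  qed
  then show ?thesis unfolding constants_def using infinite_UNIV_alg_closed by (simp add: finite_image_iff)
qed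

text \<open>Dehomogenize in both charts, to p and q. If p were 0, homogeneity would make t vanish
  wherever the second coordinate is nonzero; then q has infinitely many roots and is 0 as well,
  which kills t at the remaining points, against \<open>ne\<close>.\<close>

lemma finite_affine_zeros:
  fixes t :: "'a::alg_closed_field ^ 2 \<Rightarrow> 'a"
  assumes t: "form_fun d t" and ne: "nz t \<noteq> {}"
  shows "finite {a. t (vector [a, 1]) = 0}"
proof -
  obtain M c where M: "finite M" "\<And>v. t v = (\<Sum>m\<in>M. c m * mono_fun m v)"
    using form_fun_decomp[OF t] by blast
  have mono: "mono_fun m (vector [a, b]) = a ^ Poly_Mapping.lookup m 1 * b ^ Poly_Mapping.lookup m 2"
    for m :: "2 \<Rightarrow>\<^sub>0 nat" and a b :: 'a by (simp add: mono_fun_def UNIV_2)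
  define p where "p = (\<Sum>m\<in>M. Polynomial.monom (c m) (Poly_Mapping.lookup m 1))"
  define q where "q = (\<Sum>m\<in>M. Polynomial.monom (c m) (Poly_Mapping.lookup m 2))"
  have p: "t (vector [a, 1]) = poly p a" for a by (simp add: M(2) mono p_def poly_sum poly_monom)
  have q: "t (vector [1, b]) = poly q b" for b by (simp add: M(2) mono q_def poly_sum poly_monom)
  have scale: "t (vector [x * a, x * b]) = x ^ d * t (vector [a, b])" for x a b
  proof -
    have "(vector [x * a, x * b] :: 'a ^ 2) = x *s vector [a, b]" by (simp add: vec_eq_iff forall_2)
    then show ?thesis using form_fun_scale[OF t] by simp
  qed
  have "p \<noteq> 0"
  proof
    assume p0: "p = 0"
    have b: "t (vector [a, b]) = 0" if "b \<noteq> 0" for a b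
      using scale[of b "a / b" 1] that p p0 by simp
    then have "UNIV - {0} \<subseteq> {b. poly q b = 0}" unfolding q[symmetric] by auto
    moreover have "infinite (UNIV - {0 :: 'a})" using infinite_UNIV_alg_closed by simp
    ultimately have "q = 0" using poly_roots_finite finite_subset by blast
    then have "t (vector [a, 0]) = 0" for a using scale[of a 1 0] q by simp
    with b have z: "t (vector [a, b]) = 0" for a b by (cases "b = 0") auto
    obtain v where "t v \<noteq> 0" using ne by (auto simp: nz_def)
    moreover have "v = vector [v $ 1, v $ 2]" by (simp add: vec_eq_iff forall_2)
    ultimately show False using z[of "v $ 1" "v $ 2"] by simp
  qed
  then show ?thesis unfolding p by (rule poly_roots_finite)
qed

text \<open>For each a, the equation h = a either holds generically or fails generically. If it
  failed for every a in A, the values would generically avoid the finite set A.\<close>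

lemma generically_in_finite_const:
  assumes V: "projective_variety V" and h: "generically V (regular_at V h)"
    and A: "finite A" "generically V (\<lambda>P. h P \<in> A)"
  shows "\<exists>a. generically V (\<lambda>P. h P = a)"
proof (rule ccontr)
  assume no: "\<not> ?thesis"
  have "generically V (\<lambda>P. h P \<noteq> a)" for a
  proof -
    have "generically V (regular_at V (\<lambda>P. h P + - a))" by (rule ratfun_add[OF V h ratfun_const[OF V]])
    moreover have "\<not> generically V (\<lambda>P. h P + - a = 0)" using no by simp
    ultimately have "generically V (\<lambda>P. h P + - a \<noteq> 0)" by (rule ratfun_zero_or_nonzero[OF V])
    then show ?thesis by simp
  qed
  then have "generically V (\<lambda>P. \<forall>a\<in>A. h P \<noteq> a)" by (intro generically_ball_finite[OF V A(1)])
  from generically_conj[OF V A(2) this] show False using generically_ex by blast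
qed

section \<open>Birationality and Galois points\<close>

text \<open>Conjugation by h moves an action on K to R. It is needed because the groups act on the
  function field of the curve, while a Galois point is a condition on that of the plane
  image.\<close>

lemma endo_family_transport:
  assumes R: "ring R" and h: "h \<in> ring_iso R K" and S: "endo_family K S"
  defines "S' \<equiv> (\<lambda>s x. inv_into (carrier R) h (s (h x))) ` S"
  shows "endo_family R S'" "fixed_points R S' = {x \<in> carrier R. h x \<in> fixed_points K S}"
proof -
  let ?g = "inv_into (carrier R) h"
  have hom: "h \<in> ring_hom R K" and bij: "bij_betw h (carrier R) (carrier K)"
    using h by (auto simp: ring_iso_def)
  have ghom: "?g \<in> ring_hom K R" using ring_iso_set_sym[OF R h] by (auto simp: ring_iso_def)
  have gh: "?g (h x) = x" if "x \<in> carrier R" for x using bij_betw_inv_into_left[OF bij that] .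
  have hg: "h (?g y) = y" if "y \<in> carrier K" for y using bij_betw_inv_into_right[OF bij that] .
  have hc: "h x \<in> carrier K" if "x \<in> carrier R" for x using ring_hom_memE(1)[OF hom that] .
  have Sh: "s \<in> ring_hom K K" if "s \<in> S" for s using S that by (auto simp: endo_family_def)
  show "fixed_points R S' = {x \<in> carrier R. h x \<in> fixed_points K S}"
  proof -
    have "?g (s (h x)) = x \<longleftrightarrow> s (h x) = h x" if "s \<in> S" "x \<in> carrier R" for s x
      using gh[OF that(2)] hg[of "s (h x)"] ring_hom_memE(1)[OF Sh[OF that(1)] hc[OF that(2)]] by auto
    then show ?thesis using hc by (auto simp: fixed_points_def S'_def)
  qed
  show "endo_family R S'" unfolding endo_family_def
  proof (intro conjI)
    show "finite S'" using S by (simp add: S'_def endo_family_def)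
    show "S' \<subseteq> ring_hom R R"
    proof
      fix s' assume "s' \<in> S'"
      then obtain s where s: "s \<in> S" "s' = (\<lambda>x. ?g (s (h x)))" by (auto simp: S'_def)
      then show "s' \<in> ring_hom R R"
        using ring_hom_trans[OF ring_hom_trans[OF hom Sh[OF s(1)]] ghom] by (simp add: comp_def)
    qed
    obtain u where u: "u \<in> S" "\<forall>x\<in>carrier K. u x = x" using S by (auto simp: endo_family_def)
    then show "\<exists>u\<in>S'. \<forall>x\<in>carrier R. u x = x" using gh hc by (auto simp: S'_def intro!: bexI[of _ u])
    show "\<forall>s\<in>S'. \<forall>t\<in>S'. \<exists>u\<in>S'. \<forall>x\<in>carrier R. u x = s (t x)"
    proof (intro ballI)
      fix s' t' assume "s' \<in> S'" "t' \<in> S'"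
      then obtain s t where st: "s \<in> S" "t \<in> S" "s' = (\<lambda>x. ?g (s (h x)))" "t' = (\<lambda>x. ?g (t (h x)))"
        by (auto simp: S'_def)
      obtain u where u: "u \<in> S" "\<forall>x\<in>carrier K. u x = s (t x)"
        using S st(1,2) unfolding endo_family_def by blast
      show "\<exists>u\<in>S'. \<forall>x\<in>carrier R. u x = s' (t' x)"
      proof (intro bexI ballI)
        fix x assume x: "x \<in> carrier R"
        show "?g (u (h x)) = s' (t' x)"
          using u(2) hc[OF x] hg[OF ring_hom_memE(1)[OF Sh[OF st(2)] hc[OF x]]] by (simp add: st)
      qed (use u(1) in \<open>auto simp: S'_def\<close>)
    qed
  qed
qed

lemma pullback_iso:
  assumes "projective_variety V" "projective_variety W" "dominant V \<phi> W"
    and "pullback V \<phi> ` carrier (function_field W) = carrier (function_field V)"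
  shows "pullback V \<phi> \<in> ring_iso (function_field W) (function_field V)"
  using pullback_hom[OF assms(1-3)] pullback_inj[OF assms(1-3)] assms(4) by (auto simp: ring_iso_def bij_betw_def)

text \<open>Two forms that are not identically zero have finitely many zeros in the affine chart,
  and the field is infinite, so some point avoids both zero sets.\<close>

lemma projective_variety_P1: "projective_variety (UNIV :: ('a::alg_closed_field, 2) pspace set)"
proof (rule projective_varietyI)
  show "zclosed (UNIV :: ('a, 2) pspace set)" by (simp add: zclosed_iff)
  fix d e and h h' :: "'a ^ 2 \<Rightarrow> 'a"
  assume h: "form_fun d h" "form_fun e h'" "UNIV \<inter> nz h \<noteq> {}" "UNIV \<inter> nz h' \<noteq> {}"
  then have "finite ({a. h (vector [a, 1]) = 0} \<union> {a. h' (vector [a, 1]) = 0})"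
    by (intro finite_UnI finite_affine_zeros[OF h(1)] finite_affine_zeros[OF h(2)]) auto
  then obtain a where a: "h (vector [a, 1]) \<noteq> 0" "h' (vector [a, 1]) \<noteq> 0"
    using ex_new_if_finite[OF infinite_UNIV_alg_closed] by blast
  have "(vector [a, 1] :: 'a ^ 2) \<noteq> 0" by (simp add: vec_eq_iff forall_2)
  with a have "pt (vector [a, 1]) \<in> nz h \<inter> nz h'" using pt_in_nz[OF h(1)] pt_in_nz[OF h(2)] by blast
  then show "UNIV \<inter> (nz h \<inter> nz h') \<noteq> {}" by blast
qed simp

text \<open>A constant generator would leave only constants in the fixed field. But the affine
  coordinate of the projective line composed with the quotient map is invariant, and it is not
  constant because the quotient map is dominant.\<close>

lemma generator_nonconstant:
  fixes V :: "('a::alg_closed_field, 'n::finite) pspace set"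
  assumes V: "projective_variety V"
    and G: "subgroup G (Aut_var V)" and quot: "quotient_is_P1 V G"
    and gen: "generate_field (function_field V) (insert (rational_function V h) (constants V)) = fixed_field V G"
  shows "\<not> generically V (\<lambda>P. h P = a)"
proof
  assume "generically V (\<lambda>P. h P = a)"
  then have "rational_function V h = rational_function V (\<lambda>P. a)" by (simp add: rational_function_eq_iff[OF V])
  then have "rational_function V h \<in> constants V" by (simp add: constants_def)
  then have gc: "fixed_field V G \<subseteq> constants V"
    using field.generate_field_min_subfield1[OF field_function_field[OF V] _ subfield_constants[OF V]]
      subringE(1)[OF subfieldE(1)[OF subfield_constants[OF V]]]
    unfolding gen[symmetric] by (simp add: insert_absorb)
  obtain q :: "('a, 'n) pspace \<Rightarrow> ('a, 2) pspace" where q: "is_quotient V G UNIV q"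
    using quot by (auto simp: quotient_is_P1_def)
  have inv: "q (\<sigma> P) = q P" if "\<sigma> \<in> G" "P \<in> V" for \<sigma> P
  proof -
    have "\<sigma> \<in> carrier (Aut_var V)" using subgroup.subset[OF G] that(1) by blast
    then have "\<sigma> P \<in> V" using that(2) by (auto simp: Aut_var_def morphism_def)
    then show ?thesis using q that unfolding is_quotient_def by metis
  qed
  have dq: "dominant V q UNIV" by (rule morphism_dominant[OF V projective_variety_P1]) (use q in \<open>simp_all add: is_quotient_def\<close>)
  let ?u = "coord_ratio 1 2 :: ('a, 2) pspace \<Rightarrow> 'a"
  have nz: "generically (UNIV :: ('a, 2) pspace set) (\<lambda>P. rep_pspace P $ 2 \<noteq> 0)"
  proof -
    have "rep_pspace (pt (vector [0, 1] :: 'a ^ 2)) $ 2 \<noteq> 0"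
    proof -
      have "(vector [0, 1] :: 'a ^ 2) \<noteq> 0" by (simp add: vec_eq_iff forall_2)
      from pt_in_nz[OF form_fun_coord this, of 2] show ?thesis by (simp add: in_nz_iff[OF form_fun_coord])
    qed
    from generically_coord_nonzero[OF UNIV_I this] show ?thesis .
  qed
  have u: "generically V (regular_at V (\<lambda>P. ?u (q P)))"
    by (rule dominant_ratfun_comp[OF V dq coord_ratio_ratfun[OF nz]])
  have "rational_function V (\<lambda>P. ?u (q P)) \<in> fixed_field V G" unfolding fixed_field_def
  proof (intro CollectI conjI ballI)
    show "rational_function V (\<lambda>P. ?u (q P)) \<in> carrier (function_field V)" using u by (auto simp: function_field_carrier)
    fix \<sigma> assume s: "\<sigma> \<in> G"
    then have "dominant V \<sigma> V" using Aut_dominant[OF V] subgroup.subset[OF G] by blast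
    then show "pullback V \<sigma> (rational_function V (\<lambda>P. ?u (q P))) = rational_function V (\<lambda>P. ?u (q P))"
      using inv[OF s] by (simp add: pullback_rational_function[OF V V] rational_function_eq_iff[OF V] generically_all[OF V])
  qed
  then have "rational_function V (\<lambda>P. ?u (q P)) \<in> constants V" using gc by blast
  then obtain b where "rational_function V (\<lambda>P. ?u (q P)) = rational_function V (\<lambda>P. b)"
    unfolding constants_def by blast
  then have b: "generically V (\<lambda>P. ?u (q P) = b)" by (simp add: rational_function_eq_iff[OF V])
  \<comment> \<open>The linear form whose zero is the point with affine coordinate b. It is nonzero
    at (1:0), hence generically on the line, and dominance carries this back to V.\<close>
  have t: "form_fun 1 (\<lambda>v :: 'a ^ 2. v $ 1 - b * v $ 2)"
    by (intro form_fun_diff form_fun_cmult form_fun_coord)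
  have "(vector [1, 0] :: 'a ^ 2) \<noteq> 0" by (simp add: vec_eq_iff forall_2)
  then have "pt (vector [1, 0]) \<in> nz (\<lambda>v :: 'a ^ 2. v $ 1 - b * v $ 2)" by (simp add: pt_in_nz[OF t])
  then have "generically (UNIV :: ('a, 2) pspace set) (\<lambda>P. P \<in> nz (\<lambda>v. v $ 1 - b * v $ 2))"
    by (intro generically_nz[OF t]) blast
  from generically_conj[OF V dominantD[OF dq this] generically_conj[OF V dominantD[OF dq nz] b]]
  obtain P where "q P \<in> nz (\<lambda>v. v $ 1 - b * v $ 2)" "rep_pspace (q P) $ 2 \<noteq> 0" "?u (q P) = b"
    using generically_ex by blast
  then show False by (simp add: in_nz_iff[OF t] coord_ratio_def field_simps)
qed

text \<open>Its rows select coordinates i and 3. The kernel is the centre of projection: (0:1:0) for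
  i = 1 and (1:0:0) for i = 2.\<close>

definition proj_matrix :: "3 \<Rightarrow> 'a::field ^ 3 ^ 2" where
  "proj_matrix i = (\<chi> r. if r = 1 then axis i 1 else axis 3 1)"

lemma proj_matrix_mult: "proj_matrix i *v v = (\<chi> r. v $ (if r = 1 then i else 3))"
proof -
  have "(\<Sum>j\<in>UNIV. axis k 1 $ j * v $ j) = v $ k" for k
    using sum.remove[of UNIV k "\<lambda>j. axis k 1 $ j * v $ j"] by (simp add: axis_def)
  then show ?thesis by (simp add: vec_eq_iff proj_matrix_def matrix_vector_mult_def)
qed

text \<open>Both Galois points are covered by letting i vary: h is the i-th affine coordinate of the
  plane map, w its affine representative, and Z is described by its linear equations. The image has
  the same function field as C by \<open>surj\<close>, which is where the action of G is
  transported.\<close>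

lemma galois_point_rational_image:
  fixes C :: "('a::alg_closed_field, 'n::finite) pspace set" and i :: 3
  assumes C: "projective_variety C" and \<phi>: "generically C (regular_map_at C \<phi>)"
    and surj: "pullback C \<phi> ` carrier (function_field (rational_image C \<phi>)) = carrier (function_field C)"
    and G: "subgroup G (Aut_var C)" "finite G" and quot: "quotient_is_P1 C G"
    and h: "generically C (regular_at C h)"
    and gen: "generate_field (function_field C) (insert (rational_function C h) (constants C)) = fixed_field C G"
    and w: "\<And>P. \<phi> P = pt (w P)" "\<And>P. w P $ 3 = 1" "\<And>P. w P $ i = h P"
    and Z: "\<And>v. v \<noteq> 0 \<Longrightarrow> pt v = Z \<longleftrightarrow> v $ i = 0 \<and> v $ 3 = 0"
  shows "galois_point (rational_image C \<phi>) Z"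
proof -
  define D where "D = rational_image C \<phi>"
  define A :: "'a ^ 3 ^ 2" where "A = proj_matrix i"
  \<comment> \<open>At the centre Z this is the junk value \<open>pt 0\<close>, which
    \<open>projection_from\<close> leaves free.\<close>
  define \<pi> :: "('a, 3) pspace \<Rightarrow> ('a, 2) pspace" where "\<pi> Q = pt (A *v rep_pspace Q)" for Q
  note im = rational_image_dominant[OF C \<phi>, folded D_def]
  note D = im(1) and d\<phi> = im(2)
  have A0: "A *v v = 0 \<longleftrightarrow> v $ i = 0 \<and> v $ 3 = 0" for v
    by (simp add: A_def proj_matrix_mult vec_eq_iff forall_2)
  have \<pi>: "\<pi> (pt v) = pt (A *v v)" if v: "v \<noteq> 0" "A *v v \<noteq> 0" for v
  proof -
    obtain c where c: "c \<noteq> 0" "rep_pspace (pt v) = c *s v" by (rule rep_pspace_pt[OF v(1)])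
    have "A *v (c *s v) = c *s (A *v v)" by (simp add: A_def proj_matrix_mult vec_eq_iff)
    then show ?thesis using pt_scale[OF c(1) v(2)] by (simp add: \<pi>_def c(2))
  qed
  have w0: "w P \<noteq> 0" for P using w(2)[of P] by auto
  have Aw0: "A *v w P \<noteq> 0" for P using w(2)[of P] by (simp add: A0)
  have \<pi>\<phi>: "\<pi> (\<phi> P) = pt (vector [h P, 1])" for P
  proof -
    have "A *v w P = vector [h P, 1]" using w(2,3)[of P] by (simp add: A_def proj_matrix_mult vec_eq_iff forall_2)
    then show ?thesis using \<pi>[OF w0 Aw0] w(1) by simp
  qed
  have v0: "(vector [a, 1] :: 'a ^ 2) \<noteq> 0" for a by (simp add: vec_eq_iff forall_2)
  have proj: "projection_from Z \<pi>" unfolding projection_from_def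
    using Z A0 \<pi> by (intro exI[of _ A]) auto
  have D3: "generically D (\<lambda>Q. rep_pspace Q $ 3 \<noteq> 0)"
  proof -
    obtain P where P: "\<phi> P \<in> D" using im(3) generically_ex by blast
    have "\<phi> P \<in> nz (\<lambda>v. v $ 3)" using w(1,2)[of P] pt_in_nz[OF form_fun_coord w0[of P], of 3] by simp
    with generically_coord_nonzero[OF P] show ?thesis by (simp add: in_nz_iff[OF form_fun_coord])
  qed
  have r\<pi>: "generically D (regular_map_at D \<pi>)"
  proof (rule ratmapI[where A = "\<lambda>r v. v $ (if r = 1 then i else 3)", OF form_fun_coord], rule generically_mono[OF D3])
    fix Q :: "('a, 3) pspace" assume Q: "rep_pspace Q $ 3 \<noteq> 0"
    have e: "(\<chi> r :: 2. rep_pspace Q $ (if r = 1 then i else 3)) = A *v rep_pspace Q" by (simp add: A_def proj_matrix_mult)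
    show "(\<chi> r :: 2. rep_pspace Q $ (if r = 1 then i else 3)) \<noteq> 0 \<and> \<pi> Q = pt (\<chi> r. rep_pspace Q $ (if r = 1 then i else 3))"
      unfolding e using Q by (simp add: A0 \<pi>_def)
  qed
  note im\<pi> = rational_image_dominant[OF D r\<pi>]
  let ?I = "rational_image D \<pi>"
  note P1 = projective_variety_P1[where 'a = 'a]
  note nonconst = generator_nonconstant[OF C G(1) quot gen]
  \<comment> \<open>If the closed image missed a point, a form t would vanish on the image without
    being zero; the values of h would generically lie among its finitely many affine zeros, and h
    would be constant.\<close>
  have I: "?I = UNIV"
  proof (rule ccontr)
    assume "?I \<noteq> UNIV"
    then obtain Q where Q: "Q \<notin> ?I" by blast
    have "zclosed ?I" using im\<pi>(1) by (simp add: projective_variety_def)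
    then obtain e t where t: "form_fun e t" "Q \<in> nz t" "?I \<inter> nz t = {}"
      using Q unfolding zclosed_iff by blast
    have fin: "finite {a. t (vector [a, 1]) = 0}" using t(2) by (intro finite_affine_zeros[OF t(1)]) blast
    have "generically C (\<lambda>P. h P \<in> {a. t (vector [a, 1]) = 0})"
    proof (rule generically_mono[OF dominantD[OF d\<phi> im\<pi>(3)]])
      fix P assume "\<pi> (\<phi> P) \<in> ?I"
      then have "pt (vector [h P, 1]) \<notin> nz t" using t(3) unfolding \<pi>\<phi> by blast
      then show "h P \<in> {a. t (vector [a, 1]) = 0}" using pt_in_nz[OF t(1) v0] by simp
    qed
    from generically_in_finite_const[OF C h fin this] nonconst show False by blast
  qed
  note d\<pi> = im\<pi>(2)[unfolded I]
  note d\<pi>\<phi> = dominant_comp[OF C d\<phi> d\<pi>]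
  interpret R: Ring.field "function_field D" by (rule field_function_field[OF D])
  interpret K: Ring.field "function_field C" by (rule field_function_field[OF C])
  note iso = pullback_iso[OF C D d\<phi> surj[folded D_def]]
  note fam = Aut_pullback_family[OF C G]
  note tr = endo_family_transport[OF R.ring_axioms iso fam(1)]
  define M where "M = pullback D \<pi> ` carrier (function_field (UNIV :: ('a, 2) pspace set))"
  have comp: "pullback C \<phi> (pullback D \<pi> c) = pullback C (\<lambda>P. \<pi> (\<phi> P)) c"
    if "c \<in> carrier (function_field UNIV)" for c
    by (rule pullback_comp[OF C D P1 d\<phi> d\<pi> that])
  have hF: "rational_function C h \<in> fixed_field C G"
    using generate_field.incl[of "rational_function C h"] unfolding gen[symmetric] by blast
  have dG: "dominant C \<sigma> C" if "\<sigma> \<in> G" for \<sigma>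
    using Aut_dominant[OF C] subgroup.subset[OF G(1)] that by blast
  have "x \<in> M \<longleftrightarrow> x \<in> carrier (function_field D) \<and> pullback C \<phi> x \<in> fixed_field C G" for x
  proof
    assume "x \<in> M"
    then obtain c where c: "c \<in> carrier (function_field UNIV)" "x = pullback D \<pi> c" by (auto simp: M_def)
    have x: "x \<in> carrier (function_field D)"
      using ring_hom_memE(1)[OF pullback_hom[OF D P1 d\<pi>] c(1)] c(2) by simp
    moreover have "pullback C \<phi> x \<in> fixed_field C G" unfolding fixed_field_def
    proof (intro CollectI conjI ballI)
      show "pullback C \<phi> x \<in> carrier (function_field C)" by (rule ring_hom_memE(1)[OF pullback_hom[OF C D d\<phi>] x])
      fix \<sigma> assume s: "\<sigma> \<in> G"
      have "pullback C \<sigma> (rational_function C h) = rational_function C h"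
        using hF s by (simp add: fixed_field_def)
      then have "generically C (\<lambda>P. h (\<sigma> P) = h P)"
        by (simp add: pullback_rational_function[OF C C dG[OF s]] rational_function_eq_iff[OF C])
      \<comment> \<open>The projected point is (h P : 1), so it inherits the invariance of
        h.\<close>
      then have "generically C (\<lambda>P. \<pi> (\<phi> (\<sigma> P)) = \<pi> (\<phi> P))"
        by (rule generically_mono) (simp add: \<pi>\<phi>)
      from pullback_cong[OF C P1 dominant_comp[OF C dG[OF s] d\<pi>\<phi>] d\<pi>\<phi> this c(1)]
      show "pullback C \<sigma> (pullback C \<phi> x) = pullback C \<phi> x"
        using pullback_comp[OF C C P1 dG[OF s] d\<pi>\<phi> c(1)] by (simp add: c(2) comp[OF c(1)])
    qed
    ultimately show "x \<in> carrier (function_field D) \<and> pullback C \<phi> x \<in> fixed_field C G" by blast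
  next
    assume x: "x \<in> carrier (function_field D) \<and> pullback C \<phi> x \<in> fixed_field C G"
    let ?L = "pullback C (\<lambda>P. \<pi> (\<phi> P)) ` carrier (function_field UNIV)"
    note sub = pullback_image_subfield[OF C P1 d\<pi>\<phi>]
    \<comment> \<open>h is the pull-back of the affine coordinate of the projective line. So ?L
      contains h and the constants, and therefore the whole fixed field that they generate.\<close>
    have "rational_function C h \<in> ?L"
    proof (rule image_eqI)
      have pi: "\<pi> (\<phi> P) \<in> nz (\<lambda>v. v $ 2)" for P by (simp add: \<pi>\<phi> pt_in_nz[OF form_fun_coord v0])
      have "rep_pspace (\<pi> (\<phi> P)) $ 2 \<noteq> 0" for P using pi by (simp add: in_nz_iff[OF form_fun_coord])
      from coord_ratio_ratfun[OF generically_coord_nonzero[OF UNIV_I this]]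
      show "rational_function UNIV (coord_ratio 1 2) \<in> carrier (function_field (UNIV :: ('a, 2) pspace set))"
        by (auto simp: function_field_carrier)
      show "rational_function C h = pullback C (\<lambda>P. \<pi> (\<phi> P)) (rational_function UNIV (coord_ratio 1 2))"
        unfolding pullback_rational_function[OF C P1 d\<pi>\<phi>] by (simp add: \<pi>\<phi> coord_ratio_pt[OF v0])
    qed
    then have gL: "insert (rational_function C h) (constants C) \<subseteq> ?L"
      using pullback_constants[OF C P1 d\<pi>\<phi>] by simp
    have "fixed_field C G \<subseteq> ?L" unfolding gen[symmetric]
      by (rule K.generate_field_min_subfield1[OF subset_trans[OF gL subringE(1)[OF subfieldE(1)[OF sub]]] sub gL])
    then have "pullback C \<phi> x \<in> ?L" using x by (rule subsetD[OF _ conjunct2])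
    then obtain c where c: "c \<in> carrier (function_field UNIV)" "pullback C \<phi> x = pullback C \<phi> (pullback D \<pi> c)"
      unfolding image_iff using comp by auto
    then have "x = pullback D \<pi> c"
      using inj_onD[OF pullback_inj[OF C D d\<phi>]] x ring_hom_memE(1)[OF pullback_hom[OF D P1 d\<pi>]] by blast
    then show "x \<in> M" using c(1) by (simp add: M_def)
  qed
  then have M: "M = fixed_points (function_field D)
      ((\<lambda>s x. inv_into (carrier (function_field D)) (pullback C \<phi>) (s (pullback C \<phi> x))) ` pullback C ` G)"
    unfolding tr(2) fam(2) by blast
  have "R.galois_over M"
    unfolding R.galois_over_def M using R.artin[OF tr(1)] by blast
  then show ?thesis unfolding galois_point_def D_def[symmetric]
    using proj r\<pi> I R.field_axioms by (intro exI[of _ \<pi>]) (simp add: rational_map_def M_def)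
qed

text \<open>The coordinate ratios of C are pull-backs of rational functions on the image; these
  functions, used as homogeneous coordinates, define the inverse map.\<close>

lemma birational_if_pullback_surjective:
  fixes C :: "('a::field, 'n::finite) pspace set" and \<phi> :: "('a, 'n) pspace \<Rightarrow> ('a, 'm::finite) pspace"
  assumes C: "projective_variety C" and \<phi>: "generically C (regular_map_at C \<phi>)"
    and surj: "pullback C \<phi> ` carrier (function_field (rational_image C \<phi>)) = carrier (function_field C)"
  shows "birational_onto_image C \<phi>"
proof -
  define D where "D = rational_image C \<phi>"
  note im = rational_image_dominant[OF C \<phi>, folded D_def]
  note D = im(1) and d\<phi> = im(2)
  obtain j where j: "generically C (\<lambda>P. rep_pspace P $ j \<noteq> 0)" by (rule ex_coord_nonzero[OF C])
  have "\<exists>h. generically D (regular_at D h) \<and> generically C (\<lambda>P. h (\<phi> P) = coord_ratio i j P)" for i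
  proof -
    have "rational_function C (coord_ratio i j) \<in> carrier (function_field C)"
      using coord_ratio_ratfun[OF j] by (auto simp: function_field_carrier)
    then obtain y where y: "y \<in> carrier (function_field D)" "rational_function C (coord_ratio i j) = pullback C \<phi> y"
      unfolding surj[symmetric] D_def by blast
    then obtain h where h: "generically D (regular_at D h)" "y = rational_function D h"
      by (auto simp: function_field_carrier)
    have "rational_function C (\<lambda>P. h (\<phi> P)) = rational_function C (coord_ratio i j)"
      using y(2) unfolding h(2) pullback_rational_function[OF C D d\<phi>] by simp
    then show ?thesis using h(1) unfolding rational_function_eq_iff[OF C] by blast
  qed
  then have "\<forall>i. \<exists>h. generically D (regular_at D h) \<and> generically C (\<lambda>P. h (\<phi> P) = coord_ratio i j P)" by blast
  from choice[OF this] obtain h where h: "\<And>i. generically D (regular_at D (h i))"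
    "\<And>i. generically C (\<lambda>P. h i (\<phi> P) = coord_ratio i j P)" by blast
  \<comment> \<open>The ratio of coordinate j to itself is 1, but \<open>h j\<close> equals 1 only
    generically. Replacing it by the constant 1 makes the coordinate vector nonzero
    everywhere.\<close>
  define k where "k i = (if i = j then (\<lambda>Q. 1) else h i)" for i
  define \<psi> where "\<psi> Q = pt (\<chi> i. k i Q)" for Q
  have k: "generically D (regular_at D (k i))" for i
    using h(1) ratfun_const[OF D] by (simp add: k_def)
  have "(\<chi> i. k i Q) \<noteq> 0" for Q by (auto simp: vec_eq_iff k_def intro!: exI[of _ j])
  then have r\<psi>: "generically D (regular_map_at D \<psi>)"
    unfolding \<psi>_def by (intro ratmap_of_ratfuns[OF D k] generically_all[OF D])
  have "generically C (\<lambda>P. \<forall>i\<in>UNIV. h i (\<phi> P) = coord_ratio i j P)"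
    by (rule generically_ball_finite[OF C finite h(2)])
  from this j have \<psi>\<phi>: "generically C (\<lambda>P. \<psi> (\<phi> P) = P)"
  proof (rule generically_mp[OF C])
    fix P assume e: "\<forall>i\<in>UNIV. h i (\<phi> P) = coord_ratio i j P" and nz: "rep_pspace P $ j \<noteq> 0"
    have "k i (\<phi> P) = coord_ratio i j P" for i using e nz by (simp add: k_def coord_ratio_def)
    then show "\<psi> (\<phi> P) = P" using pt_coord_ratios(2)[OF nz] by (simp add: \<psi>_def)
  qed
  have id: "dominant C (\<lambda>P. P) C" using ratmap_id[OF C] by (simp add: dominant_def)
  have I: "rational_image D \<psi> = C"
    by (rule rational_image_eqI[OF C D C d\<phi> r\<psi> id \<psi>\<phi>]) (rule generically_all[OF C])
  note im\<psi> = rational_image_dominant[OF D r\<psi>, unfolded I]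
  \<comment> \<open>The other composite follows by cancelling the dominant \<phi>, since \<phi>
    \<psi> \<phi> = \<phi> generically on C.\<close>
  have "generically D (\<lambda>Q. \<phi> (\<psi> Q) = Q)"
    by (rule dominant_agree[OF C D d\<phi> dominant_ratmap_comp[OF D im\<psi>(2) \<phi>] ratmap_id[OF D]])
      (rule generically_mono[OF \<psi>\<phi>], simp)
  then show ?thesis unfolding birational_onto_image_def D_def[symmetric] rational_map_def
    using \<psi>\<phi> generically_conj[OF C \<phi> im(3)] generically_conj[OF D r\<psi> im\<psi>(3)]
    by (intro conjI exI[of _ \<psi>])
qed

text \<open>The pulled-back field contains the constants and, as affine coordinates of the plane, f
  and g. So it contains both fixed fields, and \<open>subfield_eq_carrier\<close> applies; equal
  pull-backs from G1 and G2 come from one automorphism by faithfulness, which \<open>triv\<close>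
  makes the identity.\<close>

lemma plane_map_pullback_surjective:
  fixes C :: "('a::alg_closed_field, 'n::finite) pspace set"
  assumes C: "projective_variety C"
    and G1: "subgroup G1 (Aut_var C)" "finite G1" and G2: "subgroup G2 (Aut_var C)" "finite G2"
    and triv: "G1 \<inter> G2 = {\<one>\<^bsub>Aut_var C\<^esub>}"
    and f: "generically C (regular_at C f)" and g: "generically C (regular_at C g)"
    and gen1: "generate_field (function_field C) (insert (rational_function C f) (constants C)) = fixed_field C G1"
    and gen2: "generate_field (function_field C) (insert (rational_function C g) (constants C)) = fixed_field C G2"
  defines "\<phi> \<equiv> plane_map f g"
  shows "generically C (regular_map_at C \<phi>)"
    "pullback C \<phi> ` carrier (function_field (rational_image C \<phi>)) = carrier (function_field C)"
proof -
  let ?w = "\<lambda>P. vector [f P, g P, 1] :: 'a ^ 3"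
  have w: "?w P \<noteq> 0" for P by (simp add: vec_eq_iff forall_3)
  have e: "?w P = (\<chi> i. (if i = 1 then f else if i = 2 then g else (\<lambda>P. 1)) P)" for P
    by (simp add: vec_eq_iff forall_3)
  show \<phi>: "generically C (regular_map_at C \<phi>)"
  proof -
    have "generically C (regular_map_at C (\<lambda>P. pt (\<chi> i :: 3. (if i = 1 then f else if i = 2 then g else (\<lambda>P. 1)) P)))"
    proof (rule ratmap_of_ratfuns[OF C])
      show "generically C (regular_at C (if i = 1 then f else if i = 2 then g else (\<lambda>P. 1)))" for i :: 3
        using f g ratfun_const[OF C] by simp
      show "generically C (\<lambda>P. (\<chi> i :: 3. (if i = 1 then f else if i = 2 then g else (\<lambda>P. 1)) P) \<noteq> 0)"
        unfolding e[symmetric] by (rule generically_all[OF C w])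
    qed
    moreover have "\<phi> = (\<lambda>P. pt (\<chi> i :: 3. (if i = 1 then f else if i = 2 then g else (\<lambda>P. 1)) P))"
      unfolding e[symmetric] by (rule ext) (simp add: \<phi>_def plane_map_def)
    ultimately show ?thesis by simp
  qed
  define D where "D = rational_image C \<phi>"
  note im = rational_image_dominant[OF C \<phi>, folded D_def]
  note D = im(1) and d\<phi> = im(2)
  let ?L = "pullback C \<phi> ` carrier (function_field D)"
  note sub = pullback_image_subfield[OF C D d\<phi>]
  have Lc: "?L \<subseteq> carrier (function_field C)" using subringE(1)[OF subfieldE(1)[OF sub]] .
  note kL = pullback_constants[OF C D d\<phi>]
  interpret K: Ring.field "function_field C" by (rule field_function_field[OF C])
  have D3: "generically D (\<lambda>Q. rep_pspace Q $ 3 \<noteq> 0)"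
  proof -
    obtain P where P: "\<phi> P \<in> D" using im(3) generically_ex by blast
    have "\<phi> P \<in> nz (\<lambda>v. v $ 3)"
      using pt_in_nz[OF form_fun_coord w[of P], of 3] by (simp add: \<phi>_def plane_map_def)
    with generically_coord_nonzero[OF P] show ?thesis by (simp add: in_nz_iff[OF form_fun_coord])
  qed
  \<comment> \<open>Since the third coordinate of the plane map is 1, dividing by coordinate 3 on
    the image returns the components f and g themselves.\<close>
  have ratio: "rational_function C (\<lambda>P. ?w P $ i) \<in> ?L" for i
  proof (rule image_eqI)
    show "rational_function D (coord_ratio i 3) \<in> carrier (function_field D)"
      using coord_ratio_ratfun[OF D3] by (auto simp: function_field_carrier)
    show "rational_function C (\<lambda>P. ?w P $ i) = pullback C \<phi> (rational_function D (coord_ratio i 3))"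
      unfolding pullback_rational_function[OF C D d\<phi>] by (simp add: \<phi>_def plane_map_def coord_ratio_pt[OF w])
  qed
  have fL: "rational_function C f \<in> ?L" using ratio[of 1] by simp
  have gL: "rational_function C g \<in> ?L" using ratio[of 2] by simp
  have F1: "fixed_field C G1 \<subseteq> ?L"
    unfolding gen1[symmetric] by (rule K.generate_field_min_subfield1[OF _ sub]) (use fL kL Lc in blast)+
  have F2: "fixed_field C G2 \<subseteq> ?L"
    unfolding gen2[symmetric] by (rule K.generate_field_min_subfield1[OF _ sub]) (use gL kL Lc in blast)+
  note fam1 = Aut_pullback_family[OF C G1] and fam2 = Aut_pullback_family[OF C G2]
  have "?L = carrier (function_field C)"
  proof (rule K.subfield_eq_carrier[OF fam1(1) fam2(1) sub _ _ infinite_constants[OF C]], unfold fam1(2) fam2(2))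
    show "fixed_field C G1 \<subseteq> ?L" "fixed_field C G2 \<subseteq> ?L" by (fact F1 F2)+
    show "constants C \<subseteq> fixed_field C G1" unfolding gen1[symmetric] by (auto intro: generate_field.incl)
    show "constants C \<subseteq> fixed_field C G2" unfolding gen2[symmetric] by (auto intro: generate_field.incl)
    fix s t assume "s \<in> pullback C ` G1" "t \<in> pullback C ` G2"
      and st: "\<forall>x\<in>carrier (function_field C). s x = t x"
    then obtain \<sigma> \<tau> where \<sigma>: "\<sigma> \<in> G1" "s = pullback C \<sigma>" and \<tau>: "\<tau> \<in> G2" "t = pullback C \<tau>" by blast
    have "\<sigma> \<in> carrier (Aut_var C)" "\<tau> \<in> carrier (Aut_var C)"
      using \<sigma>(1) \<tau>(1) subgroup.subset[OF G1(1)] subgroup.subset[OF G2(1)] by blast+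
    then have "\<sigma> = \<tau>" by (rule Aut_pullback_faithful[OF C]) (use st \<sigma>(2) \<tau>(2) in simp)
    then have "\<sigma> = \<one>\<^bsub>Aut_var C\<^esub>" using triv \<sigma>(1) \<tau>(1) by blast
    then show "\<forall>x\<in>carrier (function_field C). s x = x" using fam1(3) \<sigma>(2) by simp
  qed
  then show "pullback C \<phi> ` carrier (function_field (rational_image C \<phi>)) = carrier (function_field C)"
    by (simp add: D_def)
qed

lemma rational_function_representative:
  assumes V: "projective_variety V" and c: "c \<in> carrier (function_field V)" and h: "h \<in> c"
  shows "generically V (regular_at V h)" "c = rational_function V h"
proof -
  obtain h' where h': "generically V (regular_at V h')" "c = rational_function V h'"
    using c by (auto simp: function_field_carrier)
  then have e: "generically V (\<lambda>P. h P = h' P)" using h by (simp add: rational_function_eq)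
  show "generically V (regular_at V h)" by (rule ratfun_cong[OF V h'(1) e])
  show "c = rational_function V h" using e h'(2) rational_function_eq_iff[OF V] by metis
qed

theorem proposition1:
  fixes C :: "('a::alg_closed_field, 'n::finite) pspace set"
    and G1 G2 :: "(('a, 'n) pspace \<Rightarrow> ('a, 'n) pspace) set"
    and f g :: "(('a, 'n) pspace \<Rightarrow> 'a) set"
    and f0 g0 :: "('a, 'n) pspace \<Rightarrow> 'a"
  assumes "smooth_projective_curve C"
    and "subgroup G1 (Aut_var C)" and "finite G1"
    and "subgroup G2 (Aut_var C)" and "finite G2"
    and "G1 \<inter> G2 = {\<one>\<^bsub>Aut_var C\<^esub>}"
    and "quotient_is_P1 C G1" and "quotient_is_P1 C G2"
    and "f \<in> carrier (function_field C)"
    and "generate_field (function_field C) (insert f (constants C)) = fixed_field C G1"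
    and "g \<in> carrier (function_field C)"
    and "generate_field (function_field C) (insert g (constants C)) = fixed_field C G2"
    and "f0 \<in> f" and "g0 \<in> g"
  shows "birational_onto_image C (plane_map f0 g0)
    \<and> galois_point (rational_image C (plane_map f0 g0)) (pt (vector [0, 1, 0]))
    \<and> galois_point (rational_image C (plane_map f0 g0)) (pt (vector [1, 0, 0]))"
proof -
  have C: "projective_variety C" using assms(1) by (simp add: smooth_projective_curve_def)
  note f = rational_function_representative[OF C assms(9,13)]
  note g = rational_function_representative[OF C assms(11,14)]
  note gen1 = assms(10)[unfolded f(2)] and gen2 = assms(12)[unfolded g(2)]
  note \<phi> = plane_map_pullback_surjective[OF C assms(2-6) f(1) g(1) gen1 gen2]
  have v: "pt v = pt (vector [a, b, 0]) \<longleftrightarrow> (\<exists>c. c \<noteq> 0 \<and> vector [a, b, 0] = c *s v)"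
    if "v \<noteq> 0" "a \<noteq> 0 \<or> b \<noteq> 0" for v :: "'a ^ 3" and a b
    by (rule pt_eq_iff[OF that(1)]) (use that(2) in \<open>auto simp: vec_eq_iff forall_3\<close>)
  have "galois_point (rational_image C (plane_map f0 g0)) (pt (vector [0, 1, 0]))"
  proof (rule galois_point_rational_image[OF C \<phi> assms(2,3,7) f(1) gen1 plane_map_def])
    fix v :: "'a ^ 3" assume v0: "v \<noteq> 0"
    \<comment> \<open>The surviving coordinate is nonzero, so its inverse is the scalar taking v to
      the standard representative of the point.\<close>
    have "v $ 1 = 0 \<and> v $ 3 = 0 \<Longrightarrow> v $ 2 \<noteq> 0" using v0 by (auto simp: vec_eq_iff forall_3)
    then show "pt v = pt (vector [0, 1, 0]) \<longleftrightarrow> v $ 1 = 0 \<and> v $ 3 = 0"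
      unfolding v[OF v0 disjI2[OF one_neq_zero]]
      by (auto simp: vec_eq_iff forall_3 intro!: exI[of _ "inverse (v $ 2)"])
  qed simp_all
  moreover have "galois_point (rational_image C (plane_map f0 g0)) (pt (vector [1, 0, 0]))"
  proof (rule galois_point_rational_image[OF C \<phi> assms(4,5,8) g(1) gen2 plane_map_def])
    fix v :: "'a ^ 3" assume v0: "v \<noteq> 0"
    have "v $ 2 = 0 \<and> v $ 3 = 0 \<Longrightarrow> v $ 1 \<noteq> 0" using v0 by (auto simp: vec_eq_iff forall_3)
    then show "pt v = pt (vector [1, 0, 0]) \<longleftrightarrow> v $ 2 = 0 \<and> v $ 3 = 0"
      unfolding v[OF v0 disjI1[OF one_neq_zero]]
      by (auto simp: vec_eq_iff forall_3 intro!: exI[of _ "inverse (v $ 1)"])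
  qed simp_all
  ultimately show ?thesis using birational_if_pullback_surjective[OF C \<phi>] by blast
qed

end
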